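(* Let $\mu$ be a Borel probability measure on $\mathbb{C}$, let $X_1,X_2,\ldots$ be i.i.d. random variables with law $\mu$, and let $P_n(z)=(z-X_1)\cdots(z-X_n)$. Let $k=k(n)$ be a sequence of positive integers with $k(n)<n$ and satisfying $k(n)\le \frac{\log n}{5\log\log n}$ for all sufficiently large $n$. Let $$\mu_n^{(k)}=\frac{1}{n-k}\sum_{z\in\mathbb{C}:\,P_n^{(k)}(z)=0}\delta_z$$ be the empirical measure of the zeros (counted with multiplicity) of the $k$-th derivative $P_n^{(k)}$, with $k=k(n)$. Then $\mu_n^{(k)}\to\mu$ in probability as $n\to\infty$.
   Context: $P_n^{(k)}$ denotes the $k$-th derivative of $P_n$. Convergence in probability of the random probability measures $\mu_n^{(k)}$ to the deterministic measure $\mu$ is with respect to weak convergence: for every bounded continuous $\varphi:\mathbb{C}\to\mathbb{R}$, $\int\varphi\,d\mu_n^{(k)}\to\int\varphi\,d\mu$ in probability as $n\to\infty$. *)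

theory Defs
  imports "HOL-Probability.Probability" "HOL-Computational_Algebra.Computational_Algebra"
begin

(* The measurability conjunct is part of the notion: on a non-measurable set Sigma_Algebra's
   measure is 0 by convention, so without it the limit alone could hold vacuously. *)
definition tendsto_in_prob :: "'a measure \<Rightarrow> (nat \<Rightarrow> 'a \<Rightarrow> real) \<Rightarrow> ('a \<Rightarrow> real) \<Rightarrow> bool" where
  "tendsto_in_prob M Y Z \<longleftrightarrow>
     (\<forall>n. Y n \<in> borel_measurable M) \<and> Z \<in> borel_measurable M \<and>
     (\<forall>\<epsilon>>0. (\<lambda>n. measure M {\<omega> \<in> space M. \<bar>Y n \<omega> - Z \<omega>\<bar> > \<epsilon>}) \<longlonglongrightarrow> 0)"

definition weakly_tendsto_in_prob ::
  "'a measure \<Rightarrow> (nat \<Rightarrow> 'a \<Rightarrow> complex measure) \<Rightarrow> complex measure \<Rightarrow> bool" where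
  "weakly_tendsto_in_prob M N \<mu> \<longleftrightarrow>
     (\<forall>\<phi> :: complex \<Rightarrow> real. continuous_on UNIV \<phi> \<longrightarrow> bounded (range \<phi>) \<longrightarrow>
        tendsto_in_prob M (\<lambda>n \<omega>. \<integral>z. \<phi> z \<partial>N n \<omega>) (\<lambda>\<omega>. \<integral>z. \<phi> z \<partial>\<mu>))"

definition random_poly :: "(nat \<Rightarrow> 'a \<Rightarrow> complex) \<Rightarrow> nat \<Rightarrow> 'a \<Rightarrow> complex poly" where
  "random_poly X n \<omega> = (\<Prod>i=1..n. [:- X i \<omega>, 1:])"

(* The Borel measure (1/d) * (sum of the Dirac measures at the zeros of p, a zero z
   being repeated order z p times).  Meant for p \<noteq> 0 and d = degree p > 0. *)
definition zeros_measure :: "nat \<Rightarrow> complex poly \<Rightarrow> complex measure" where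
  "zeros_measure d p =
     distr (point_measure {z. poly p z = 0} (\<lambda>z. ennreal (real (order z p) / real d)))
           borel (\<lambda>z. z)"

definition empirical_zeros ::
  "(nat \<Rightarrow> 'a \<Rightarrow> complex) \<Rightarrow> nat \<Rightarrow> nat \<Rightarrow> 'a \<Rightarrow> complex measure" where
  "empirical_zeros X n k \<omega> = zeros_measure (n - k) ((pderiv ^^ k) (random_poly X n \<omega>))"

lemma emeasure_zeros_measure:
  assumes "p \<noteq> 0" "A \<in> sets borel"
  shows "emeasure (zeros_measure d p) A =
           (\<Sum>z | poly p z = 0. ennreal (real (order z p) / real d) * indicator A z)"
proof -
  let ?R = "{z. poly p z = 0}" and ?f = "\<lambda>z. ennreal (real (order z p) / real d)"
  have fin: "finite ?R" using assms(1) by (rule poly_roots_finite)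
  have "emeasure (zeros_measure d p) A = emeasure (point_measure ?R ?f) (A \<inter> ?R)"
    unfolding zeros_measure_def using assms(2)
    by (subst emeasure_distr) (auto simp: measurable_point_measure_eq1 space_point_measure)
  also have "\<dots> = (\<Sum>z\<in>A \<inter> ?R. ?f z)"
    using fin by (intro emeasure_point_measure_finite) auto
  also have "\<dots> = (\<Sum>z\<in>?R. ?f z * indicator A z)"
    using fin by (intro sum.mono_neutral_cong_left) (auto simp: indicator_def)
  finally show ?thesis .
qed

lemma integral_zeros_measure:
  fixes \<phi> :: "complex \<Rightarrow> real"
  assumes "p \<noteq> 0" "\<phi> \<in> borel_measurable borel"
  shows "(\<integral>z. \<phi> z \<partial>zeros_measure d p) =
           (\<Sum>z | poly p z = 0. real (order z p) * \<phi> z) / real d"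
proof -
  have fin: "finite {z. poly p z = 0}" using assms(1) by (rule poly_roots_finite)
  show ?thesis
    unfolding zeros_measure_def using assms(2) fin
    by (subst integral_distr)
       (auto simp: measurable_point_measure_eq1 lebesgue_integral_point_measure_finite
             sum_divide_distrib)
qed

end

theory Submission
  imports Defs "HOL-Complex_Analysis.Conformal_Mappings" "HOL-Real_Asymp.Real_Asymp"
    "Jordan_Normal_Form.Determinant"
begin

text \<open>
  Write \<open>P^(k)(z) = k! P(z) e_k(Y)\<close> with \<open>Y_i = 1 / (z - X_i)\<close> and \<open>e_k\<close> the elementary symmetric
  function.

  \<^bold>\<open>Anticoncentration.\<close> For fixed \<open>z\<close> the probability of \<open>|e_k(Y)| \<le> exp (- \<epsilon> n)\<close> tends to 0. Pair
  \<open>Y_i\<close> with an independent copy and choose one of the two by a coin. If the pairs that lie in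
  \<open>B \<times> A\<close>, for two small and well separated sets \<open>A\<close>, \<open>B\<close> of diameter about \<open>1/k^2\<close>, are indexed by
  \<open>G\<close>, then along a chain of \<open>k + 1\<close> subsets of \<open>G\<close> the values of \<open>e_k\<close> cannot all be tiny: the
  determinant of \<open>e_0, ..., e_k\<close> along the chain is a sum of products of differences \<open>b - a\<close>, all of
  nearly the same argument. By the LYM inequality the tiny values have probability
  \<open>O(k / sqrt |G|)\<close>.

  \<^bold>\<open>Comparison of potentials.\<close> For almost every radius \<open>R\<close> the averages of \<open>ln max(|w - a|, R)\<close>
  over the zeros of \<open>P^(k)\<close> and over the \<open>X_i\<close> are close. The upper bound is the maximum modulus
  principle together with the trivial bound for \<open>|e_k|\<close> on the circle, the lower bound follows from
  anticoncentration at finitely many points of the circle. Differences of two such functions have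
  compact support, and convolution with them approximates every continuous function of compact
  support.
\<close>

section \<open>Chains of sets and central binomial coefficients\<close>

text \<open>The degree k of e_k grows with n, so every bound has to be uniform in k. In the
  determinant with rows e_0, ..., e_k, smallness of the last column alone makes the whole
  determinant small, because the other entries are powers of n: off a rare event the sum of the
  |Y_i| is at most n^4. So |d|^(k(k+1)/2), with d a typical difference b - a, is compared with
  exp(-\<epsilon> n) n^(6 k^2), and for k <= ln n the exponential wins. The diameter 1/k^2 keeps the
  relative error of a product of k(k+1)/2 differences bounded. It leaves A and B a mass of order
  k^(-4) each, hence |G| of order n k^(-8), and k / sqrt |G| is of order k^5 / sqrt n. If Y is
  almost surely constant there are no separated sets, and e_k is computed directly.

  The function ln max(|w - a|, R) is the mean of ln |z - w| over the circle |z - a| = R. The radius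
  is chosen so that the inverse square root of the distance to the circle is integrable for the law
  of X_i; this controls all 1 / |z - X_i| on the whole circle at once.\<close>

definition chain_in :: "'a set set \<Rightarrow> nat \<Rightarrow> (nat \<Rightarrow> 'a set) \<Rightarrow> bool" where
  "chain_in F k E \<longleftrightarrow> (\<forall>i\<le>k. E i \<in> F) \<and> (\<forall>i<k. E i \<subset> E (Suc i))"

text \<open>The LYM inequality for families without \<open>k + 1\<close> nested members
  (\<open>k\<close> counts inclusions). For S different from V the weight of S is the average over x
  in V of its weight in V - {x}, counted as 0 if x lies in S; so induction on |V| applies when V is
  not in F. If V is in F, it has weight 1 and extends every chain of the other members, which lowers
  \<open>k\<close> by one.\<close>

lemma sum_inverse_binomial_le:
  assumes "finite V" "F \<subseteq> Pow V" "\<nexists>E. chain_in F k E"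
  shows "(\<Sum>S\<in>F. 1 / real (card V choose card S)) \<le> real k"
  using assms
proof (induction "card V" arbitrary: V F k)
  case 0
  then have V: "V = {}" by simp
  have "chain_in F 0 (\<lambda>_. {})" if "{} \<in> F" using that by (auto simp: chain_in_def)
  then have "k = 0 \<Longrightarrow> F = {}" using 0 V by auto
  moreover have "F \<subseteq> {{}}" using 0 V by auto
  then have "F = {} \<or> F = {{}}" by blast
  ultimately show ?case using V by (cases k) auto
next
  case (Suc n)
  have fV: "finite F" using Suc.prems finite_subset by (metis finite_Pow_iff)
  have ne: "V \<noteq> {}" using Suc.hyps by auto
  have main: "(\<Sum>S\<in>F. 1 / real (card V choose card S)) \<le> real k"
    if F: "F \<subseteq> Pow V" "V \<notin> F" "\<nexists>E. chain_in F k E" for F :: "'a set set" and k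
  proof -
    have fF: "finite F" using F Suc.prems finite_subset by (metis finite_Pow_iff)
    have "(\<Sum>S\<in>F. 1 / real (card V choose card S)) =
      (\<Sum>S\<in>F. \<Sum>x\<in>V - S. 1 / real (card V * (n choose card S)))"
    proof (rule sum.cong[OF refl])
      fix S assume S: "S \<in> F"
      then have sV: "S \<subset> V" using F by auto
      have fS: "finite S" using sV Suc.prems finite_subset by blast
      have c: "card (V - S) = card V - card S" using sV fS by (simp add: card_Diff_subset)
      have lt: "card S < card V" using sV Suc.prems by (simp add: psubset_card_mono)
      have "(card V - card S) * (card V choose card S) = card V * (n choose card S)"
        using binomial_absorb_comp[of "card V" "card S"] Suc.hyps(2) by (metis diff_Suc_1)
      moreover have "(n choose card S) > 0" using lt Suc.hyps by simp
      moreover have "(card V choose card S) > 0" using lt by simp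
      ultimately have "1 / real (card V choose card S) = real (card V - card S) / real (card V * (n choose card S))"
        by (metis (no_types, lifting) lt nonzero_divide_mult_cancel_left of_nat_0_eq_iff of_nat_mult zero_less_diff not_gr_zero)
      then show "1 / real (card V choose card S) = (\<Sum>x\<in>V - S. 1 / real (card V * (n choose card S)))"
        by (simp add: c)
    qed
    also have "\<dots> = (\<Sum>x\<in>V. \<Sum>S\<in>{S\<in>F. x \<notin> S}. 1 / real (card V * (n choose card S)))"
    proof -
      have "(\<Sum>x\<in>V - S. 1 / real (card V * (n choose card S))) =
        (\<Sum>x\<in>V. if x \<notin> S then 1 / real (card V * (n choose card S)) else 0)" for S
        using Suc.prems(1) by (simp add: sum.If_cases Diff_eq Collect_neg_eq)
      then show ?thesis using fF Suc.prems(1)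
        by (simp only:) (subst sum.swap, simp add: sum.inter_filter[symmetric])
    qed
    also have "\<dots> \<le> (\<Sum>x\<in>V. real k / card V)"
    proof (rule sum_mono)
      fix x assume x: "x \<in> V"
      have "(\<Sum>S\<in>{S\<in>F. x \<notin> S}. 1 / real (card (V - {x}) choose card S)) \<le> real k"
      proof (rule Suc.hyps(1))
        show "n = card (V - {x})" using Suc.hyps x Suc.prems by simp
        show "finite (V - {x})" using Suc.prems by simp
        show "{S \<in> F. x \<notin> S} \<subseteq> Pow (V - {x})" using F by auto
        show "\<nexists>E. chain_in {S \<in> F. x \<notin> S} k E" using F(3) by (auto simp: chain_in_def)
      qed
      moreover have "card (V - {x}) = n" using Suc.hyps x Suc.prems by simp
      ultimately have "(\<Sum>S\<in>{S\<in>F. x \<notin> S}. 1 / real (n choose card S)) \<le> real k" by simp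
      then have "(\<Sum>S\<in>{S\<in>F. x \<notin> S}. 1 / real (n choose card S)) / card V \<le> real k / card V"
        by (rule divide_right_mono) simp
      then show "(\<Sum>S\<in>{S\<in>F. x \<notin> S}. 1 / real (card V * (n choose card S))) \<le> real k / card V"
        by (simp add: sum_divide_distrib mult.commute)
    qed
    also have "\<dots> = real k" using Suc.hyps(2) ne Suc.prems(1) by simp
    finally show ?thesis .
  qed
  show ?case
  proof (cases "V \<in> F")
    case False
    then show ?thesis using main[of F k] Suc.prems by blast
  next
    case True
    have "k \<noteq> 0"
    proof
      assume "k = 0"
      then have "chain_in F k (\<lambda>_. V)" using True by (auto simp: chain_in_def)
      then show False using Suc.prems by blast
    qed
    then obtain l where k: "k = Suc l" by (cases k) auto
    have "\<nexists>E. chain_in (F - {V}) l E"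
    proof
      assume "\<exists>E. chain_in (F - {V}) l E"
      then obtain E where E: "chain_in (F - {V}) l E" by blast
      have "chain_in F k (E(k := V))"
        unfolding chain_in_def k
      proof (intro conjI allI impI)
        fix i assume "i \<le> Suc l"
        then show "(E(Suc l := V)) i \<in> F" using E True by (auto simp: chain_in_def le_Suc_eq)
      next
        fix i assume i: "i < Suc l"
        show "(E(Suc l := V)) i \<subset> (E(Suc l := V)) (Suc i)"
        proof (cases "i = l")
          case True
          have "E l \<in> F - {V}" using E by (auto simp: chain_in_def)
          then show ?thesis using True Suc.prems(2) by auto
        next
          case False
          then show ?thesis using E i by (auto simp: chain_in_def)
        qed
      qed
      then show False using Suc.prems by blast
    qed
    then have "(\<Sum>S\<in>F - {V}. 1 / real (card V choose card S)) \<le> real l"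
      using main[of "F - {V}" l] Suc.prems by blast
    then show ?thesis using True fV by (simp add: sum.remove k)
  qed
qed

text \<open>Bounding every weight below by the reciprocal of the central binomial coefficient gives
  Erdos's extension of Sperner's theorem.\<close>

lemma card_chain_free_le:
  assumes "finite V" "F \<subseteq> Pow V" "\<nexists>E. chain_in F k E"
  shows "card F \<le> k * (card V choose (card V div 2))"
proof -
  have fF: "finite F" using assms finite_subset by (metis finite_Pow_iff)
  let ?c = "real (card V choose (card V div 2))"
  have c0: "?c > 0" by simp
  have "real (card F) / ?c = (\<Sum>S\<in>F. 1 / ?c)" by simp
  also have "\<dots> \<le> (\<Sum>S\<in>F. 1 / real (card V choose card S))"
  proof (rule sum_mono)
    fix S assume "S \<in> F"
    then have "card S \<le> card V" using assms by (auto intro: card_mono)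
    then show "1 / ?c \<le> 1 / real (card V choose card S)"
      using binomial_maximum[of "card V" "card S"] by (intro divide_left_mono) auto
  qed
  also have "\<dots> \<le> k" by (rule sum_inverse_binomial_le[OF assms])
  finally have "real (card F) \<le> k * ?c" using c0 by (simp add: divide_le_eq)
  then show ?thesis by (metis of_nat_le_iff of_nat_mult)
qed

text \<open>The summand 1 under the root lets the induction close: the step reduces to (2m+1)(2m+3)
  <= (2m+2)^2, whereas a bound with sqrt (2m) does not reproduce itself.\<close>

lemma central_binomial_upper_bound_even: "real (2 * m choose m) * sqrt (2 * m + 1) \<le> 4 ^ m"
proof (induction m)
  case (Suc m)
  have e: "2 * Suc m = Suc (2 * m + 1)" "2 * m + 1 - m = Suc m" "2 * m + 1 - 1 = 2 * m" by simp_all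
  have "Suc m * (2 * Suc m choose Suc m) = 2 * Suc m * (2 * m + 1 choose m)"
    unfolding e(1) by (rule Suc_times_binomial)
  moreover have "Suc m * (2 * m + 1 choose m) = (2 * m + 1) * (2 * m choose m)"
    using binomial_absorb_comp[of "2*m+1" m] unfolding e(2,3) .
  ultimately have "Suc m * (Suc m * (2 * Suc m choose Suc m)) = 2 * Suc m * ((2 * m + 1) * (2 * m choose m))"
    by (metis (no_types, opaque_lifting) mult.left_commute)
  then have "Suc m * (2 * Suc m choose Suc m) = 2 * ((2 * m + 1) * (2 * m choose m))"
    by (metis (no_types, lifting) mult.assoc mult.left_commute mult_cancel1 nat.distinct(1))
  then have eq: "(real m + 1) * real (2 * Suc m choose Suc m) = 2 * ((2 * m + 1) * real (2 * m choose m))"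
    by (metis (mono_tags, lifting) of_nat_Suc of_nat_mult of_nat_numeral add.commute)
  have "(2 * m + 1) * sqrt (2 * Suc m + 1) \<le> 2 * (real m + 1) * sqrt (2 * m + 1)"
  proof (rule power2_le_imp_le)
    have "(real m + 1/2)\<^sup>2 * (2 * real m + 3) \<le> (real m + 1)\<^sup>2 * (2 * real m + 1)"
      by (simp add: power2_eq_square algebra_simps)
    then show "(real (2 * m + 1) * sqrt (2 * Suc m + 1))\<^sup>2 \<le> (2 * (real m + 1) * sqrt (2 * m + 1))\<^sup>2"
      by (simp add: power_mult_distrib power2_eq_square algebra_simps)
  qed simp
  then have "(real m + 1) * real (2 * Suc m choose Suc m) * sqrt (2 * Suc m + 1)
     \<le> 2 * real (2 * m choose m) * (2 * (real m + 1) * sqrt (2 * m + 1))"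
    unfolding eq by (simp add: mult_left_mono mult.assoc mult.left_commute)
  also have "\<dots> = 2 * (2 * (real m + 1)) * (real (2 * m choose m) * sqrt (2 * m + 1))"
    by (simp only: mult_ac)
  also have "\<dots> \<le> 2 * (2 * (real m + 1)) * 4 ^ m"
    by (rule mult_left_mono[OF Suc]) simp
  also have "\<dots> = (real m + 1) * 4 ^ Suc m" by simp
  finally have "(real m + 1) * (real (2 * Suc m choose Suc m) * sqrt (2 * Suc m + 1)) \<le> (real m + 1) * 4 ^ Suc m"
    by (simp only: mult.assoc)
  then show ?case by (rule mult_left_le_imp_le) simp
qed simp

lemma central_binomial_upper_bound:
  assumes "m > 0"
  shows "real (m choose (m div 2)) / 2 ^ m \<le> 1 / sqrt m"
proof (cases "even m")
  case True
  then obtain l where l: "m = 2 * l" by (auto elim: evenE)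
  show ?thesis
  proof (cases "l = 0")
    case False
    have "real (2 * l choose l) * sqrt (2 * l) \<le> real (2 * l choose l) * sqrt (2 * l + 1)"
      by (intro mult_left_mono) auto
    also have "\<dots> \<le> 4 ^ l" by (rule central_binomial_upper_bound_even)
    finally have "real (2 * l choose l) * sqrt (2 * l) \<le> 2 ^ (2 * l)" by (simp add: power_mult)
    then show ?thesis using False by (simp add: l field_simps)
  qed (use l assms in simp)
next
  case False
  then obtain l where l: "m = 2 * l + 1" by (auto elim: oddE)
  have "(2 * l + 1 choose l) * 2 = (2 * Suc l choose Suc l)"
    using central_binomial_odd[of "2*l+1"] by simp
  then have "2 * real (2 * l + 1 choose l) = real (2 * Suc l choose Suc l)"
    by (metis mult.commute of_nat_mult of_nat_numeral)
  moreover have "real (2 * Suc l choose Suc l) * sqrt (2 * l + 1) \<le> real (2 * Suc l choose Suc l) * sqrt (2 * Suc l + 1)"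
      by (intro mult_left_mono) auto
  ultimately have "2 * real (2 * l + 1 choose l) * sqrt (2 * l + 1) \<le> 4 ^ Suc l"
    using order_trans[OF _ central_binomial_upper_bound_even[of "Suc l"]] by (simp only:)
  then have "real (2 * l + 1 choose l) * sqrt (2 * l + 1) \<le> 2 * 2 ^ (2 * l)" by (simp add: power_mult)
  moreover have "m div 2 = l" using l by simp
  ultimately show ?thesis by (simp add: l field_simps)
qed

section \<open>A determinant along a chain\<close>

text \<open>These sets of complex numbers absorb all cancellation problems: they are stable under sums and
  products, and for small \<open>\<eta>\<close> they stay away from 0.\<close>

definition near_real :: "real \<Rightarrow> nat \<Rightarrow> complex \<Rightarrow> bool" where
  "near_real \<eta> q z \<longleftrightarrow> (\<exists>N\<ge>1. norm (z - of_real N) \<le> ((1 + \<eta>) ^ q - 1) * N)"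

lemma near_real_one: "near_real \<eta> 0 1"
  by (auto simp: near_real_def intro!: exI[of _ 1])

lemma near_real_base: "norm (u - 1) \<le> \<eta> \<Longrightarrow> near_real \<eta> 1 u"
  by (auto simp: near_real_def intro!: exI[of _ 1])

lemma near_real_mult:
  assumes "near_real \<eta> p z" "near_real \<eta> q w"
  shows "near_real \<eta> (p + q) (z * w)"
proof -
  from assms obtain M N where M: "M \<ge> 1" "norm (z - of_real M) \<le> ((1 + \<eta>) ^ p - 1) * M"
    and N: "N \<ge> 1" "norm (w - of_real N) \<le> ((1 + \<eta>) ^ q - 1) * N"
    by (auto simp: near_real_def)
  have "norm w \<le> norm (w - of_real N) + norm (of_real N :: complex)"
    by (metis diff_add_cancel norm_triangle_ineq)
  then have w: "norm w \<le> (1 + \<eta>) ^ q * N" using N by (simp add: algebra_simps)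
  have "z * w - of_real (M * N) = (z - of_real M) * w + of_real M * (w - of_real N)"
    by (simp add: algebra_simps)
  then have "norm (z * w - of_real (M * N)) \<le> norm (z - of_real M) * norm w + M * norm (w - of_real N)"
    using M(1) by (metis norm_mult norm_triangle_ineq norm_of_real abs_of_nonneg order_trans zero_le_one)
  also have "\<dots> \<le> (((1 + \<eta>) ^ p - 1) * M) * ((1 + \<eta>) ^ q * N) + M * (((1 + \<eta>) ^ q - 1) * N)"
    using M N w by (intro add_mono mult_mono mult_left_mono) (auto intro: order_trans[OF norm_ge_zero])
  also have "\<dots> = ((1 + \<eta>) ^ (p + q) - 1) * (M * N)"
    by (simp add: algebra_simps power_add)
  finally show ?thesis using M N unfolding near_real_def
    by (intro exI[of _ "M * N"]) (auto simp: mult_ge1_I)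
qed

text \<open>The exponent \<open>q\<close> does not grow, since relative errors of positive
  quantities do not accumulate under addition. Hence sums cost nothing, however many terms they
  have; only the number of multiplied factors matters.\<close>

lemma near_real_add:
  assumes "near_real \<eta> q z" "near_real \<eta> q w"
  shows "near_real \<eta> q (z + w)"
proof -
  from assms obtain M N where M: "M \<ge> 1" "norm (z - of_real M) \<le> ((1 + \<eta>) ^ q - 1) * M"
    and N: "N \<ge> 1" "norm (w - of_real N) \<le> ((1 + \<eta>) ^ q - 1) * N"
    by (auto simp: near_real_def)
  have "norm ((z + w) - of_real (M + N)) \<le> norm (z - of_real M) + norm (w - of_real N)"
    by (metis add_diff_add norm_triangle_ineq of_real_add)
  then show ?thesis using M N unfolding near_real_def
    by (intro exI[of _ "M + N"]) (auto simp: algebra_simps)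
qed

lemma near_real_sum:
  assumes "finite A" "A \<noteq> {}" "\<And>x. x \<in> A \<Longrightarrow> near_real \<eta> q (f x)"
  shows "near_real \<eta> q (\<Sum>x\<in>A. f x)"
  using assms by (induction A rule: finite_ne_induct) (auto intro: near_real_add)

lemma near_real_prod:
  assumes "\<And>i. i < n \<Longrightarrow> norm (f i - 1) \<le> \<eta>"
  shows "near_real \<eta> n (\<Prod>i<n. f i)"
  using assms
proof (induction n)
  case (Suc n)
  have "near_real \<eta> (n + 1) ((\<Prod>i<n. f i) * f n)"
    using Suc by (intro near_real_mult near_real_base) auto
  then show ?case by simp
qed (simp add: near_real_one)

lemma near_real_norm_ge:
  assumes "near_real \<eta> q z" "(1 + \<eta>) ^ q \<le> 3 / 2"
  shows "1 / 2 \<le> norm z"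
proof -
  from assms obtain N where N: "N \<ge> 1" "norm (z - of_real N) \<le> ((1 + \<eta>) ^ q - 1) * N"
    by (auto simp: near_real_def)
  have "((1 + \<eta>) ^ q - 1) * N \<le> (1/2) * N"
    using assms N by (intro mult_right_mono) auto
  moreover have "norm (of_real N :: complex) \<le> norm z + norm (z - of_real N)"
    by (metis norm_triangle_ineq2 add.commute diff_le_eq norm_minus_commute)
  moreover have "norm (of_real N :: complex) = N" using N(1) by (subst norm_of_real) linarith
  ultimately have "N \<le> norm z + (1/2) * N" using N(2) by linarith
  then show ?thesis using N(1) by simp
qed

text \<open>For generating polynomials of elementary symmetric functions, row \<open>i\<close>
  consists of e_0, ..., e_k of the \<open>i\<close>-th set, so the first column is constantly
  1.\<close>

definition coeff_det :: "nat \<Rightarrow> (nat \<Rightarrow> complex poly) \<Rightarrow> complex" where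
  "coeff_det k r = det (mat (Suc k) (Suc k) (\<lambda>(i, l). coeff (r i) l))"

text \<open>Multiplication by the unipotent bidiagonal matrix \<open>L\<close> subtracts from each
  row its predecessor. The first column becomes (1, 0, ..., 0), so the expansion along it leaves a
  single minor.\<close>

lemma coeff_det_Suc:
  assumes "\<And>i. i \<le> Suc k \<Longrightarrow> coeff (r i) 0 = 1"
  shows "coeff_det (Suc k) r =
    det (mat (Suc k) (Suc k) (\<lambda>(i, l). coeff (r (Suc i)) (Suc l) - coeff (r i) (Suc l)))"
proof -
  define n where "n = Suc (Suc k)"
  define A where "A = mat n n (\<lambda>(i, l). coeff (r i) l)"
  define L where "L = mat n n (\<lambda>(i, j). if i = j then 1 else if i = Suc j then - 1 else 0 :: complex)"
  define B where "B = mat n n (\<lambda>(i, l). if i = 0 then coeff (r 0) l else coeff (r i) l - coeff (r (i - 1)) l)"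
  have c: "A \<in> carrier_mat n n" "L \<in> carrier_mat n n" "B \<in> carrier_mat n n"
    by (auto simp: A_def L_def B_def)
  have LA: "L * A = B"
  proof (rule eq_matI)
    fix i l assume "i < dim_row B" "l < dim_col B"
    then have il: "i < n" "l < n" by (auto simp: B_def)
    have "(L * A) $$ (i, l) = (\<Sum>j<n. L $$ (i, j) * A $$ (j, l))"
      using il c by (simp add: scalar_prod_def lessThan_atLeast0)
    also have "\<dots> = (\<Sum>j<n. (if j = i then coeff (r i) l else 0) - (if Suc j = i then coeff (r j) l else 0))"
      using il by (intro sum.cong) (auto simp: L_def A_def)
    also have "\<dots> = coeff (r i) l - (\<Sum>j<n. if Suc j = i then coeff (r j) l else 0)"
      using il by (simp add: sum_subtractf)
    also have "\<dots> = B $$ (i, l)"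
    proof (cases i)
      case 0
      then show ?thesis using il by (simp add: B_def)
    next
      case (Suc i')
      then show ?thesis using il by (simp add: B_def)
    qed
    finally show "(L * A) $$ (i, l) = B $$ (i, l)" .
  qed (use c in auto)
  have "det L = prod_list (diag_mat L)"
    by (rule det_lower_triangular[OF _ c(2)]) (auto simp: L_def)
  also have "\<dots> = 1"
    unfolding prod_list_diag_prod by (rule prod.neutral) (auto simp: L_def)
  finally have "det L = 1" .
  then have "det A = det B" using det_mult[OF c(2,1)] LA by simp
  also have "\<dots> = (\<Sum>i<n. B $$ (i, 0) * cofactor B i 0)"
    by (rule laplace_expansion_column[OF c(3)]) (simp add: n_def)
  also have "\<dots> = (\<Sum>i<n. if i = 0 then cofactor B 0 0 else 0)"
    using assms by (intro sum.cong) (auto simp: B_def n_def)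
  also have "\<dots> = cofactor B 0 0" by (simp add: n_def)
  also have "\<dots> = det (mat_delete B 0 0)" by (simp add: cofactor_def)
  also have "mat_delete B 0 0 = mat (Suc k) (Suc k) (\<lambda>(i, l). coeff (r (Suc i)) (Suc l) - coeff (r i) (Suc l))"
    by (rule eq_matI) (auto simp: mat_delete_def B_def n_def)
  finally show ?thesis by (simp add: coeff_det_def A_def n_def)
qed

lemma permutes_less: fixes n :: nat shows "p permutes {0..<n} \<Longrightarrow> i < n \<Longrightarrow> p i < n"
  using permutes_in_image[of p "{0..<n}" i] by (simp only: atLeastLessThan_iff zero_le simp_thms)

lemma det_rows_sum:
  fixes c :: "'i \<Rightarrow> complex"
  assumes "\<And>i. i < n \<Longrightarrow> finite (I i)"
  shows "det (mat n n (\<lambda>(i, l). \<Sum>j\<in>I i. c j * h j l)) =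
    (\<Sum>f\<in>PiE {..<n} I. (\<Prod>i<n. c (f i)) * det (mat n n (\<lambda>(i, l). h (f i) l)))"
proof -
  have "det (mat n n (\<lambda>(i, l). \<Sum>j\<in>I i. c j * h j l)) =
    (\<Sum>p | p permutes {0..<n}. signof p * (\<Prod>i<n. \<Sum>j\<in>I i. c j * h j (p i)))"
    unfolding det_def
    by (auto simp: lessThan_atLeast0 permutes_less intro!: sum.cong prod.cong)
  also have "\<dots> = (\<Sum>p | p permutes {0..<n}. signof p * (\<Sum>f\<in>PiE {..<n} I. \<Prod>i<n. c (f i) * h (f i) (p i)))"
    using assms by (subst prod_sum_PiE) auto
  also have "\<dots> = (\<Sum>f\<in>PiE {..<n} I. \<Sum>p | p permutes {0..<n}. signof p * (\<Prod>i<n. c (f i) * h (f i) (p i)))"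
    by (simp add: sum_distrib_left) (rule sum.swap)
  also have "\<dots> = (\<Sum>f\<in>PiE {..<n} I. (\<Prod>i<n. c (f i)) * det (mat n n (\<lambda>(i, l). h (f i) l)))"
    unfolding det_def sum_distrib_left
    by (auto simp: lessThan_atLeast0 permutes_less prod.distrib sum_distrib_left intro!: sum.cong prod.cong)
  finally show ?thesis .
qed

text \<open>In the Leibniz formula every permutation meets the last column exactly once, in row
  \<open>j\<close>. So each of the (k+1)! terms has one factor bounded by \<delta> and k factors
  bounded by \<open>B\<close>.\<close>

lemma norm_coeff_det_le:
  assumes B: "1 \<le> B" and le: "\<And>i l. i \<le> k \<Longrightarrow> l \<le> k \<Longrightarrow> norm (coeff (r i) l) \<le> B"
    and d: "\<And>i. i \<le> k \<Longrightarrow> norm (coeff (r i) k) \<le> \<delta>"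
  shows "norm (coeff_det k r) \<le> fact (Suc k) * (\<delta> * B ^ k)"
proof -
  let ?P = "{p. p permutes {0..<Suc k}}"
  have d0: "0 \<le> \<delta>" using d[of 0] by (meson norm_ge_zero order_trans zero_le)
  have "coeff_det k r = (\<Sum>p\<in>?P. signof p * (\<Prod>i<Suc k. coeff (r i) (p i)))"
    unfolding coeff_det_def det_def
    by (auto simp: lessThan_atLeast0 permutes_less intro!: sum.cong prod.cong)
  also have "norm \<dots> \<le> (\<Sum>p\<in>?P. \<delta> * B ^ k)"
  proof (rule sum_norm_le)
    fix p assume "p \<in> ?P"
    then have p: "p permutes {0..<Suc k}" by simp
    define j where "j = Hilbert_Choice.inv p k"
    have pj: "p j = k" unfolding j_def using p by (simp add: permutes_inverses)
    have j: "j < Suc k" using permutes_less[OF p, of k] p pj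
      by (metis atLeastLessThan_iff lessI permutes_in_image zero_le)
    have pl: "p i \<le> k" if "i < Suc k" for i
      using permutes_less[OF p that] by simp
    have "norm (signof p * (\<Prod>i<Suc k. coeff (r i) (p i))) = (\<Prod>i<Suc k. norm (coeff (r i) (p i)))"
      by (simp add: norm_mult prod_norm sign_def del: prod.lessThan_Suc)
    also have "\<dots> = norm (coeff (r j) (p j)) * (\<Prod>i\<in>{..<Suc k} - {j}. norm (coeff (r i) (p i)))"
      using j by (subst prod.remove[of _ j]) auto
    also have "\<dots> \<le> \<delta> * (\<Prod>i\<in>{..<Suc k} - {j}. B)"
      using j pj d le pl d0
      by (intro mult_mono prod_mono) (auto intro!: prod_nonneg simp: less_Suc_eq_le)
    also have "\<dots> = \<delta> * B ^ k" using j by simp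
    finally show "norm (signof p * (\<Prod>i<Suc k. coeff (r i) (p i))) \<le> \<delta> * B ^ k" .
  qed
  also have "\<dots> = fact (Suc k) * (\<delta> * B ^ k)"
    by (simp add: card_permutations[OF refl] del: fact_Suc)
  finally show ?thesis .
qed

text \<open>Along a chain of subsets the generating polynomial of the elementary symmetric functions is
  \<open>chain_poly U a b m 0 j\<close>. The parameter \<open>p\<close> counts the factors missing between the \<open>b\<close>-part and the
  \<open>a\<close>-part, since a difference of two consecutive members is a multiple of the member with one more
  factor missing.\<close>

definition chain_poly :: "complex poly \<Rightarrow> (nat \<Rightarrow> complex) \<Rightarrow> (nat \<Rightarrow> complex) \<Rightarrow> nat \<Rightarrow> nat \<Rightarrow> nat \<Rightarrow> complex poly" where
  "chain_poly U a b m p j = U * (\<Prod>i<j. [:1, b i:]) * (\<Prod>i\<in>{j + p..<m}. [:1, a i:])"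

lemma chain_poly_step:
  assumes "j + p < m"
  shows "chain_poly U a b m p (Suc j) - chain_poly U a b m p j
    = [:0, b j - a (j + p):] * chain_poly U a b m (Suc p) j"
proof -
  have "{j + p..<m} = insert (j + p) {Suc (j + p)..<m}" using assms by auto
  then have "chain_poly U a b m p j = chain_poly U a b m (Suc p) j * [:1, a (j + p):]"
    by (simp add: chain_poly_def mult_ac del: mult_pCons_left mult_pCons_right)
  moreover have "chain_poly U a b m p (Suc j) = chain_poly U a b m (Suc p) j * [:1, b j:]"
    by (simp add: chain_poly_def mult_ac del: mult_pCons_left mult_pCons_right)
  moreover have "[:1, b j:] - [:1, a (j + p):] = [:0, b j - a (j + p):]" by simp
  ultimately show ?thesis
    by (metis mult.commute right_diff_distrib)
qed

text \<open>Telescoping of \<open>chain_poly_step\<close>. The factor without constant term shifts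
  coefficients by one, so the smaller determinant starts again with the coefficient of index
  0.\<close>

lemma chain_poly_diff:
  assumes "i \<le> j" "j + p \<le> m"
  shows "coeff (chain_poly U a b m p j) (Suc l) - coeff (chain_poly U a b m p i) (Suc l)
    = (\<Sum>t\<in>{i..<j}. (b t - a (t + p)) * coeff (chain_poly U a b m (Suc p) t) l)"
proof -
  have "coeff (chain_poly U a b m p j) (Suc l) - coeff (chain_poly U a b m p i) (Suc l) =
    (\<Sum>t\<in>{i..<j}. coeff (chain_poly U a b m p (Suc t)) (Suc l) - coeff (chain_poly U a b m p t) (Suc l))"
    using sum_Suc_diff'[OF assms(1), of "\<lambda>t. coeff (chain_poly U a b m p t) (Suc l)"] by simp
  also have "\<dots> = (\<Sum>t\<in>{i..<j}. (b t - a (t + p)) * coeff (chain_poly U a b m (Suc p) t) l)"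
  proof (rule sum.cong[OF refl])
    fix t assume "t \<in> {i..<j}"
    then have "t + p < m" using assms by auto
    from arg_cong[OF chain_poly_step[OF this, of U a b], of "\<lambda>q. coeff q (Suc l)"]
    show "coeff (chain_poly U a b m p (Suc t)) (Suc l) - coeff (chain_poly U a b m p t) (Suc l)
      = (b t - a (t + p)) * coeff (chain_poly U a b m (Suc p) t) l"
      by simp
  qed
  finally show ?thesis .
qed

lemma coeff_0_chain_poly: "coeff U 0 = 1 \<Longrightarrow> coeff (chain_poly U a b m p j) 0 = 1"
  by (simp add: chain_poly_def poly_0_coeff_0[symmetric] poly_prod)

text \<open>Subtracting consecutive rows and expanding by multilinearity turns the determinant of size
  \<open>k + 1\<close> into a sum, over strictly increasing selections, of products of differences \<open>b - a\<close> times
  determinants of size \<open>k\<close> of the same kind. No sign occurs.\<close>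

lemma near_real_coeff_det:
  assumes U: "coeff U 0 = 1" and d: "d \<noteq> 0"
    and ab: "\<And>i j. i < m \<Longrightarrow> j < m \<Longrightarrow> norm ((b i - a j) / d - 1) \<le> \<eta>"
    and J: "\<And>i. i < k \<Longrightarrow> J i < J (Suc i)" "J k + p \<le> m"
  shows "near_real \<eta> (\<Sum>{..k}) (coeff_det k (\<lambda>i. chain_poly U a b m p (J i)) / d ^ (\<Sum>{..k}))"
  using J
proof (induction k arbitrary: p J)
  case 0
  then show ?case using coeff_0_chain_poly[OF U]
    by (simp add: coeff_det_def det_single near_real_one)
next
  case (Suc k)
  let ?q = "\<Sum>{..k}" and ?H = "chain_poly U a b m"
  define c where "c t = b t - a (t + p)" for t
  \<comment> \<open>Row \<open>i\<close> of the expansion picks one index from \<open>J i\<close> up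
    to, but excluding, \<open>J (Suc i)\<close>. These intervals are consecutive, so each selection
    is strictly increasing; its last index lies strictly below \<open>J (Suc k)\<close>, which pays
    for raising \<open>p\<close> by one.\<close>
  define S where "S = PiE {..<Suc k} (\<lambda>i. {J i..<J (Suc i)})"
  have mono: "J i \<le> J (Suc k)" if "i \<le> Suc k" for i
    using that by (induction rule: inc_induct) (use Suc.prems(1) in \<open>auto intro: order_trans less_imp_le\<close>)
  have "coeff_det (Suc k) (\<lambda>i. ?H p (J i)) = det (mat (Suc k) (Suc k)
    (\<lambda>(i, l). coeff (?H p (J (Suc i))) (Suc l) - coeff (?H p (J i)) (Suc l)))"
    by (rule coeff_det_Suc) (rule coeff_0_chain_poly[OF U])
  also have "\<dots> = det (mat (Suc k) (Suc k) (\<lambda>(i, l). \<Sum>t\<in>{J i..<J (Suc i)}. c t * coeff (?H (Suc p) t) l))"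
  proof (rule arg_cong[of _ _ det], rule eq_matI, goal_cases)
    case (1 i l)
    then have i: "i < Suc k" "l < Suc k" by auto
    have "J i \<le> J (Suc i)" using Suc.prems(1)[OF i(1)] by simp
    moreover have "J (Suc i) + p \<le> m" using mono[of "Suc i"] i Suc.prems(2) by simp
    ultimately show ?case using i by (simp add: chain_poly_diff c_def)
  qed auto
  also have "\<dots> = (\<Sum>f\<in>S. (\<Prod>i<Suc k. c (f i)) * coeff_det k (\<lambda>i. ?H (Suc p) (f i)))"
    unfolding S_def coeff_det_def by (rule det_rows_sum) simp
  finally have "coeff_det (Suc k) (\<lambda>i. ?H p (J i)) / d ^ (\<Sum>{..Suc k}) =
    (\<Sum>f\<in>S. (\<Prod>i<Suc k. c (f i) / d) * (coeff_det k (\<lambda>i. ?H (Suc p) (f i)) / d ^ ?q))"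
    by (simp add: sum_divide_distrib prod_dividef power_add mult_ac del: prod.lessThan_Suc)
  moreover have "near_real \<eta> (Suc k + ?q) \<dots>"
  proof (rule near_real_sum)
    show "finite S" unfolding S_def by (rule finite_PiE) auto
    show "S \<noteq> {}" unfolding S_def PiE_eq_empty_iff using Suc.prems(1) by fastforce
    fix f assume f: "f \<in> S"
    have fi: "J i \<le> f i" "f i < J (Suc i)" if "i < Suc k" for i
      using f that unfolding S_def by (auto simp: PiE_iff)
    have fm: "f i + p < m" if "i < Suc k" for i
      using fi(2)[OF that] mono[of "Suc i"] that Suc.prems(2) by simp
    show "near_real \<eta> (Suc k + ?q) ((\<Prod>i<Suc k. c (f i) / d) * (coeff_det k (\<lambda>i. ?H (Suc p) (f i)) / d ^ ?q))"
    proof (rule near_real_mult)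
      show "near_real \<eta> (Suc k) (\<Prod>i<Suc k. c (f i) / d)"
      proof (rule near_real_prod)
        fix i assume i: "i < Suc k"
        show "norm (c (f i) / d - 1) \<le> \<eta>" unfolding c_def
          by (rule ab) (use fm[OF i] in auto)
      qed
      show "near_real \<eta> ?q (coeff_det k (\<lambda>i. ?H (Suc p) (f i)) / d ^ ?q)"
      proof (rule Suc.IH)
        show "f i < f (Suc i)" if "i < k" for i
          using fi(2)[of i] fi(1)[of "Suc i"] that by simp
        show "f k + Suc p \<le> m" using fm[of k] by simp
      qed
    qed
  qed
  ultimately show ?case by (simp add: add.commute)
qed

text \<open>Listing the new elements of each member after the old ones makes every member an initial
  segment; the chain is then encoded by the lengths of these segments.\<close>

lemma chain_enumeration:
  fixes E :: "nat \<Rightarrow> 'a set"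
  assumes "\<And>i. i \<le> k \<Longrightarrow> finite (E i)" "\<And>i. i < k \<Longrightarrow> E i \<subset> E (Suc i)"
  shows "\<exists>xs. distinct xs \<and> set xs = E k \<and> (\<forall>i\<le>k. E i = set (take (card (E i)) xs))"
  using assms
proof (induction k)
  case 0
  then obtain xs where xs: "set xs = E 0" "distinct xs" using finite_distinct_list by blast
  then have "card (E 0) = length xs" by (metis distinct_card)
  then show ?case using xs by (intro exI[of _ xs]) auto
next
  case (Suc k)
  then obtain xs where xs: "distinct xs" "set xs = E k" "\<And>i. i \<le> k \<Longrightarrow> E i = set (take (card (E i)) xs)"
    by (metis less_SucI le_SucI)
  obtain ys where ys: "set ys = E (Suc k) - E k" "distinct ys"
    using Suc.prems(1)[of "Suc k"] finite_distinct_list[of "E (Suc k) - E k"] by auto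
  have sub: "E k \<subset> E (Suc k)" using Suc.prems by simp
  have len: "length xs = card (E k)" using xs distinct_card by metis
  have mono: "E i \<subseteq> E k" if "i \<le> k" for i
    using xs(3)[OF that] xs(2) by (metis set_take_subset)
  have d: "distinct (xs @ ys)" using xs ys by auto
  have s: "set (xs @ ys) = E (Suc k)" using xs ys sub by auto
  have "E i = set (take (card (E i)) (xs @ ys))" if "i \<le> Suc k" for i
  proof (cases "i = Suc k")
    case True
    have "card (E i) = length (xs @ ys)" using d s True by (metis distinct_card)
    then show ?thesis using s True by simp
  next
    case False
    then have i: "i \<le> k" using that by simp
    have "card (E i) \<le> card (E k)" using mono[OF i] Suc.prems(1) by (intro card_mono) auto
    then have "take (card (E i)) (xs @ ys) = take (card (E i)) xs" using len by simp
    then show ?thesis using xs(3)[OF i] by (simp only:)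
  qed
  then show ?case using d s by blast
qed

text \<open>\<open>T\<close> holds the choices frozen outside \<open>G\<close>. All members of the
  chain share the factor \<open>U\<close> of the indices outside the top set; along the listing of
  the top set, member \<open>i\<close> takes x before position \<open>J i\<close> and y from there
  on. This is the form to which both bounds for the determinant apply.\<close>

lemma no_small_chain:
  fixes x y :: "'i \<Rightarrow> complex"
  assumes I: "finite I" and T: "T \<inter> G = {}" and G: "G \<subseteq> I" and F: "F \<subseteq> Pow G"
    and E: "chain_in F k E" and d: "d \<noteq> 0"
    and xy: "\<And>i j. i \<in> G \<Longrightarrow> j \<in> G \<Longrightarrow> norm ((x i - y j) / d - 1) \<le> \<eta>"
    and eta: "(1 + \<eta>) ^ (\<Sum>{..k}) \<le> 3 / 2" and B: "1 \<le> B"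
    and le: "\<And>S l. S \<in> F \<Longrightarrow> l \<le> k \<Longrightarrow> norm (coeff (\<Prod>i\<in>I. [:1, if i \<in> S \<union> T then x i else y i:]) l) \<le> B"
    and small: "\<And>S. S \<in> F \<Longrightarrow> norm (coeff (\<Prod>i\<in>I. [:1, if i \<in> S \<union> T then x i else y i:]) k) \<le> \<delta>"
  shows "norm d ^ (\<Sum>{..k}) / 2 \<le> fact (Suc k) * (\<delta> * B ^ k)"
proof -
  have EF: "E i \<in> F" if "i \<le> k" for i using E that by (auto simp: chain_in_def)
  have EG: "E i \<subseteq> G" if "i \<le> k" for i using EF[OF that] F by auto
  have fE: "finite (E i)" if "i \<le> k" for i using EG[OF that] G I by (meson finite_subset)
  have ss: "E i \<subset> E (Suc i)" if "i < k" for i using E that by (auto simp: chain_in_def)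
  obtain xs where xs: "distinct xs" "set xs = E k" "\<And>i. i \<le> k \<Longrightarrow> E i = set (take (card (E i)) xs)"
    using chain_enumeration[of k E] fE ss by blast
  define m where "m = length xs"
  define J where "J i = card (E i)" for i
  define a where "a t = y (xs ! t)" for t
  define b where "b t = x (xs ! t)" for t
  define U where "U = (\<Prod>i\<in>I - E k. [:1, if i \<in> T then x i else y i:])"
  have mono: "E i \<subseteq> E k" if "i \<le> k" for i using xs(3)[OF that] xs(2) by (metis set_take_subset)
  have Jm: "J i \<le> m" if "i \<le> k" for i
    unfolding J_def m_def using mono[OF that] fE xs by (metis card_mono distinct_card order_refl)
  have poly: "(\<Prod>t\<in>I. [:1, if t \<in> E i \<union> T then x t else y t:]) = chain_poly U a b m 0 (J i)" if i: "i \<le> k" for i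
  proof -
    have set1: "E i = (!) xs ` {..<J i}"
      using xs(3)[OF i] Jm[OF i] nth_image[of "J i" xs] unfolding J_def m_def by (simp add: lessThan_atLeast0)
    have inj: "inj_on ((!) xs) {..<m}" using xs(1) by (auto simp: inj_on_def m_def nth_eq_iff_index_eq)
    have "E k = (!) xs ` {..<m}" using xs(2) by (auto simp: set_conv_nth image_def m_def)
    also have "{..<m} = {..<J i} \<union> {J i..<m}" using Jm[OF i] by auto
    finally have "E k - E i = (!) xs ` (({..<J i} \<union> {J i..<m}) - {..<J i})"
      unfolding set1 using inj Jm[OF i] by (subst inj_on_image_set_diff[of _ "{..<m}"]) auto
    also have "({..<J i} \<union> {J i..<m}) - {..<J i} = {J i..<m}" by auto
    finally have set2: "E k - E i = (!) xs ` {J i..<m}" .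
    have split: "I = (I - E k) \<union> (E i \<union> (E k - E i))" using mono[OF i] EG[of k] G by auto
    have "(\<Prod>t\<in>I. [:1, if t \<in> E i \<union> T then x t else y t:]) =
      (\<Prod>t\<in>I - E k. [:1, if t \<in> E i \<union> T then x t else y t:]) *
      ((\<Prod>t\<in>E i. [:1, if t \<in> E i \<union> T then x t else y t:]) *
       (\<Prod>t\<in>E k - E i. [:1, if t \<in> E i \<union> T then x t else y t:]))"
      using fE[OF i] fE[of k] I mono[OF i]
      by (subst (1) split, subst prod.union_disjoint, simp, simp, blast, subst prod.union_disjoint) auto
    also have "(\<Prod>t\<in>I - E k. [:1, if t \<in> E i \<union> T then x t else y t:]) = U"
      unfolding U_def using mono[OF i] by (intro prod.cong) auto
    also have "(\<Prod>t\<in>E i. [:1, if t \<in> E i \<union> T then x t else y t:]) = (\<Prod>t\<in>E i. [:1, x t:])"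
      by (intro prod.cong) auto
    also have "\<dots> = (\<Prod>t<J i. [:1, b t:])"
      unfolding set1 b_def using inj Jm[OF i] by (subst prod.reindex) (auto intro: inj_on_subset)
    also have "(\<Prod>t\<in>E k - E i. [:1, if t \<in> E i \<union> T then x t else y t:]) = (\<Prod>t\<in>E k - E i. [:1, y t:])"
      using EG[of k] T by (intro prod.cong) auto
    also have "\<dots> = (\<Prod>t\<in>{J i..<m}. [:1, a t:])"
      unfolding set2 a_def using inj by (subst prod.reindex) (auto intro: inj_on_subset)
    finally show ?thesis by (simp only: chain_poly_def mult.assoc add_0_right)
  qed
  have "near_real \<eta> (\<Sum>{..k}) (coeff_det k (\<lambda>i. chain_poly U a b m 0 (J i)) / d ^ (\<Sum>{..k}))"
  proof (rule near_real_coeff_det)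
    show "coeff U 0 = 1" by (simp add: U_def poly_0_coeff_0[symmetric] poly_prod)
    show "norm ((b i - a j) / d - 1) \<le> \<eta>" if "i < m" "j < m" for i j
      unfolding a_def b_def using that xs(2) EG[of k] by (intro xy) (auto simp: m_def)
    show "J i < J (Suc i)" if "i < k" for i
      unfolding J_def using ss[OF that] fE[of "Suc i"] that by (intro psubset_card_mono) auto
    show "J k + 0 \<le> m" using Jm by simp
  qed (rule d)
  from near_real_norm_ge[OF this eta]
  have "norm d ^ (\<Sum>{..k}) / 2 \<le> norm (coeff_det k (\<lambda>i. chain_poly U a b m 0 (J i)))"
    using d by (simp add: norm_divide norm_power field_simps)
  also have "\<dots> \<le> fact (Suc k) * (\<delta> * B ^ k)"
  proof (rule norm_coeff_det_le[OF B])
    fix i assume i: "i \<le> k"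
    show "norm (coeff (chain_poly U a b m 0 (J i)) l) \<le> B" if "l \<le> k" for l
      using le[OF EF[OF i] that] poly[OF i] by simp
    show "norm (coeff (chain_poly U a b m 0 (J i)) k) \<le> \<delta>"
      using small[OF EF[OF i]] poly[OF i] by simp
  qed
  finally show ?thesis .
qed

section \<open>Elementary symmetric functions\<close>

definition esym :: "nat \<Rightarrow> 'i set \<Rightarrow> ('i \<Rightarrow> complex) \<Rightarrow> complex" where
  "esym k I y = coeff (\<Prod>i\<in>I. [:1, y i:]) k"

lemma esym_0 [simp]: "esym 0 I y = 1"
  by (simp add: esym_def poly_0_coeff_0[symmetric] poly_prod)

lemma esym_insert:
  "finite I \<Longrightarrow> i \<notin> I \<Longrightarrow> esym (Suc k) (insert i I) y = esym (Suc k) I y + y i * esym k I y"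
  by (simp add: esym_def)

lemma esym_empty: "esym (Suc k) {} y = 0"
  by (simp add: esym_def)

lemma norm_esym_le: "finite I \<Longrightarrow> norm (esym k I y) \<le> (\<Sum>i\<in>I. norm (y i)) ^ k"
proof (induction I arbitrary: k rule: finite_induct)
  case empty
  then show ?case by (cases k) (auto simp: esym_empty)
next
  case (insert i I)
  show ?case
  proof (cases k)
    case (Suc l)
    let ?s = "\<Sum>i\<in>I. norm (y i)"
    have s: "0 \<le> ?s" by (simp add: sum_nonneg)
    have "norm (esym k (insert i I) y) \<le> norm (esym (Suc l) I y) + norm (y i) * norm (esym l I y)"
      unfolding Suc esym_insert[OF insert.hyps] by (metis norm_mult norm_triangle_ineq)
    also have "\<dots> \<le> ?s ^ Suc l + norm (y i) * ?s ^ l"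
      by (intro add_mono mult_left_mono insert.IH) auto
    also have "\<dots> = (norm (y i) + ?s) * ?s ^ l" by (simp add: algebra_simps)
    also have "\<dots> \<le> (norm (y i) + ?s) * (norm (y i) + ?s) ^ l"
      using s by (intro mult_left_mono power_mono) auto
    finally show ?thesis using insert.hyps by (simp add: Suc)
  qed simp
qed

text \<open>\<open>E\<close> is the outcome of the coin tosses, the set of indices at which the
  first entry of the pair is chosen.\<close>

definition mix :: "'i set \<Rightarrow> ('i \<Rightarrow> 'b) \<Rightarrow> ('i \<Rightarrow> 'b) \<Rightarrow> 'i \<Rightarrow> 'b" where
  "mix E x y i = (if i \<in> E then x i else y i)"

text \<open>The bound on the sum of moduli belongs to the event because the determinant argument
  also needs upper bounds for e_0, ..., e_k, which it supplies through
  \<open>norm_esym_le\<close>.\<close>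

definition esym_small :: "nat \<Rightarrow> real \<Rightarrow> real \<Rightarrow> 'i set \<Rightarrow> ('i \<Rightarrow> complex) \<Rightarrow> bool" where
  "esym_small k \<delta> \<Lambda> I z \<longleftrightarrow> norm (esym k I z) \<le> \<delta> \<and> (\<Sum>i\<in>I. norm (z i)) \<le> \<Lambda>"

text \<open>Fix the part \<open>T\<close> of the coin outcome outside \<open>G\<close>. The choices
  inside \<open>G\<close> that give a small value contain no \<open>k + 1\<close> nested sets,
  because such a chain would contradict the choice of \<delta>. Each of the 2^|I - G| fibres is
  therefore bounded by \<open>k\<close> times the central binomial coefficient.\<close>

lemma card_esym_small_le:
  fixes x y :: "'i \<Rightarrow> complex"
  assumes I: "finite I" and G: "G \<subseteq> I" "G \<noteq> {}" and d: "d \<noteq> 0"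
    and xy: "\<And>i j. i \<in> G \<Longrightarrow> j \<in> G \<Longrightarrow> norm ((x i - y j) / d - 1) \<le> \<eta>"
    and eta: "(1 + \<eta>) ^ (\<Sum>{..k}) \<le> 3 / 2" and L: "1 \<le> \<Lambda>"
    and \<delta>: "fact (Suc k) * (\<delta> * (\<Lambda> ^ k) ^ k) < norm d ^ (\<Sum>{..k}) / 2"
  shows "real (card {E\<in>Pow I. esym_small k \<delta> \<Lambda> I (mix E x y)}) / 2 ^ card I \<le> k / sqrt (card G)"
proof -
  define F where "F T = {S\<in>Pow G. esym_small k \<delta> \<Lambda> I (mix (S \<union> T) x y)}" for T
  have fin: "finite G" "finite (I - G)" "\<And>T. finite (F T)"
    using I G finite_subset[OF G(1) I] unfolding F_def by auto
  have cF: "card (F T) \<le> k * (card G choose (card G div 2))" if T: "T \<subseteq> I - G" for T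
  proof (rule card_chain_free_le)
    show "\<nexists>E. chain_in (F T) k E"
    proof
      assume "\<exists>E. chain_in (F T) k E"
      then obtain E where E: "chain_in (F T) k E" ..
      have sm: "esym_small k \<delta> \<Lambda> I (mix (S \<union> T) x y)" if "S \<in> F T" for S
        using that by (simp add: F_def)
      have le: "norm (esym l I (mix (S \<union> T) x y)) \<le> \<Lambda> ^ k" if "S \<in> F T" "l \<le> k" for S l
      proof -
        have "norm (esym l I (mix (S \<union> T) x y)) \<le> (\<Sum>i\<in>I. norm (mix (S \<union> T) x y i)) ^ l"
          by (rule norm_esym_le[OF I])
        also have "\<dots> \<le> \<Lambda> ^ l" using sm[OF that(1)] unfolding esym_small_def
          by (intro power_mono) (auto intro: sum_nonneg)
        also have "\<dots> \<le> \<Lambda> ^ k" using L that by (intro power_increasing)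
        finally show ?thesis .
      qed
      have "norm d ^ (\<Sum>{..k}) / 2 \<le> fact (Suc k) * (\<delta> * (\<Lambda> ^ k) ^ k)"
      proof (rule no_small_chain[OF I _ G(1) _ E d xy eta])
        show "T \<inter> G = {}" using T by auto
        show "F T \<subseteq> Pow G" by (auto simp: F_def)
        show "1 \<le> \<Lambda> ^ k" using L by simp
        show "norm (coeff (\<Prod>i\<in>I. [:1, if i \<in> S \<union> T then x i else y i:]) l) \<le> \<Lambda> ^ k"
          if "S \<in> F T" "l \<le> k" for S l
          using le[OF that] unfolding esym_def mix_def .
        show "norm (coeff (\<Prod>i\<in>I. [:1, if i \<in> S \<union> T then x i else y i:]) k) \<le> \<delta>" if "S \<in> F T" for S
          using sm[OF that] unfolding esym_small_def esym_def mix_def by (rule conjunct1)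
      qed
      then show False using \<delta> by simp
    qed
  qed (use fin in \<open>auto simp: F_def\<close>)
  have "{E\<in>Pow I. esym_small k \<delta> \<Lambda> I (mix E x y)} \<subseteq> (\<Union>T\<in>Pow (I - G). (\<lambda>S. S \<union> T) ` F T)"
  proof
    fix E assume "E \<in> {E\<in>Pow I. esym_small k \<delta> \<Lambda> I (mix E x y)}"
    then have E: "E \<subseteq> I" "esym_small k \<delta> \<Lambda> I (mix E x y)" by auto
    have e: "E = E \<inter> G \<union> (E - G)" by auto
    then have "E \<inter> G \<in> F (E - G)" using E by (simp add: F_def)
    moreover have "E - G \<in> Pow (I - G)" using E by auto
    ultimately show "E \<in> (\<Union>T\<in>Pow (I - G). (\<lambda>S. S \<union> T) ` F T)" using e by blast
  qed
  then have "card {E\<in>Pow I. esym_small k \<delta> \<Lambda> I (mix E x y)} \<le> card (\<Union>T\<in>Pow (I - G). (\<lambda>S. S \<union> T) ` F T)"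
    using fin by (intro card_mono) auto
  also have "\<dots> \<le> (\<Sum>T\<in>Pow (I - G). card ((\<lambda>S. S \<union> T) ` F T))"
    using fin by (intro card_UN_le) auto
  also have "\<dots> \<le> (\<Sum>T\<in>Pow (I - G). k * (card G choose (card G div 2)))"
    using cF fin by (intro sum_mono) (auto intro: order_trans[OF card_image_le])
  also have "\<dots> = 2 ^ card (I - G) * (k * (card G choose (card G div 2)))"
    using fin by (simp add: card_Pow)
  finally have "real (card {E\<in>Pow I. esym_small k \<delta> \<Lambda> I (mix E x y)})
      \<le> 2 ^ card (I - G) * (k * real (card G choose (card G div 2)))"
    by (metis (mono_tags, lifting) of_nat_le_iff of_nat_mult of_nat_numeral of_nat_power)
  moreover have "card I = card (I - G) + card G"
    using I G fin by (simp add: card_Diff_subset card_mono)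
  ultimately have "real (card {E\<in>Pow I. esym_small k \<delta> \<Lambda> I (mix E x y)}) / 2 ^ card I
      \<le> k * (real (card G choose (card G div 2)) / 2 ^ card G)"
    by (simp add: power_add field_simps)
  also have "\<dots> \<le> k * (1 / sqrt (card G))"
    using central_binomial_upper_bound[of "card G"] G fin
    by (intro mult_left_mono) (auto simp: card_gt_0_iff)
  finally show ?thesis by simp
qed

section \<open>Anticoncentration\<close>

lemma esym_measurable [measurable]:
  assumes "finite I" "\<And>i. i \<in> I \<Longrightarrow> (\<lambda>\<omega>. Y \<omega> i) \<in> borel_measurable M"
  shows "(\<lambda>\<omega>. esym k I (Y \<omega>)) \<in> borel_measurable M"
  using assms
proof (induction I arbitrary: k rule: finite_induct)
  case empty
  then show ?case by (cases k) (auto simp: esym_empty)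
next
  case (insert i I)
  show ?case
  proof (cases k)
    case (Suc l)
    have "(\<lambda>\<omega>. esym (Suc l) I (Y \<omega>) + Y \<omega> i * esym l I (Y \<omega>)) \<in> borel_measurable M"
      using insert by (intro borel_measurable_add borel_measurable_times) auto
    then show ?thesis using insert.hyps by (simp add: Suc esym_insert)
  qed simp
qed

lemma esym_small_measurable:
  assumes "finite I" "\<And>i. i \<in> I \<Longrightarrow> (\<lambda>\<omega>. Y \<omega> i) \<in> borel_measurable M"
  shows "{\<omega>\<in>space M. esym_small k \<delta> \<Lambda> I (Y \<omega>)} \<in> sets M"
proof -
  have [measurable]: "(\<lambda>\<omega>. esym k I (Y \<omega>)) \<in> borel_measurable M" by (rule esym_measurable[OF assms])
  have [measurable]: "(\<lambda>\<omega>. \<Sum>i\<in>I. norm (Y \<omega> i)) \<in> borel_measurable M"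
    using assms by (intro borel_measurable_sum measurable_compose[OF _ borel_measurable_norm])
  show ?thesis unfolding esym_small_def by measurable
qed

text \<open>Injectivity of \<open>h\<close> keeps the reindexed variables independent, so both
  families have the same product law on \<open>I\<close>. \<open>P\<close> may depend only on
  coordinates in \<open>I\<close> because product spaces contain functions restricted to
  \<open>I\<close>, while \<open>\<lambda>i. X (h i) \<omega>\<close> is not restricted.\<close>

lemma (in prob_space) prob_iid_reindex:
  fixes X :: "'i \<Rightarrow> 'a \<Rightarrow> complex"
  assumes ind: "indep_vars (\<lambda>_. borel) X J" and law: "\<And>i. i \<in> J \<Longrightarrow> distr M borel (X i) = \<nu>"
    and I: "I \<subseteq> J" and h: "inj_on h I" "h ` I \<subseteq> J"
    and P: "{y\<in>space (PiM I (\<lambda>_. borel)). P y} \<in> sets (PiM I (\<lambda>_. borel))"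
    and PI: "\<And>y z. (\<And>i. i \<in> I \<Longrightarrow> y i = z i) \<Longrightarrow> P y = P z"
  shows "prob {\<omega>\<in>space M. P (\<lambda>i. X (h i) \<omega>)} = prob {\<omega>\<in>space M. P (\<lambda>i. X i \<omega>)}"
proof (cases "I = {}")
  case True
  then have "P (\<lambda>i. X (h i) \<omega>) = P (\<lambda>i. X i \<omega>)" for \<omega> by (intro PI) auto
  then show ?thesis by simp
next
  case False
  have rv: "X i \<in> borel_measurable M" if "i \<in> J" for i
    using ind that by (auto simp: indep_vars_def)
  have *: "prob {\<omega>\<in>space M. P (\<lambda>i. X (g i) \<omega>)}
      = measure (\<Pi>\<^sub>M i\<in>I. \<nu>) {y\<in>space (PiM I (\<lambda>_. borel)). P y}"
    if g: "inj_on g I" "g ` I \<subseteq> J" for g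
  proof -
    have "indep_vars (\<lambda>j. PiM {g j} (\<lambda>_. borel)) (\<lambda>j \<omega>. restrict (\<lambda>i. X i \<omega>) {g j}) I"
      using g by (intro indep_vars_restrict[OF ind]) (auto simp: disjoint_family_on_def inj_on_def)
    then have "indep_vars (\<lambda>_. borel) (\<lambda>j \<omega>. (\<lambda>y. y (g j)) (restrict (\<lambda>i. X i \<omega>) {g j})) I"
      by (rule indep_vars_compose2) (auto intro: measurable_component_singleton)
    then have i: "indep_vars (\<lambda>_. borel) (\<lambda>i. X (g i)) I" by simp
    have d: "distr M (\<Pi>\<^sub>M i\<in>I. borel) (\<lambda>x. \<lambda>i\<in>I. X (g i) x) = (\<Pi>\<^sub>M i\<in>I. distr M borel (X (g i)))"
      using indep_vars_iff_distr_eq_PiM'[OF False, of "\<lambda>i. X (g i)" "\<lambda>_. borel"] i rv g by blast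
    also have "\<dots> = (\<Pi>\<^sub>M i\<in>I. \<nu>)" using law g by (intro PiM_cong) auto
    finally have d: "distr M (\<Pi>\<^sub>M i\<in>I. borel) (\<lambda>x. \<lambda>i\<in>I. X (g i) x) = (\<Pi>\<^sub>M i\<in>I. \<nu>)" .
    have m: "(\<lambda>x. \<lambda>i\<in>I. X (g i) x) \<in> measurable M (\<Pi>\<^sub>M i\<in>I. borel)"
      using rv g by (intro measurable_restrict) auto
    have "measure (\<Pi>\<^sub>M i\<in>I. \<nu>) {y\<in>space (PiM I (\<lambda>_. borel)). P y} =
      prob ((\<lambda>x. \<lambda>i\<in>I. X (g i) x) -` {y\<in>space (PiM I (\<lambda>_. borel)). P y} \<inter> space M)"
      unfolding d[symmetric] by (rule measure_distr[OF m P])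
    also have "(\<lambda>x. \<lambda>i\<in>I. X (g i) x) -` {y\<in>space (PiM I (\<lambda>_. borel)). P y} \<inter> space M
      = {\<omega>\<in>space M. P (\<lambda>i. X (g i) \<omega>)}"
    proof -
      have "P (\<lambda>i\<in>I. X (g i) x) = P (\<lambda>i. X (g i) x)" for x by (rule PI) simp
      then show ?thesis by (auto simp: space_PiM)
    qed
    finally show ?thesis by simp
  qed
  show ?thesis using *[OF h] *[of "\<lambda>i. i"] I by simp
qed

text \<open>Swapping \<open>X i\<close> and \<open>X (n + i)\<close> for the indices outside a set \<open>E\<close> does not change the law, so
  the probability equals the expected proportion of sets \<open>E\<close> giving a small value; that proportion is
  bounded for every single outcome.\<close>

lemma (in prob_space) esym_anticoncentration:
  fixes X :: "nat \<Rightarrow> 'a \<Rightarrow> complex"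
  assumes ind: "indep_vars (\<lambda>_. borel) X {1..2*n}"
    and law: "\<And>i. i \<in> {1..2*n} \<Longrightarrow> distr M borel (X i) = \<nu>"
    and AB: "A \<in> sets borel" "B \<in> sets borel" and d: "d \<noteq> 0"
    and xy: "\<And>x y. x \<in> B \<Longrightarrow> y \<in> A \<Longrightarrow> norm ((x - y) / d - 1) \<le> \<eta>"
    and eta: "(1 + \<eta>) ^ (\<Sum>{..k}) \<le> 3 / 2" and L: "1 \<le> \<Lambda>"
    and \<delta>: "fact (Suc k) * (\<delta> * (\<Lambda> ^ k) ^ k) < norm d ^ (\<Sum>{..k}) / 2"
    and p: "p = measure \<nu> A * measure \<nu> B" "p > 0" and n: "n > 0"
  shows "prob {\<omega>\<in>space M. esym_small k \<delta> \<Lambda> {1..n} (\<lambda>i. X i \<omega>)}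
    \<le> k / sqrt (n * p / 2) + exp (- (real n * p\<^sup>2 / 2))"
proof -
  have rv [measurable]: "X i \<in> borel_measurable M" if "i \<in> {1..2*n}" for i
    using ind that by (auto simp: indep_vars_def)
  note [measurable] = AB
  define I where "I = {1..n}"
  have I: "finite I" "card I = n" "I \<subseteq> {1..2*n}" "I \<noteq> {}" using n by (auto simp: I_def)
  define Z where "Z E \<omega> = mix E (\<lambda>i. X i \<omega>) (\<lambda>i. X (n + i) \<omega>)" for E \<omega>
  let ?E = "\<lambda>E. {\<omega>\<in>space M. esym_small k \<delta> \<Lambda> I (Z E \<omega>)}"
  let ?C = "\<lambda>\<omega>. card {E\<in>Pow I. esym_small k \<delta> \<Lambda> I (Z E \<omega>)}"
  \<comment> \<open>The variables with index above \<open>n\<close> serve as the independent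
    copies.\<close>
  define h where "h E i = (if i \<in> E then i else n + i)" for E :: "nat set" and i
  have Zh: "Z E \<omega> i = X (h E i) \<omega>" for E \<omega> i by (simp add: Z_def mix_def h_def)
  have hI: "inj_on (h E) I" "h E ` I \<subseteq> {1..2*n}" for E by (auto simp: h_def I_def inj_on_def)
  have ms: "?E E \<in> events" for E
    using hI(2)[of E] by (intro esym_small_measurable I) (auto simp: Zh image_subset_iff)
  let ?S = "{\<omega>\<in>space M. esym_small k \<delta> \<Lambda> I (\<lambda>i. X i \<omega>)}"
  have same: "prob (?E E) = prob ?S" for E
  proof -
    have Z: "Z E \<omega> = (\<lambda>i. X (h E i) \<omega>)" for \<omega> by (rule ext) (rule Zh)
    have "prob {\<omega>\<in>space M. esym_small k \<delta> \<Lambda> I (\<lambda>i. X (h E i) \<omega>)} = prob ?S"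
    proof (rule prob_iid_reindex[OF ind _ I(3) hI])
      show "distr M borel (X i) = \<nu>" if "i \<in> {1..2*n}" for i using law that .
      show "{y\<in>space (PiM I (\<lambda>_. borel)). esym_small k \<delta> \<Lambda> I y} \<in> sets (PiM I (\<lambda>_. borel))"
        by (rule esym_small_measurable[OF I(1)]) (rule measurable_component_singleton)
      show "esym_small k \<delta> \<Lambda> I y = esym_small k \<delta> \<Lambda> I z" if "\<And>i. i \<in> I \<Longrightarrow> y i = z i" for y z
        unfolding esym_small_def esym_def using that by simp
    qed
    then show ?thesis by (simp only: Z)
  qed
  define G where "G \<omega> = {i\<in>I. X i \<omega> \<in> B \<and> X (n + i) \<omega> \<in> A}" for \<omega>
  define W where "W i \<omega> = (indicator B (X i \<omega>) * indicator A (X (n + i) \<omega>) :: real)" for i \<omega>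
  have W [measurable]: "W i \<in> borel_measurable M" if "i \<in> I" for i
  proof -
    have [measurable]: "X i \<in> borel_measurable M" "X (n + i) \<in> borel_measurable M"
      using that by (auto simp: I_def intro!: rv)
    show ?thesis unfolding W_def by measurable
  qed
  have GW: "real (card (G \<omega>)) = (\<Sum>i\<in>I. W i \<omega>)" for \<omega>
  proof -
    have "(\<Sum>i\<in>I. W i \<omega>) = (\<Sum>i\<in>I. if X i \<omega> \<in> B \<and> X (n + i) \<omega> \<in> A then 1 else 0)"
      by (intro sum.cong) (auto simp: W_def indicator_def)
    also have "\<dots> = real (card (G \<omega>))" using I by (simp add: G_def sum.If_cases Int_def)
    finally show ?thesis by simp
  qed
  have XP: "prob (X i -` C \<inter> space M) = measure \<nu> C" if "i \<in> {1..2*n}" "C \<in> sets borel" for i C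
    using measure_distr[OF rv[OF that(1)] that(2)] law[OF that(1)] by simp
  have EW: "expectation (W i) = p" if i: "i \<in> I" for i
  proof -
    have i2: "i \<in> {1..2*n}" "n + i \<in> {1..2*n}" "i \<noteq> n + i" using i n by (auto simp: I_def)
    let ?C = "\<lambda>j. if j = i then B else A"
    define D where "D = (\<Inter>j\<in>{i, n + i}. X j -` ?C j \<inter> space M)"
    have "expectation (W i) = expectation (indicator D)"
      using i2 by (intro Bochner_Integration.integral_cong) (auto simp: W_def indicator_def D_def)
    also have "\<dots> = prob (D \<inter> space M)" by (rule Bochner_Integration.integral_indicator)
    also have "\<dots> = prob (\<Inter>j\<in>{i, n + i}. X j -` ?C j \<inter> space M)"
      by (rule arg_cong[of _ _ prob]) (auto simp: D_def)
    also have "\<dots> = (\<Prod>j\<in>{i, n + i}. prob (X j -` ?C j \<inter> space M))"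
      using i2 AB by (intro indep_varsD[OF ind]) auto
    also have "\<dots> = p" using i2 AB n by (simp add: XP p)
    finally show ?thesis .
  qed
  have indW: "indep_vars (\<lambda>_. borel) W I"
  proof -
    have "indep_vars (\<lambda>j. PiM {j, n + j} (\<lambda>_. borel)) (\<lambda>j \<omega>. restrict (\<lambda>i. X i \<omega>) {j, n + j}) I"
      by (rule indep_vars_restrict[OF ind]) (auto simp: I_def disjoint_family_on_def)
    then have "indep_vars (\<lambda>_. borel) (\<lambda>j \<omega>. (\<lambda>y. indicator B (y j) * indicator A (y (n + j)) :: real)
        (restrict (\<lambda>i. X i \<omega>) {j, n + j})) I"
      by (rule indep_vars_compose2) measurable
    then show ?thesis unfolding W_def by simp
  qed
  interpret H: Hoeffding_ineq M I W "\<lambda>_. 0" "\<lambda>_. 1" "\<Sum>i\<in>I. expectation (W i)"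
    by unfold_locales (use I indW in \<open>auto simp: W_def indicator_def\<close>)
  \<comment> \<open>\<open>card (G \<omega>)\<close> is a sum of independent indicators with total
    mean \<open>n * p\<close>. By Hoeffding's inequality it is exponentially unlikely to stay below
    half of that.\<close>
  define bad where "bad = {\<omega>\<in>space M. (\<Sum>i\<in>I. W i \<omega>) \<le> n * p / 2}"
  have bad [measurable]: "bad \<in> events" unfolding bad_def by measurable
  have "prob bad \<le> exp (-2 * (n * p / 2)\<^sup>2 / n)"
  proof -
    have "(\<Sum>i\<in>I. expectation (W i)) - n * p / 2 = n * p / 2" using EW I by simp
    then show ?thesis
      using H.Hoeffding_ineq_le[of "n * p / 2"] p n I by (simp add: bad_def)
  qed
  also have "-2 * (n * p / 2)\<^sup>2 / n = - (real n * p\<^sup>2 / 2)" using n by (simp add: power2_eq_square)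
  finally have pb: "prob bad \<le> exp (- (real n * p\<^sup>2 / 2))" by simp
  let ?N = "\<lambda>\<omega>. real (?C \<omega>) / 2 ^ n"
  have Nsum: "?N \<omega> = (\<Sum>E\<in>Pow I. indicator (?E E) \<omega> / 2 ^ n)"
    if "\<omega> \<in> space M" for \<omega>
  proof -
    have "(\<Sum>E\<in>Pow I. indicator (?E E) \<omega> :: real)
      = (\<Sum>E\<in>Pow I. if esym_small k \<delta> \<Lambda> I (Z E \<omega>) then 1 else 0)"
      using that by (intro sum.cong) (auto simp: indicator_def)
    also have "\<dots> = real (?C \<omega>)"
      using I by (simp add: sum.If_cases Int_def)
    finally show ?thesis by (simp add: sum_divide_distrib[symmetric])
  qed
  \<comment> \<open>Off \<open>bad\<close> there are more than \<open>n * p / 2\<close> good pairs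
    and the deterministic count applies; on \<open>bad\<close> a proportion is at most 1.\<close>
  have Nle: "?N \<omega> \<le> k / sqrt (n * p / 2) + indicator bad \<omega>" if w: "\<omega> \<in> space M" for \<omega>
  proof (cases "\<omega> \<in> bad")
    case True
    have "?C \<omega> \<le> card (Pow I)"
      using I by (intro card_mono) auto
    then have c: "?C \<omega> \<le> 2 ^ n"
      using I by (simp add: card_Pow)
    have "real (?C \<omega>) \<le> real (2 ^ n)"
      using c by (rule of_nat_mono)
    then have "?N \<omega> \<le> 1" by simp
    moreover have "indicator bad \<omega> = (1 :: real)" using True by simp
    moreover have "0 \<le> k / sqrt (n * p / 2)" using p by simp
    ultimately show ?thesis by linarith
  next
    case False
    then have gt: "n * p / 2 < card (G \<omega>)" using w by (simp add: bad_def GW)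
    have np: "0 < n * p / 2" using n p by simp
    have "G \<omega> \<noteq> {}" using gt np by auto
    have "real (card {E\<in>Pow I. esym_small k \<delta> \<Lambda> I (mix E (\<lambda>i. X i \<omega>) (\<lambda>i. X (n + i) \<omega>))}) / 2 ^ card I
        \<le> k / sqrt (card (G \<omega>))"
      by (rule card_esym_small_le[OF I(1) _ \<open>G \<omega> \<noteq> {}\<close> d _ eta L \<delta>]) (auto simp: G_def xy)
    then have "?N \<omega> \<le> k / sqrt (card (G \<omega>))" by (simp only: Z_def I(2))
    also have "\<dots> \<le> k / sqrt (n * p / 2)"
      using gt np by (intro divide_left_mono mult_pos_pos) auto
    finally show ?thesis using False by simp
  qed
  have "prob ?S = (\<Sum>E\<in>Pow I. prob (?E E) / 2 ^ n)"
    using I by (simp add: same card_Pow)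
  also have "\<dots> = expectation (\<lambda>\<omega>. \<Sum>E\<in>Pow I. indicator (?E E) \<omega> / 2 ^ n)"
    using ms by (subst Bochner_Integration.integral_sum) (auto simp: emeasure_eq_measure)
  also have "\<dots> \<le> expectation (\<lambda>\<omega>. k / sqrt (n * p / 2) + indicator bad \<omega>)"
    using ms bad Nle Nsum
    by (intro integral_mono Bochner_Integration.integrable_sum Bochner_Integration.integrable_add)
       (auto simp: emeasure_eq_measure)
  also have "\<dots> = k / sqrt (n * p / 2) + prob bad"
    using bad by (subst Bochner_Integration.integral_add) (auto simp: prob_space emeasure_eq_measure)
  also have "\<dots> \<le> k / sqrt (n * p / 2) + exp (- (real n * p\<^sup>2 / 2))" using pb by simp
  finally show ?thesis unfolding I_def .
qed

text \<open>Pigeonhole on a square grid of mesh \<open>R / N\<close>: the rounded coordinates lie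
  between -N and N, so at most (2N+1)^2 <= 9 N^2 cells meet \<open>Q\<close>. The factor 2 in the
  diameter comes from adding real and imaginary parts.\<close>

lemma small_cell_of_large_mass:
  assumes "finite_measure \<nu>" and s: "sets \<nu> = sets borel" and Q: "Q \<in> sets borel" "Q \<subseteq> cball 0 R"
    and R: "R > 0" and N: "N \<ge> (1::nat)"
  obtains A :: "complex set" where "A \<in> sets borel" "A \<subseteq> Q" "measure \<nu> A \<ge> measure \<nu> Q / (9 * real N ^ 2)"
    "\<And>x y. x \<in> A \<Longrightarrow> y \<in> A \<Longrightarrow> norm (x - y) \<le> 2 * R / N"
proof -
  interpret finite_measure \<nu> by fact
  define f where "f z = (\<lfloor>Re z * N / R\<rfloor>, \<lfloor>Im z * N / R\<rfloor>)" for z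
  define C where "C q = {z\<in>Q. f z = q}" for q
  define I where "I = {- int N..int N} \<times> {- int N..int N}"
  note [measurable] = Q(1)
  have Cm: "C q \<in> sets borel" for q
    unfolding C_def f_def by (cases q) (simp, measurable)
  have floor_mem: "\<lfloor>t * N / R\<rfloor> \<in> {- int N..int N}" if "\<bar>t\<bar> \<le> R" for t
  proof -
    have "t * N \<le> R * N" "- (R * N) \<le> t * N" using that
      by (auto simp: abs_le_iff intro!: mult_right_mono) (metis minus_le_iff minus_mult_left mult_right_mono of_nat_0_le_iff)
    then have "t * N / R \<le> N" "- real N \<le> t * N / R" using R by (auto simp: field_simps)
    then show ?thesis by (auto simp: le_floor_iff floor_le_iff)
  qed
  have cover: "Q = (\<Union>q\<in>I. C q)"
  proof -
    have "f z \<in> I" if "z \<in> Q" for z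
    proof -
      have "norm z \<le> R" using that Q by auto
      then show ?thesis unfolding f_def I_def
        using floor_mem[of "Re z"] floor_mem[of "Im z"] abs_Re_le_cmod[of z] abs_Im_le_cmod[of z] by auto
    qed
    then show ?thesis by (auto simp: C_def)
  qed
  have cI: "real (card I) \<le> 9 * real N ^ 2" "finite I" "I \<noteq> {}"
  proof -
    have "nat (int N + int N + 1) = 2 * N + 1" by linarith
    then have "card {- int N..int N} = 2 * N + 1" by simp
    then have "card I = (2 * N + 1) * (2 * N + 1)" by (simp only: I_def card_cartesian_product)
    then have "real (card I) = (2 * real N + 1) * (2 * real N + 1)" by (simp add: algebra_simps)
    also have "\<dots> \<le> (3 * real N) * (3 * real N)" using N by (intro mult_mono) auto
    finally show "real (card I) \<le> 9 * real N ^ 2" by (simp add: power2_eq_square)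
  qed (auto simp: I_def)
  have "\<exists>q\<in>I. measure \<nu> (C q) \<ge> measure \<nu> Q / (9 * real N ^ 2)"
  proof (rule ccontr)
    assume "\<not> ?thesis"
    then have lt: "measure \<nu> (C q) < measure \<nu> Q / (9 * real N ^ 2)" if "q \<in> I" for q using that by auto
    have "measure \<nu> Q \<le> (\<Sum>q\<in>I. measure \<nu> (C q))"
      unfolding cover using Cm cI s by (intro measure_UNION_le) auto
    also have "\<dots> < (\<Sum>q\<in>I. measure \<nu> Q / (9 * real N ^ 2))"
      using cI lt by (intro sum_strict_mono) auto
    also have "\<dots> = card I * (measure \<nu> Q / (9 * real N ^ 2))" by simp
    also have "\<dots> \<le> (9 * real N ^ 2) * (measure \<nu> Q / (9 * real N ^ 2))"
      using cI by (intro mult_right_mono) auto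
    also have "\<dots> = measure \<nu> Q" using N by simp
    finally show False by simp
  qed
  then obtain q where q: "measure \<nu> (C q) \<ge> measure \<nu> Q / (9 * real N ^ 2)" by blast
  show ?thesis
  proof (rule that[of "C q"])
    fix x y assume xy: "x \<in> C q" "y \<in> C q"
    have close: "\<bar>s - t\<bar> \<le> R / N" if "\<lfloor>s * N / R\<rfloor> = \<lfloor>t * N / R\<rfloor>" for s t :: real
    proof -
      have "\<bar>s * N / R - t * N / R\<bar> \<le> 1" using that by linarith
      also have "s * N / R - t * N / R = (s - t) * (N / R)" by (simp add: algebra_simps diff_divide_distrib)
      also have "\<bar>\<dots>\<bar> = \<bar>s - t\<bar> * (N / R)" using R by (simp add: abs_mult)
      finally show ?thesis using R N by (simp add: field_simps)
    qed
    have "\<bar>Re (x - y)\<bar> \<le> R / N" "\<bar>Im (x - y)\<bar> \<le> R / N"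
      using xy close by (auto simp: C_def f_def)
    then show "norm (x - y) \<le> 2 * R / N" using cmod_le[of "x - y"] by simp
  qed (use q Cm in \<open>auto simp: C_def\<close>)
qed

text \<open>By the Lindelof property there is a point \<open>u\<close> all of whose neighbourhoods
  have positive mass. As {u} does not carry the full mass, some bounded set at positive distance
  from \<open>u\<close> is charged too.\<close>

lemma nondegenerate_split:
  fixes \<nu> :: "complex measure"
  assumes "prob_space \<nu>" and s: "sets \<nu> = sets borel" and nd: "\<And>a. measure \<nu> {a} < 1"
  obtains P Q \<kappa> R where "P \<in> sets borel" "Q \<in> sets borel" "\<kappa> > 0" "R > 0" "P \<subseteq> cball 0 R" "Q \<subseteq> cball 0 R"
    "measure \<nu> P > 0" "measure \<nu> Q > 0" "\<And>x y. x \<in> P \<Longrightarrow> y \<in> Q \<Longrightarrow> norm (x - y) \<ge> \<kappa>"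
proof -
  interpret prob_space \<nu> by fact
  have sp: "space \<nu> = UNIV" using sets_eq_imp_space_eq[OF s] by simp
  have "\<exists>u. \<forall>r>0. measure \<nu> (ball u r) > 0"
  proof (rule ccontr)
    assume "\<not> ?thesis"
    then have "\<forall>u. \<exists>r>0. measure \<nu> (ball u r) = 0"
      by (metis measure_nonneg less_eq_real_def)
    then obtain r where r: "\<And>u. r u > 0" "\<And>u. measure \<nu> (ball u (r u)) = 0" by metis
    obtain F where F: "F \<subseteq> range (\<lambda>u. ball u (r u))" "countable F" "\<Union>F = \<Union>(range (\<lambda>u. ball u (r u)))"
      using Lindelof[of "range (\<lambda>u. ball u (r u))"] by auto
    have "\<Union>F = UNIV" unfolding F(3) using r(1) by (auto intro: centre_in_ball[THEN iffD2])
    moreover have "S \<in> null_sets \<nu>" if "S \<in> F" for S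
      using F(1) r(2) that by (auto simp: null_sets_def s emeasure_eq_measure)
    then have "\<Union>F \<in> null_sets \<nu>"
      using null_sets_UN'[OF F(2), of "\<lambda>S. S" \<nu>] by simp
    ultimately show False using emeasure_space_1 sp by (auto simp: null_sets_def)
  qed
  then obtain u where u: "\<And>r. r > 0 \<Longrightarrow> measure \<nu> (ball u r) > 0" by blast
  define C where "C m = {z. 1 / (real m + 1) \<le> norm (z - u)} \<inter> cball 0 (real m)" for m :: nat
  have Cm: "C m \<in> sets borel" for m
  proof -
    have "closed (C m)" unfolding C_def
      by (intro closed_Int closed_Collect_le continuous_intros closed_cball)
    then show ?thesis by (rule borel_closed)
  qed
  have "\<exists>m. measure \<nu> (C m) > 0"
  proof (rule ccontr)
    assume "\<not> ?thesis"
    then have 0: "measure \<nu> (C m) = 0" for m by (metis measure_nonneg less_eq_real_def)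
    have "(\<Union>m. C m) \<in> null_sets \<nu>"
      using Cm 0 by (intro null_sets_UN) (auto simp: null_sets_def s emeasure_eq_measure)
    moreover have "UNIV - {u} \<subseteq> (\<Union>m. C m)"
    proof
      fix z assume "z \<in> UNIV - {u}"
      then have z: "norm (z - u) > 0" by simp
      obtain m1 where m1: "norm z \<le> real m1" using real_arch_simple by blast
      obtain m2 where m2: "1 / norm (z - u) \<le> real m2" using real_arch_simple by blast
      have "1 \<le> norm (z - u) * real m2" using m2 z by (simp add: field_simps)
      also have "\<dots> \<le> norm (z - u) * (real (max m1 m2) + 1)" by (intro mult_left_mono) auto
      finally have "z \<in> C (max m1 m2)" using m1 by (auto simp: C_def field_simps)
      then show "z \<in> (\<Union>m. C m)" by blast
    qed
    ultimately have "UNIV - {u} \<in> null_sets \<nu>"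
      using null_sets_subset[of "\<Union>m. C m" \<nu> "UNIV - {u}"] by (simp add: s)
    then have "measure \<nu> (UNIV - {u}) = 0" by (simp add: measure_def null_setsD1)
    then show False using prob_compl[of "{u}"] nd[of u] s sp by simp
  qed
  then obtain m where m: "measure \<nu> (C m) > 0" by blast
  \<comment> \<open>Half of the distance that \<open>C m\<close> keeps from \<open>u\<close>; the
    other half is the radius of the ball around \<open>u\<close>.\<close>
  define \<kappa> where "\<kappa> = 1 / (2 * (real m + 1))"
  have k: "\<kappa> > 0" "\<kappa> \<le> 1" "1 / (real m + 1) = 2 * \<kappa>" by (auto simp: \<kappa>_def field_simps)
  show ?thesis
  proof (rule that[of "ball u \<kappa>" "C m" \<kappa> "real m + norm u + 1"])
    show "ball u \<kappa> \<subseteq> cball 0 (real m + norm u + 1)"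
    proof
      fix z assume "z \<in> ball u \<kappa>"
      then have "norm (z - u) \<le> 1" using k by (auto simp: dist_norm norm_minus_commute)
      then show "z \<in> cball 0 (real m + norm u + 1)" using norm_triangle_sub[of z u] by auto
    qed
    show "C m \<subseteq> cball 0 (real m + norm u + 1)"
    proof
      fix z assume "z \<in> C m"
      then have "norm z \<le> real m" by (simp add: C_def)
      then show "z \<in> cball 0 (real m + norm u + 1)" using norm_ge_zero[of u] unfolding mem_cball_0 by linarith
    qed
    show "norm (x - y) \<ge> \<kappa>" if "x \<in> ball u \<kappa>" "y \<in> C m" for x y
    proof -
      have "norm (x - u) < \<kappa>" "2 * \<kappa> \<le> norm (y - u)"
        using that k by (auto simp: C_def dist_norm norm_minus_commute)
      moreover have "norm (y - u) \<le> norm (x - u) + norm (x - y)"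
        using norm_triangle_ineq4[of "x - u" "x - y"] by simp
      ultimately show ?thesis by linarith
    qed
  qed (use k m u Cm in \<open>auto intro!: add_nonneg_pos\<close>)
qed

text \<open>Bernoulli's inequality bounds (1 - \<eta>)^n below by 2/3, and (1 + \<eta>)^n (1 -
  \<eta>)^n is at most 1.\<close>

lemma power_le_three_halves:
  assumes "0 \<le> \<eta>" "real n * \<eta> \<le> 1 / 3" "\<eta> < 1"
  shows "(1 + \<eta>) ^ n \<le> (3 / 2 :: real)"
proof -
  have "1 + n * (-\<eta>) \<le> (1 + (-\<eta>)) ^ n" using assms by (intro Bernoulli_inequality) auto
  then have a: "2 / 3 \<le> (1 - \<eta>) ^ n" using assms by simp
  have "(1 + \<eta>) ^ n * (1 - \<eta>) ^ n = (1 - \<eta>\<^sup>2) ^ n"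
    by (simp add: power_mult_distrib[symmetric] algebra_simps power2_eq_square)
  also have "\<dots> \<le> 1" using assms by (intro power_le_one) (auto simp: power_le_one power2_eq_square mult_le_one)
  finally have "(1 + \<eta>) ^ n * (1 - \<eta>) ^ n \<le> 1" .
  moreover have "(1 + \<eta>) ^ n * (2 / 3) \<le> (1 + \<eta>) ^ n * (1 - \<eta>) ^ n"
    using a assms by (intro mult_left_mono) auto
  ultimately show ?thesis by simp
qed

lemma triangular_le_square: "1 \<le> k \<Longrightarrow> \<Sum>{..k} \<le> k\<^sup>2" for k :: nat
proof (induction k rule: dec_induct)
  case (step k)
  then show ?case by (simp add: power2_eq_square)
qed simp

text \<open>The determinant contains k(k+1)/2 <= k^2 difference factors, so each may have relative
  error 1/(3 k^2), which asks for cells of diameter of order 1/k^2. A grid that fine has of order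
  k^4 cells; the pigeonhole principle leaves mass of order k^(-4) to \<open>A\<close> and to
  \<open>B\<close>, whence the exponent 8.\<close>

lemma nondegenerate_cells:
  fixes \<nu> :: "complex measure"
  assumes pr: "prob_space \<nu>" and s: "sets \<nu> = sets borel" and nd: "\<And>a. measure \<nu> {a} < 1"
  obtains \<kappa> c where "0 < \<kappa>" "\<kappa> \<le> 1" "0 < c"
    "\<And>k. 1 \<le> k \<Longrightarrow> \<exists>A B d \<eta>. A \<in> sets borel \<and> B \<in> sets borel \<and> \<kappa> \<le> norm d \<and>
       (\<forall>x\<in>B. \<forall>y\<in>A. norm ((x - y) / d - 1) \<le> \<eta>) \<and> (1 + \<eta>) ^ (\<Sum>{..k}) \<le> 3 / 2 \<and>
       c / real k ^ 8 \<le> measure \<nu> A * measure \<nu> B"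
proof -
  interpret prob_space \<nu> by fact
  obtain P Q \<kappa> R where PQ: "P \<in> sets borel" "Q \<in> sets borel" "\<kappa> > 0" "R > 0" "P \<subseteq> cball 0 R" "Q \<subseteq> cball 0 R"
    "measure \<nu> P > 0" "measure \<nu> Q > 0" "\<And>x y. x \<in> P \<Longrightarrow> y \<in> Q \<Longrightarrow> norm (x - y) \<ge> \<kappa>"
    using nondegenerate_split[OF pr s nd] by blast
  \<comment> \<open>Chosen so that \<open>4 * R / (C * k\<^sup>2 * \<kappa>)\<close> is at most
    \<open>1 / (3 * k\<^sup>2)\<close>.\<close>
  obtain C where C: "12 * R / \<kappa> \<le> real C" using real_arch_simple by blast
  have C1: "real C > 0" using C PQ by (meson divide_pos_pos less_le_trans mult_pos_pos zero_less_numeral)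
  define c where "c = measure \<nu> P * measure \<nu> Q / (81 * real C ^ 4)"
  show ?thesis
  \<comment> \<open>The minimum with 1 makes the powers of this bound decreasing and its logarithm
    nonpositive, as later estimates require.\<close>
  proof (rule that[of "min \<kappa> 1" c])
    show "0 < c" using PQ C1 by (simp add: c_def)
    fix k :: nat assume k: "1 \<le> k"
    define N where "N = C * k\<^sup>2"
    have N1: "N \<ge> 1" using C1 k by (simp add: N_def Suc_le_eq)
    obtain A where A: "A \<in> sets borel" "A \<subseteq> P" "measure \<nu> A \<ge> measure \<nu> P / (9 * real N ^ 2)"
      "\<And>x y. x \<in> A \<Longrightarrow> y \<in> A \<Longrightarrow> norm (x - y) \<le> 2 * R / N"
      using small_cell_of_large_mass[OF finite_measure_axioms s PQ(1,5,4) N1] by blast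
    obtain B where B: "B \<in> sets borel" "B \<subseteq> Q" "measure \<nu> B \<ge> measure \<nu> Q / (9 * real N ^ 2)"
      "\<And>x y. x \<in> B \<Longrightarrow> y \<in> B \<Longrightarrow> norm (x - y) \<le> 2 * R / N"
      using small_cell_of_large_mass[OF finite_measure_axioms s PQ(2,6,4) N1] by blast
    have "measure \<nu> P / (9 * real N ^ 2) > 0" "measure \<nu> Q / (9 * real N ^ 2) > 0" using PQ N1 by auto
    then have "measure \<nu> A > 0" "measure \<nu> B > 0" using A B by linarith+
    then obtain a b where ab: "a \<in> A" "b \<in> B" by (metis equals0I measure_empty less_irrefl)
    define d where "d = b - a"
    have d: "\<kappa> \<le> norm d" using PQ(9)[of a b] ab A B by (auto simp: d_def norm_minus_commute)
    define \<eta> where "\<eta> = 4 * R / (N * \<kappa>)"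
    have xy: "norm ((x - y) / d - 1) \<le> \<eta>" if "x \<in> B" "y \<in> A" for x y
    proof -
      have d0: "d \<noteq> 0" using d PQ by auto
      have "(x - y) / d - 1 = ((x - b) - (y - a)) / d" using d0 by (simp add: d_def field_simps)
      also have "norm \<dots> \<le> (norm (x - b) + norm (y - a)) / norm d"
        unfolding norm_divide by (intro divide_right_mono norm_triangle_ineq4) simp
      also have "\<dots> \<le> (2 * R / N + 2 * R / N) / \<kappa>"
        using A B ab that d PQ by (intro frac_le add_mono) (auto intro!: add_nonneg_nonneg divide_nonneg_nonneg)
      finally show ?thesis by (simp add: \<eta>_def)
    qed
    have eta: "(1 + \<eta>) ^ (\<Sum>{..k}) \<le> 3 / 2"
    proof (rule power_le_three_halves)
      have e0: "\<eta> \<ge> 0" using PQ by (simp add: \<eta>_def)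
      then show "0 \<le> \<eta>" .
      have le: "real (k\<^sup>2) * \<eta> \<le> 1 / 3"
        using C C1 k PQ by (simp add: \<eta>_def N_def field_simps)
      have "real (\<Sum>{..k}) \<le> real (k\<^sup>2)" using triangular_le_square[OF k] by (simp only: of_nat_le_iff)
      then have "real (\<Sum>{..k}) * \<eta> \<le> real (k\<^sup>2) * \<eta>" using e0 by (rule mult_right_mono)
      with le show "real (\<Sum>{..k}) * \<eta> \<le> 1 / 3" by linarith
      have "1 * \<eta> \<le> real (k\<^sup>2) * \<eta>" using e0 k by (intro mult_right_mono) auto
      with le show "\<eta> < 1" by linarith
    qed
    have "c / real k ^ 8 = (measure \<nu> P / (9 * real N ^ 2)) * (measure \<nu> Q / (9 * real N ^ 2))"
      using C1 k by (simp add: c_def N_def field_simps flip: power_mult power_add)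
    also have "\<dots> \<le> measure \<nu> A * measure \<nu> B" using A B by (intro mult_mono) auto
    finally have p: "c / real k ^ 8 \<le> measure \<nu> A * measure \<nu> B" .
    show "\<exists>A B d \<eta>. A \<in> sets borel \<and> B \<in> sets borel \<and> min \<kappa> 1 \<le> norm d \<and>
       (\<forall>x\<in>B. \<forall>y\<in>A. norm ((x - y) / d - 1) \<le> \<eta>) \<and> (1 + \<eta>) ^ (\<Sum>{..k}) \<le> 3 / 2 \<and>
       c / real k ^ 8 \<le> measure \<nu> A * measure \<nu> B"
      using A(1) B(1) d xy eta p by (intro exI[of _ A] exI[of _ B] exI[of _ d] exI[of _ \<eta>]) auto
  qed (use PQ in auto)
qed

section \<open>Anticoncentration as n tends to infinity\<close>

lemma esym_const: "finite I \<Longrightarrow> esym k I (\<lambda>_. a) = of_nat (card I choose k) * a ^ k"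
proof (induction I arbitrary: k rule: finite_induct)
  case empty
  then show ?case by (cases k) (auto simp: esym_empty)
next
  case (insert i I)
  then show ?case by (cases k) (auto simp: esym_insert algebra_simps)
qed

text \<open>Everything except the exponential is a power of n with exponent of order k^2: the
  factorial is at most n^(2 k^2), and the powers of n^4 give n^(4 k^2). For k <= ln n the product is
  at most exp (6 (ln n)^3), and \<kappa>^(k^2) accounts for the term with \<open>ln \<kappa>\<close>
  in \<open>big\<close>.\<close>

lemma fact_Suc_mult_power_less:
  fixes \<epsilon> :: real
  assumes k: "1 \<le> k" "real k \<le> ln (real n)" and n: "n \<ge> 2" and \<kappa>: "0 < \<kappa>" "\<kappa> \<le> 1"
    and big: "6 * ln n ^ 3 - ln \<kappa> * ln n ^ 2 + ln 2 < \<epsilon> * n"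
  shows "fact (Suc k) * (exp (- (\<epsilon> * real n)) * ((real n ^ 4) ^ k) ^ k) < \<kappa> ^ (\<Sum>{..k}) / 2"
proof -
  have kn: "Suc k \<le> n"
  proof -
    have "ln (real n) \<le> real n - 1" using n by (intro ln_le_minus_one) auto
    then show ?thesis using k by linarith
  qed
  have l0: "0 < ln (real n)" using n by simp
  have k2: "Suc k \<le> 2 * k\<^sup>2" using k(1) self_le_power[of k 2] by linarith
  have "fact (Suc k) \<le> real (Suc k ^ Suc k)" by (metis fact_le_power le_refl)
  also have "\<dots> \<le> real (n ^ (2 * k\<^sup>2))"
  proof -
    have "Suc k ^ Suc k \<le> n ^ Suc k" using kn by (rule power_mono) simp
    also have "\<dots> \<le> n ^ (2 * k\<^sup>2)" using k2 n by (intro power_increasing) auto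
    finally show ?thesis by (simp only: of_nat_le_iff)
  qed
  also have "\<dots> = real n ^ (2 * k\<^sup>2)" by simp
  finally have "fact (Suc k) * (exp (- (\<epsilon> * real n)) * ((real n ^ 4) ^ k) ^ k)
      \<le> real n ^ (2 * k\<^sup>2) * (exp (- (\<epsilon> * real n)) * ((real n ^ 4) ^ k) ^ k)"
    by (rule mult_right_mono) simp
  also have "\<dots> = exp (- (\<epsilon> * real n)) * real n ^ (6 * k\<^sup>2)"
    by (simp add: power2_eq_square flip: power_mult power_add)
  also have "real n ^ (6 * k\<^sup>2) = exp (6 * real k ^ 2 * ln n)"
    using exp_of_nat_mult[of "6 * k\<^sup>2" "ln (real n)"] n by simp
  also have "exp (- (\<epsilon> * real n)) * \<dots> = exp (6 * real k ^ 2 * ln n - (\<epsilon> * real n))"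
    by (simp flip: exp_add)
  also have "\<dots> < exp (real (k\<^sup>2) * ln \<kappa> - ln 2)"
  proof -
    have kk: "real k ^ 2 \<le> ln n ^ 2" using k by (intro power_mono) auto
    have "6 * real k ^ 2 * ln n \<le> 6 * ln n ^ 2 * ln n"
      using kk l0 by (intro mult_right_mono) auto
    moreover have "- ln \<kappa> * real k ^ 2 \<le> - ln \<kappa> * ln n ^ 2"
      using kk \<kappa> by (intro mult_left_mono) auto
    moreover have "6 * ln n ^ 2 * ln n = 6 * ln (real n) ^ 3" by (simp add: power2_eq_square power3_eq_cube)
    ultimately have "6 * real k ^ 2 * ln n - \<epsilon> * real n < real k ^ 2 * ln \<kappa> - ln 2"
      using big by (simp add: algebra_simps)
    then show ?thesis by simp
  qed
  also have "\<dots> = \<kappa> ^ (k\<^sup>2) / 2"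
    using exp_of_nat_mult[of "k\<^sup>2" "ln \<kappa>"] \<kappa> by (simp add: exp_diff)
  also have "\<dots> \<le> \<kappa> ^ (\<Sum>{..k}) / 2"
    using \<kappa> triangular_le_square[OF k(1)] by (intro divide_right_mono power_decreasing) auto
  finally show ?thesis .
qed

text \<open>If \<nu> is not a point mass, \<open>p\<close> is at least of order (ln n)^(-8), and the
  bound is of order (ln n)^5 / sqrt n up to a negligible exponential. If it is the point mass at
  \<open>a\<close>, then e_k is a binomial coefficient times a^k; assumption \<open>z\<close> gives
  a \<noteq> 0, and k <= ln n keeps |a|^k above exp (-\<epsilon> n).\<close>

lemma (in prob_space) esym_anticoncentration_limit:
  fixes X :: "nat \<Rightarrow> 'a \<Rightarrow> complex" and \<epsilon> :: real
  assumes ind: "indep_vars (\<lambda>_. borel) X {1..}"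
    and law: "\<And>i. i \<ge> 1 \<Longrightarrow> distr M borel (X i) = \<nu>" and z: "measure \<nu> {0} = 0"
    and k: "\<forall>\<^sub>F n in sequentially. 1 \<le> k n \<and> real (k n) \<le> ln (real n)" and \<epsilon>: "\<epsilon> > 0"
  shows "(\<lambda>n. prob {\<omega>\<in>space M. esym_small (k n) (exp (- (\<epsilon> * real n))) (real n ^ 4) {1..n} (\<lambda>i. X i \<omega>)})
    \<longlonglongrightarrow> 0"
proof -
  let ?S = "\<lambda>n. {\<omega>\<in>space M. esym_small (k n) (exp (- (\<epsilon> * real n))) (real n ^ 4) {1..n} (\<lambda>i. X i \<omega>)}"
  have rv [measurable]: "X i \<in> borel_measurable M" if "i \<ge> 1" for i
    using ind that by (auto simp: indep_vars_def)
  have s: "sets \<nu> = sets borel" using law[of 1] by (metis sets_distr order_refl)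
  interpret \<nu>: prob_space \<nu> using law[of 1] prob_space_distr[OF rv[of 1]] by simp
  show ?thesis
  proof (cases "\<exists>a. measure \<nu> {a} = 1")
    case True
    then obtain a where a: "measure \<nu> {a} = 1" ..
    then have a0: "a \<noteq> 0" using z by auto
    have AE1: "AE \<omega> in M. X i \<omega> = a" if "i \<ge> 1" for i
    proof -
      have "AE x in \<nu>. x \<in> {a}" using a s by (intro \<nu>.AE_prob_1) simp
      then have "AE x in distr M borel (X i). x = a" by (subst law[OF that]) simp
      then show ?thesis using rv[OF that] by (subst (asm) AE_distr_iff) auto
    qed
    have "\<forall>\<^sub>F n in sequentially. prob (?S n) = 0"
    proof -
      define b where "b = min 1 (norm a)"
      have b: "0 < b" "b \<le> 1" "b \<le> norm a" using a0 by (auto simp: b_def)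
      have "\<forall>\<^sub>F n in sequentially. - ln b * ln (real n) < \<epsilon> * n" using \<epsilon> by real_asymp
      with k eventually_ge_at_top[of 2] show ?thesis
      proof eventually_elim
        case (elim n)
        have kn: "k n \<le> n"
        proof -
          have "ln (real n) \<le> real n - 1" using elim by (intro ln_le_minus_one) auto
          then show ?thesis using elim by linarith
        qed
        have "AE \<omega> in M. \<forall>i\<in>{1..n}. X i \<omega> = a" using AE1 by (intro AE_finite_allI) auto
        then have "AE \<omega> in M. \<not> esym_small (k n) (exp (- (\<epsilon> * real n))) (real n ^ 4) {1..n} (\<lambda>i. X i \<omega>)"
        proof eventually_elim
          case w: (elim \<omega>)
          have "esym (k n) {1..n} (\<lambda>i. X i \<omega>) = esym (k n) {1..n} (\<lambda>i. a)"
            unfolding esym_def using w by (intro arg_cong2[of _ _ _ _ coeff] prod.cong) auto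
          also have "\<dots> = of_nat (n choose k n) * a ^ k n" by (simp add: esym_const)
          also have "norm \<dots> = real (n choose k n) * norm a ^ k n" by (simp add: norm_mult norm_power)
          finally have e: "norm (esym (k n) {1..n} (\<lambda>i. X i \<omega>)) = real (n choose k n) * norm a ^ k n" .
          have "exp (- (\<epsilon> * real n)) < exp (real (k n) * ln b)"
          proof -
            have "- ln b * real (k n) \<le> - ln b * ln (real n)"
              using elim b by (intro mult_left_mono) auto
            then show ?thesis using elim by (simp add: algebra_simps)
          qed
          also have "\<dots> = b ^ k n" using exp_of_nat_mult[of "k n" "ln b"] b by simp
          also have "\<dots> \<le> norm a ^ k n" using b by (intro power_mono) auto
          also have "\<dots> \<le> real (n choose k n) * norm a ^ k n"
          proof -
            have "0 < n choose k n" using kn by simp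
            then have "1 \<le> real (n choose k n)" by linarith
            then have "1 * norm a ^ k n \<le> real (n choose k n) * norm a ^ k n" by (rule mult_right_mono) simp
            then show ?thesis by simp
          qed
          finally show ?case unfolding esym_small_def e by simp
        qed
        moreover have "?S n \<in> events"
          by (rule esym_small_measurable) auto
        ultimately show ?case by (intro prob_eq_0_AE) auto
      qed
    qed
    then show ?thesis by (rule tendsto_eventually)
  next
    case False
    then have nd: "measure \<nu> {a} < 1" for a by (metis \<nu>.prob_le_1 less_eq_real_def)
    obtain \<kappa> c where \<kappa>: "0 < \<kappa>" "\<kappa> \<le> 1" and c: "0 < c" and cells:
      "\<And>k. 1 \<le> k \<Longrightarrow> \<exists>A B d \<eta>. A \<in> sets borel \<and> B \<in> sets borel \<and> \<kappa> \<le> norm d \<and>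
         (\<forall>x\<in>B. \<forall>y\<in>A. norm ((x - y) / d - 1) \<le> \<eta>) \<and> (1 + \<eta>) ^ (\<Sum>{..k}) \<le> 3 / 2 \<and>
         c / real k ^ 8 \<le> measure \<nu> A * measure \<nu> B"
      using nondegenerate_cells[OF \<nu>.prob_space_axioms s nd] by metis
    define g where "g n = ln (real n) / sqrt (n * (c / ln n ^ 8) / 2) + exp (- (n * (c / ln n ^ 8)\<^sup>2 / 2))" for n :: nat
    have "g \<longlonglongrightarrow> 0" unfolding g_def using c by real_asymp
    moreover have "\<forall>\<^sub>F n in sequentially.
       norm (prob (?S n)) \<le> g n"
    proof -
      have "\<forall>\<^sub>F n in sequentially. 6 * ln (real n) ^ 3 - ln \<kappa> * ln (real n) ^ 2 + ln 2 < \<epsilon> * real n"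
        using \<epsilon> by real_asymp
      with k eventually_ge_at_top[of 2] show ?thesis
      proof eventually_elim
        case (elim n)
        then have kn: "1 \<le> k n" "real (k n) \<le> ln n" by auto
        have l0: "0 < ln (real n)" using elim by simp
        obtain A B d \<eta> where AB: "A \<in> sets borel" "B \<in> sets borel" "\<kappa> \<le> norm d"
         "\<And>x y. x \<in> B \<Longrightarrow> y \<in> A \<Longrightarrow> norm ((x - y) / d - 1) \<le> \<eta>" "(1 + \<eta>) ^ (\<Sum>{..k n}) \<le> 3 / 2"
         "c / real (k n) ^ 8 \<le> measure \<nu> A * measure \<nu> B"
          using cells[OF kn(1)] by blast
        define p where "p = measure \<nu> A * measure \<nu> B"
        define q where "q = c / ln n ^ 8"
        have q0: "0 < q" using c l0 by (simp add: q_def)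
        have "q \<le> c / real (k n) ^ 8" unfolding q_def
          using c kn by (intro divide_left_mono power_mono mult_pos_pos) auto
        then have qp: "q \<le> p" using AB(6) by (simp add: p_def)
        have "prob (?S n)
          \<le> k n / sqrt (n * p / 2) + exp (- (n * p\<^sup>2 / 2))"
        proof (rule esym_anticoncentration[OF _ _ AB(1,2) _ AB(4,5) _ _ p_def])
          show "indep_vars (\<lambda>_. borel) X {1..2*n}" using ind by (rule indep_vars_subset) auto
          show "d \<noteq> 0" using AB(3) \<kappa> by auto
          show "1 \<le> real n ^ 4" using elim by (intro one_le_power) auto
          have "fact (Suc (k n)) * (exp (- (\<epsilon> * real n)) * ((real n ^ 4) ^ k n) ^ k n) < \<kappa> ^ (\<Sum>{..k n}) / 2"
            using elim \<kappa> by (intro fact_Suc_mult_power_less) auto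
          also have "\<dots> \<le> norm d ^ (\<Sum>{..k n}) / 2"
            using AB(3) \<kappa> by (intro divide_right_mono power_mono) auto
          finally show "fact (Suc (k n)) * (exp (- (\<epsilon> * real n)) * ((real n ^ 4) ^ k n) ^ k n) < norm d ^ (\<Sum>{..k n}) / 2" .
        qed (use law qp q0 elim in auto)
        also have "\<dots> \<le> ln n / sqrt (n * q / 2) + exp (- (n * q\<^sup>2 / 2))"
        proof (intro add_mono)
          show "k n / sqrt (n * p / 2) \<le> ln n / sqrt (n * q / 2)"
            using kn qp q0 elim by (intro frac_le) (auto intro!: mult_left_mono)
          have "q\<^sup>2 \<le> p\<^sup>2" using qp q0 by (intro power_mono) auto
          then show "exp (- (n * p\<^sup>2 / 2)) \<le> exp (- (n * q\<^sup>2 / 2))"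
            by (auto intro!: mult_left_mono)
        qed
        finally show ?case by (simp add: g_def q_def)
      qed
    qed
    ultimately show ?thesis by (rule Lim_null_comparison[rotated])
  qed
qed

section \<open>Derivatives and zeros\<close>

lemma higher_pderiv_pcompose_shift:
  "(pderiv ^^ k) (pcompose p [:z, 1:]) = pcompose ((pderiv ^^ k) p) [:z, 1:]"
  for p :: "complex poly"
  by (induction k) (simp_all add: pderiv_pcompose pderiv_pCons)

text \<open>P^(k)(z) / k! is the coefficient of index k in the Taylor shift P(z + t), and each
  factor of the shift is (z - x_i) (1 + t / (z - x_i)).\<close>

lemma poly_higher_pderiv_prod_linear:
  assumes "\<And>i. i \<in> I \<Longrightarrow> z \<noteq> x i"
  shows "poly ((pderiv ^^ k) (\<Prod>i\<in>I. [:- x i, 1:])) z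
    = fact k * (\<Prod>i\<in>I. z - x i) * esym k I (\<lambda>i. 1 / (z - x i))"
proof -
  let ?p = "\<Prod>i\<in>I. [:- x i, 1:]"
  have "poly ((pderiv ^^ k) ?p) z = coeff (pcompose ((pderiv ^^ k) ?p) [:z, 1:]) 0"
    by (simp add: poly_0_coeff_0[symmetric] poly_pcompose)
  also have "\<dots> = fact k * coeff (pcompose ?p [:z, 1:]) k"
    by (simp add: higher_pderiv_pcompose_shift[symmetric] coeff_higher_pderiv pochhammer_fact)
  also have "pcompose ?p [:z, 1:] = (\<Prod>i\<in>I. Polynomial.smult (z - x i) [:1, 1 / (z - x i):])"
    unfolding pcompose_prod using assms by (intro prod.cong) (auto simp: pcompose_pCons)
  also have "\<dots> = Polynomial.smult (\<Prod>i\<in>I. z - x i) (\<Prod>i\<in>I. [:1, 1 / (z - x i):])" by (rule prod_smult)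
  finally show ?thesis by (simp add: esym_def mult.assoc)
qed

lemma prod_linear_monic: "finite I \<Longrightarrow> degree (\<Prod>i\<in>I. [:- x i, 1:]) = card I \<and> lead_coeff (\<Prod>i\<in>I. [:- x i, 1:]) = (1 :: complex)"
  by (subst degree_prod_sum_eq) (auto simp: lead_coeff_prod)

text \<open>The Pochhammer symbol is n! / (n-k)!, the leading coefficient of the k-th derivative of
  a monic polynomial of degree n.\<close>

lemma higher_pderiv_factorization:
  fixes x :: "nat \<Rightarrow> complex"
  assumes "k \<le> n"
  obtains r where "(pderiv ^^ k) (\<Prod>i=1..n. [:- x i, 1:])
    = Polynomial.smult (of_nat (pochhammer (Suc (n - k)) k)) (\<Prod>j<n - k. [:- r j, 1:])"
proof -
  let ?p = "\<Prod>i=1..n. [:- x i, 1:]"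
  have p: "degree ?p = n" "coeff ?p n = 1" using prod_linear_monic[of "{1..n}" x] by auto
  have d: "degree ((pderiv ^^ k) ?p) = n - k" by (simp only: degree_higher_pderiv p(1))
  have "lead_coeff ((pderiv ^^ k) ?p) = pochhammer (of_nat (Suc (n - k))) k * coeff ?p (n - k + k)"
    unfolding d by (rule coeff_higher_pderiv)
  also have "\<dots> = of_nat (pochhammer (Suc (n - k)) k)" using assms p by (simp only: pochhammer_of_nat le_add_diff_inverse2 mult_1_right)
  finally have l: "lead_coeff ((pderiv ^^ k) ?p) = of_nat (pochhammer (Suc (n - k)) k)" .
  obtain r where r: "Polynomial.smult (lead_coeff ((pderiv ^^ k) ?p)) (\<Prod>i<degree ((pderiv ^^ k) ?p). [:-r i, 1:]) = (pderiv ^^ k) ?p"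
    by (rule complex_poly_decompose')
  show ?thesis by (rule that[OF r[unfolded l, unfolded d, symmetric]])
qed

lemma pochhammer_bounds:
  assumes "k \<le> n"
  shows "1 \<le> pochhammer (Suc (n - k)) k" "pochhammer (Suc (n - k)) k \<le> n ^ k"
proof -
  have "0 < pochhammer (Suc (n - k)) k" unfolding pochhammer_prod by (intro prod_pos) simp
  then show "1 \<le> pochhammer (Suc (n - k)) k" by simp
  have "pochhammer (Suc (n - k)) k \<le> (\<Prod>i\<in>{0..<k}. n)"
    unfolding pochhammer_prod using assms by (intro prod_mono) auto
  then show "pochhammer (Suc (n - k)) k \<le> n ^ k" by simp
qed

lemma order_prod_linear: "finite J \<Longrightarrow> order z (\<Prod>j\<in>J. [:- r j, 1:]) = card {j\<in>J. r j = (z :: complex)}"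
proof (induction J rule: finite_induct)
  case (insert j J)
  have o: "order z [:- r j, 1:] = (if r j = z then 1 else 0)"
    using order_power_n_n[of "r j" 1] by (auto intro!: order_0I)
  have "{i\<in>insert j J. r i = z} = (if r j = z then insert j {i\<in>J. r i = z} else {i\<in>J. r i = z})"
    by auto
  then have c: "card {i\<in>insert j J. r i = z} = (if r j = z then 1 else 0) + card {i\<in>J. r i = z}"
    using insert.hyps by simp
  have nz: "[:- r j, 1:] \<noteq> 0" "(\<Prod>j\<in>J. [:- r j, 1:]) \<noteq> 0" using insert.hyps by (simp_all add: prod_zero_iff)
  have "order z (\<Prod>j\<in>insert j J. [:- r j, 1:]) = order z ([:- r j, 1:] * (\<Prod>j\<in>J. [:- r j, 1:]))"
    by (simp only: prod.insert[OF insert.hyps])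
  also have "\<dots> = order z [:- r j, 1:] + order z (\<Prod>j\<in>J. [:- r j, 1:])"
    using nz by (intro order_mult no_zero_divisors)
  finally show ?case using insert.IH o c by simp
qed simp

lemma sum_order_eq_sum_roots:
  fixes \<phi> :: "complex \<Rightarrow> real" and r :: "nat \<Rightarrow> complex"
  assumes "c \<noteq> 0"
    and p: "p = Polynomial.smult c (\<Prod>j<d. [:- r j, 1:])"
  shows "(\<Sum>z | poly p z = 0. real (order z p) * \<phi> z) = (\<Sum>j<d. \<phi> (r j))"
proof -
  have z: "{z. poly p z = 0} = r ` {..<d}" using assms by (auto simp: poly_prod)
  have o: "order z p = card {j\<in>{..<d}. r j = z}" for z
    using assms(1) by (simp add: p order_smult order_prod_linear del: lessThan_iff)
  have "(\<Sum>j<d. \<phi> (r j)) = (\<Sum>z\<in>r ` {..<d}. real (card {j\<in>{..<d}. r j = z}) * \<phi> z)"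
    by (rule sum_fun_comp) auto
  then show ?thesis unfolding z o by simp
qed

text \<open>By Jensen's formula \<open>ln (cmax a R w)\<close> is the mean of ln |z - w| over the
  circle |z - a| = R.\<close>

definition cmax :: "complex \<Rightarrow> real \<Rightarrow> complex \<Rightarrow> real" where
  "cmax a R w = max (norm (w - a)) R"

lemma cmax_pos: "0 < R \<Longrightarrow> 0 < cmax a R w"
  by (simp add: cmax_def)

lemma norm_reflect:
  assumes "norm (z :: complex) = R" "R > 0"
  shows "norm ((of_real (R\<^sup>2) - cnj w * z) / of_real R) = norm (z - w)"
proof -
  have "of_real (R\<^sup>2) = z * cnj z" using assms by (metis complex_norm_square)
  then have "of_real (R\<^sup>2) - cnj w * z = z * cnj (z - w)" by (simp add: algebra_simps)
  then show ?thesis using assms by (simp add: norm_divide norm_mult del: complex_cnj_diff)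
qed

text \<open>The roots inside the disc are reflected in the circle. This changes no modulus on the circle,
  and makes the quotient holomorphic in the disc, so that its value at the centre is controlled by
  the maximum modulus principle.\<close>

lemma prod_cmax_le:
  assumes R: "R > 0" and fin: "finite I" "finite J" and c: "c > 0"
    and x: "\<And>i. i \<in> I \<Longrightarrow> norm (x i - a) \<noteq> R"
    and le: "\<And>z. norm (z - a) = R \<Longrightarrow> c * (\<Prod>j\<in>J. norm (z - r j)) \<le> M * (\<Prod>i\<in>I. norm (z - x i))"
  shows "c * (\<Prod>j\<in>J. cmax a R (r j)) \<le> M * (\<Prod>i\<in>I. cmax a R (x i))"
proof -
  \<comment> \<open>The reflected factor of a root inside the disc has no zero in the closed disc
    and modulus \<open>R\<close> at the centre; other roots keep their factor. In both cases
    \<open>g w a\<close> has modulus \<open>cmax a R w\<close>.\<close>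
  define g where "g w z = (if norm (w - a) < R then (of_real (R\<^sup>2) - cnj (w - a) * (z - a)) / of_real R else z - w)" for w z
  have g_sphere: "norm (g w z) = norm (z - w)" if "norm (z - a) = R" for w z
    using norm_reflect[OF that R, of "w - a"] by (simp add: g_def)
  have g_center: "norm (g w a) = cmax a R w" for w
    using R by (auto simp: g_def cmax_def norm_divide power2_eq_square norm_minus_commute max_def norm_mult)
  have g_hol: "(\<lambda>z. g w z) holomorphic_on S" for w S
    unfolding g_def by (cases "norm (w - a) < R") (auto intro!: holomorphic_intros simp: R[THEN less_imp_neq[THEN not_sym]])
  have g_nz: "g w z \<noteq> 0" if "norm (w - a) \<noteq> R" "norm (z - a) \<le> R" for w z
  proof (cases "norm (w - a) < R")
    case True
    have "norm (cnj (w - a) * (z - a)) = norm (w - a) * norm (z - a)" by (simp add: norm_mult del: complex_cnj_diff)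
    also have "\<dots> \<le> norm (w - a) * R" using that by (intro mult_left_mono) auto
    also have "\<dots> < R * R" using True R by simp
    also have "\<dots> = norm (of_real (R\<^sup>2) :: complex)" using R by (simp add: power2_eq_square norm_mult)
    finally have "of_real (R\<^sup>2) \<noteq> cnj (w - a) * (z - a)" by (metis less_irrefl)
    then show ?thesis using True R by (simp add: g_def)
  next
    case False
    then show ?thesis using that by (auto simp: g_def)
  qed
  define f where "f z = (\<Prod>j\<in>J. g (r j) z) / (\<Prod>i\<in>I. g (x i) z)" for z
  have f_hol: "f holomorphic_on cball a R"
    unfolding f_def using g_nz x fin
    by (intro holomorphic_intros g_hol) (auto simp: dist_norm norm_minus_commute)
  have "norm (f a) \<le> M / c"
  proof (rule maximum_modulus_frontier[of f "cball a R"])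
    show "f holomorphic_on interior (cball a R)" using f_hol by (rule holomorphic_on_subset) (rule interior_subset)
    show "continuous_on (closure (cball a R)) f" using holomorphic_on_imp_continuous_on[OF f_hol] by simp
    fix z assume "z \<in> frontier (cball a R)"
    then have z: "norm (z - a) = R" using R by (simp add: dist_norm norm_minus_commute)
    have pos: "0 < (\<Prod>i\<in>I. norm (z - x i))" using x z by (intro prod_pos) auto
    have "norm (f z) = (\<Prod>j\<in>J. norm (z - r j)) / (\<Prod>i\<in>I. norm (z - x i))"
      by (simp add: f_def norm_divide prod_norm[symmetric] g_sphere[OF z])
    also have "\<dots> \<le> M / c" using le[OF z] pos c by (simp add: field_simps)
    finally show "norm (f z) \<le> M / c" .
  qed (use R in auto)
  moreover have "norm (f a) = (\<Prod>j\<in>J. cmax a R (r j)) / (\<Prod>i\<in>I. cmax a R (x i))"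
    by (simp add: f_def norm_divide prod_norm[symmetric] g_center)
  moreover have "0 < (\<Prod>i\<in>I. cmax a R (x i))" using R by (intro prod_pos) (auto simp: cmax_pos)
  ultimately show ?thesis using c by (simp add: field_simps)
qed

section \<open>Discrete means over N points of a circle\<close>

lemma roots_of_power:
  assumes N: "N \<ge> 1" and R: "R > 0"
  obtains \<rho> :: "nat \<Rightarrow> complex" where "\<And>w. (\<Prod>m<N. w - \<rho> m) = w ^ N - of_real R ^ N" "\<And>m. m < N \<Longrightarrow> norm (\<rho> m) = R"
proof -
  define p where "p = monom 1 N + [:- (of_real R ^ N) :: complex:]"
  have d: "degree p = N" unfolding p_def using N
    by (subst degree_add_eq_left) (auto simp: degree_monom_eq)
  have "lead_coeff p = 1" unfolding d using N by (simp add: p_def coeff_pCons split: nat.split)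
  then obtain \<rho> where r: "(\<Prod>m<N. [:- \<rho> m, 1:]) = p" using complex_poly_decompose'[of p] d by auto
  have e: "(\<Prod>m<N. w - \<rho> m) = w ^ N - of_real R ^ N" for w
    using arg_cong[OF r, of "\<lambda>q. poly q w"] by (simp add: poly_prod p_def poly_monom algebra_simps)
  have "norm (\<rho> m) = R" if "m < N" for m
  proof -
    have "(\<Prod>m'<N. \<rho> m - \<rho> m') = 0" using that by auto
    then have "\<rho> m ^ N = of_real R ^ N" unfolding e by simp
    then have "norm (\<rho> m) ^ N = R ^ N" using R by (metis norm_power norm_of_real abs_of_pos)
    then show ?thesis using R N by (simp add: power_eq_iff_eq_base)
  qed
  with e show ?thesis by (rule that)
qed

text \<open>ln |(w - a)^N - R^N| / N is the mean of ln |z - w| over N equidistributed points of the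
  circle. By this and the next lemma it exceeds ln cmax by at most (ln 2) / N and falls short of it
  by at most ln (cmax / gap) / N.\<close>

lemma norm_power_diff_le:
  assumes "R > 0"
  shows "norm ((w - a) ^ N - of_real R ^ N) \<le> 2 * cmax a R w ^ N"
proof -
  have "norm ((w - a) ^ N - of_real R ^ N) \<le> norm (w - a) ^ N + R ^ N"
    using norm_triangle_ineq4[of "(w - a) ^ N" "of_real R ^ N"] assms by (simp add: norm_power)
  also have "\<dots> \<le> cmax a R w ^ N + cmax a R w ^ N"
    using assms by (intro add_mono power_mono) (auto simp: cmax_def)
  finally show ?thesis by simp
qed

text \<open>If u is the larger and v the smaller of |w - a| and R, then u^N - v^N >= u^(N-1) (u -
  v).\<close>

lemma norm_power_diff_ge:
  assumes "R > 0" "N \<ge> 1"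
  shows "cmax a R w ^ N * (\<bar>norm (w - a) - R\<bar> / cmax a R w) \<le> norm ((w - a) ^ N - of_real R ^ N)"
proof -
  have *: "u ^ N * ((u - v) / u) \<le> u ^ N - v ^ N" if "0 \<le> v" "v \<le> u" "0 < u" for u v :: real
  proof -
    have "v ^ N = v * v ^ (N - 1)" using assms by (metis power_minus_mult mult.commute not_one_le_zero not_gr_zero)
    also have "\<dots> \<le> v * u ^ (N - 1)" using that by (intro mult_left_mono power_mono)
    finally have "v ^ N \<le> v * u ^ (N - 1)" .
    moreover have u: "u ^ N = u * u ^ (N - 1)" using assms by (metis power_minus_mult mult.commute not_one_le_zero not_gr_zero)
    moreover have "u ^ N * ((u - v) / u) = u * u ^ (N - 1) - v * u ^ (N - 1)"
      unfolding u using that by (simp add: field_simps)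
    ultimately show ?thesis by simp
  qed
  have "cmax a R w ^ N * (\<bar>norm (w - a) - R\<bar> / cmax a R w) \<le> \<bar>norm (w - a) ^ N - R ^ N\<bar>"
  proof (cases "norm (w - a) \<le> R")
    case True
    moreover have "norm (w - a) ^ N \<le> R ^ N" using True by (intro power_mono) auto
    ultimately show ?thesis using *[of "norm (w - a)" R] assms by (simp add: cmax_def max_def)
  next
    case False
    moreover have "0 < norm (w - a)" using False assms by linarith
    moreover have "R ^ N \<le> norm (w - a) ^ N" using False assms by (intro power_mono) auto
    ultimately show ?thesis using *[of R "norm (w - a)"] assms by (simp add: cmax_def max_def)
  qed
  also have "\<dots> \<le> norm ((w - a) ^ N - of_real R ^ N)"
    using norm_triangle_ineq3[of "(w - a) ^ N" "of_real R ^ N"] assms by (simp add: norm_power)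
  finally show ?thesis .
qed

section \<open>Comparison of logarithmic potentials on a circle\<close>

text \<open>For R > 0 this is the distance from \<open>w\<close> to the circle |z - a| = R.\<close>

definition gap :: "complex \<Rightarrow> real \<Rightarrow> complex \<Rightarrow> real" where
  "gap a R w = \<bar>norm (w - a) - R\<bar>"

lemma gap_nonneg [simp]: "0 \<le> gap a R w"
  by (simp add: gap_def)

lemma gap_le_norm_diff: "norm (z - a) = R \<Longrightarrow> gap a R w \<le> norm (z - w)"
  unfolding gap_def using norm_triangle_ineq3[of "w - a" "z - a"] by (simp add: norm_minus_commute)

text \<open>The constant 5 collects k! <= n^k and |e_k| <= (sum of 1 / gap)^k <= n^(4k). The second
  bound holds on the whole circle, since there the gap is a lower bound for |z - x_i|.\<close>

lemma circle_comparison_upper: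
  fixes x r :: "nat \<Rightarrow> complex"
  assumes R: "R > 0" and c: "c \<ge> 1" and n: "k \<le> n" "1 \<le> n"
    and gap: "\<And>i. i \<in> {1..n} \<Longrightarrow> 0 < gap a R (x i)" and sum: "(\<Sum>i=1..n. 1 / gap a R (x i)) \<le> real n ^ 4"
    and eq: "\<And>z. norm (z - a) = R \<Longrightarrow> c * (\<Prod>j<d. norm (z - r j)) =
      fact k * (\<Prod>i=1..n. norm (z - x i)) * norm (esym k {1..n} (\<lambda>i. 1 / (z - x i)))"
  shows "(\<Sum>j<d. ln (cmax a R (r j))) \<le> (\<Sum>i=1..n. ln (cmax a R (x i))) + 5 * real k * ln n"
proof -
  have "c * (\<Prod>j<d. cmax a R (r j)) \<le> real n ^ (5 * k) * (\<Prod>i=1..n. cmax a R (x i))"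
  proof (rule prod_cmax_le[OF R])
    show "norm (x i - a) \<noteq> R" if "i \<in> {1..n}" for i using gap[OF that] by (auto simp: gap_def)
    fix z assume z: "norm (z - a) = R"
    have "norm (esym k {1..n} (\<lambda>i. 1 / (z - x i))) \<le> (\<Sum>i=1..n. norm (1 / (z - x i))) ^ k"
      by (rule norm_esym_le) simp
    also have "\<dots> \<le> (\<Sum>i=1..n. 1 / gap a R (x i)) ^ k"
    proof (intro power_mono sum_mono)
      fix i assume i: "i \<in> {1..n}"
      then show "norm (1 / (z - x i)) \<le> 1 / gap a R (x i)"
        using gap[OF i] gap_le_norm_diff[OF z, of "x i"] by (simp add: norm_divide frac_le)
    qed (auto intro: sum_nonneg)
    also have "\<dots> \<le> (real n ^ 4) ^ k" using sum by (intro power_mono) (auto intro: sum_nonneg)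
    finally have e: "norm (esym k {1..n} (\<lambda>i. 1 / (z - x i))) \<le> real n ^ (4 * k)" by (simp add: power_mult)
    have "fact k \<le> real (n ^ k)"
      by (metis fact_le_power n(1) order_trans fact_mono power_mono of_nat_le_iff zero_le le_refl)
    then have f: "fact k \<le> real n ^ k" by simp
    have "fact k * (\<Prod>i=1..n. norm (z - x i)) * norm (esym k {1..n} (\<lambda>i. 1 / (z - x i)))
       \<le> real n ^ k * (\<Prod>i=1..n. norm (z - x i)) * real n ^ (4 * k)"
      using e f by (intro mult_mono) (auto intro!: prod_nonneg mult_nonneg_nonneg)
    also have "\<dots> = real n ^ (5 * k) * (\<Prod>i=1..n. norm (z - x i))"
      by (simp add: mult_ac flip: power_add)
    finally show "c * (\<Prod>j<d. norm (z - r j)) \<le> real n ^ (5 * k) * (\<Prod>i=1..n. norm (z - x i))"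
      unfolding eq[OF z] .
  qed (use c in auto)
  moreover have p: "0 < (\<Prod>j<d. cmax a R (r j))" "0 < (\<Prod>i=1..n. cmax a R (x i))"
    using R by (auto intro!: prod_pos simp: cmax_pos)
  moreover have "1 * (\<Prod>j<d. cmax a R (r j)) \<le> c * (\<Prod>j<d. cmax a R (r j))"
    using c p by (intro mult_right_mono) auto
  ultimately have "(\<Prod>j<d. cmax a R (r j)) \<le> real n ^ (5 * k) * (\<Prod>i=1..n. cmax a R (x i))" by linarith
  then have "ln (\<Prod>j<d. cmax a R (r j)) \<le> ln (real n ^ (5 * k) * (\<Prod>i=1..n. cmax a R (x i)))"
    using p n by (subst ln_le_cancel_iff) auto
  also have "\<dots> = 5 * real k * ln n + ln (\<Prod>i=1..n. cmax a R (x i))"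
    using n by (subst ln_mult_pos[OF _ p(2)]) (simp_all add: ln_realpow)
  finally show ?thesis using R cmax_pos[OF R] by (simp add: ln_prod less_imp_neq[THEN not_sym])
qed

text \<open>Here the mean over the circle is replaced by the mean over the \<open>N\<close> roots of \<open>R ^ N\<close>, so that lower
  bounds for the derivative are only needed at finitely many points.\<close>

lemma circle_comparison_lower:
  fixes x r :: "nat \<Rightarrow> complex"
  assumes R: "R > 0" and c: "0 < c" "c \<le> real n ^ k" and n: "1 \<le> n" and N: "1 \<le> N"
    and gap: "\<And>i. i \<in> {1..n} \<Longrightarrow> 0 < gap a R (x i)"
    and \<rho>: "\<And>w. (\<Prod>m<N. w - \<rho> m) = w ^ N - of_real R ^ N"
    and low: "\<And>m. m < N \<Longrightarrow> exp (- (\<epsilon> * n)) * (\<Prod>i=1..n. norm (a + \<rho> m - x i)) \<le> c * (\<Prod>j<d. norm (a + \<rho> m - r j))"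
  shows "(\<Sum>i=1..n. ln (cmax a R (x i))) \<le> (\<Sum>j<d. ln (cmax a R (r j))) + \<epsilon> * n + real k * ln n
     + (d * ln 2 + (\<Sum>i=1..n. ln (cmax a R (x i) / gap a R (x i)))) / N"
proof -
  have cp: "0 < cmax a R w" for w using R by (rule cmax_pos)
  have pm: "(\<Prod>m<N. norm (a + \<rho> m - w)) = norm ((w - a) ^ N - of_real R ^ N)" for w
  proof -
    have "(\<Prod>m<N. norm (a + \<rho> m - w)) = (\<Prod>m<N. norm ((w - a) - \<rho> m))"
      by (intro prod.cong refl) (metis (no_types, opaque_lifting) add_diff_eq diff_diff_eq2 norm_minus_commute add.commute diff_diff_add)
    then show ?thesis by (simp only: prod_norm \<rho>)
  qed
  \<comment> \<open>The inequalities \<open>low\<close> are multiplied over all \<open>m\<close>.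
    Exchanging the products replaces the circle points by the factors (w - a)^N - R^N; taking
    logarithms and dividing by N finishes.\<close>
  have "exp (- (\<epsilon> * n)) ^ N * (\<Prod>i=1..n. cmax a R (x i) ^ N * (gap a R (x i) / cmax a R (x i)))
      \<le> exp (- (\<epsilon> * n)) ^ N * (\<Prod>i=1..n. norm ((x i - a) ^ N - of_real R ^ N))"
    using norm_power_diff_ge[OF R N] cp
    by (intro mult_left_mono prod_mono) (auto simp: gap_def less_imp_le[OF cp])
  also have "\<dots> = (\<Prod>m<N. exp (- (\<epsilon> * n)) * (\<Prod>i=1..n. norm (a + \<rho> m - x i)))"
    unfolding pm[symmetric] by (subst prod.swap) (simp add: prod.distrib)
  also have "\<dots> \<le> (\<Prod>m<N. c * (\<Prod>j<d. norm (a + \<rho> m - r j)))"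
    using low by (intro prod_mono) (auto intro!: mult_nonneg_nonneg prod_nonneg)
  also have "\<dots> = c ^ N * (\<Prod>j<d. norm ((r j - a) ^ N - of_real R ^ N))"
    unfolding pm[symmetric] by (subst prod.swap) (simp add: prod.distrib)
  also have "\<dots> \<le> c ^ N * (\<Prod>j<d. 2 * cmax a R (r j) ^ N)"
    using c norm_power_diff_le[OF R] by (intro mult_left_mono prod_mono) auto
  finally have "exp (- (\<epsilon> * n)) ^ N * (\<Prod>i=1..n. cmax a R (x i) ^ N * (gap a R (x i) / cmax a R (x i)))
      \<le> c ^ N * (\<Prod>j<d. 2 * cmax a R (r j) ^ N)" .
  moreover have "0 < exp (- (\<epsilon> * n)) ^ N * (\<Prod>i=1..n. cmax a R (x i) ^ N * (gap a R (x i) / cmax a R (x i)))"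
    using cp gap by (intro mult_pos_pos prod_pos) auto
  ultimately have "ln (exp (- (\<epsilon> * n)) ^ N * (\<Prod>i=1..n. cmax a R (x i) ^ N * (gap a R (x i) / cmax a R (x i))))
     \<le> ln (c ^ N * (\<Prod>j<d. 2 * cmax a R (r j) ^ N))"
    by (subst ln_le_cancel_iff) auto
  moreover have "ln (exp (- (\<epsilon> * n)) ^ N * (\<Prod>i=1..n. cmax a R (x i) ^ N * (gap a R (x i) / cmax a R (x i))))
    = - (real N * (\<epsilon> * n)) + (\<Sum>i=1..n. real N * ln (cmax a R (x i)) - ln (cmax a R (x i) / gap a R (x i)))"
  proof -
    have p: "0 < cmax a R (x i) ^ N * (gap a R (x i) / cmax a R (x i))" if "i \<in> {1..n}" for i
      using cp gap[OF that] by simp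
    have "ln (cmax a R (x i) ^ N * (gap a R (x i) / cmax a R (x i)))
      = real N * ln (cmax a R (x i)) - ln (cmax a R (x i) / gap a R (x i))" if "i \<in> {1..n}" for i
      using cp[of "x i"] gap[OF that] by (subst ln_mult_pos) (auto simp: ln_realpow ln_div)
    note e = this
    have nz: "cmax a R (x i) ^ N * (gap a R (x i) / cmax a R (x i)) \<noteq> 0" if "i \<in> {1..n}" for i
      using p[OF that] by (metis less_irrefl)
    have "ln (\<Prod>i=1..n. cmax a R (x i) ^ N * (gap a R (x i) / cmax a R (x i)))
       = (\<Sum>i=1..n. ln (cmax a R (x i) ^ N * (gap a R (x i) / cmax a R (x i))))"
      by (rule ln_prod[OF finite_atLeastAtMost nz])
    also have "\<dots> = (\<Sum>i=1..n. real N * ln (cmax a R (x i)) - ln (cmax a R (x i) / gap a R (x i)))"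
      by (rule sum.cong[OF refl e])
    finally have "ln (\<Prod>i=1..n. cmax a R (x i) ^ N * (gap a R (x i) / cmax a R (x i)))
       = (\<Sum>i=1..n. real N * ln (cmax a R (x i)) - ln (cmax a R (x i) / gap a R (x i)))" .
    moreover have "0 < (\<Prod>i=1..n. cmax a R (x i) ^ N * (gap a R (x i) / cmax a R (x i)))" using p by (rule prod_pos)
    ultimately show ?thesis by (subst ln_mult_pos) (auto simp: ln_realpow)
  qed
  moreover have "ln (c ^ N * (\<Prod>j<d. 2 * cmax a R (r j) ^ N)) = real N * ln c + (\<Sum>j<d. ln 2 + real N * ln (cmax a R (r j)))"
  proof -
    have "ln (\<Prod>j<d. 2 * cmax a R (r j) ^ N) = (\<Sum>j<d. ln 2 + real N * ln (cmax a R (r j)))"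
      using cp by (subst ln_prod) (auto simp: less_imp_neq[THEN not_sym] ln_mult ln_realpow intro!: sum.cong)
    moreover have "0 < (\<Prod>j<d. 2 * cmax a R (r j) ^ N)" using cp by (intro prod_pos) auto
    ultimately show ?thesis using c by (subst ln_mult_pos) (auto simp: ln_realpow)
  qed
  moreover have "real N * ln c \<le> real N * (real k * ln n)"
  proof (rule mult_left_mono)
    have "ln c \<le> ln (real n ^ k)" using c n by (subst ln_le_cancel_iff) auto
    then show "ln c \<le> real k * ln n" using n by (simp add: ln_realpow)
  qed simp
  ultimately have "real N * (\<Sum>i=1..n. ln (cmax a R (x i))) \<le> real N * ((\<Sum>j<d. ln (cmax a R (r j))) + \<epsilon> * n + real k * ln n)
     + (d * ln 2 + (\<Sum>i=1..n. ln (cmax a R (x i) / gap a R (x i))))"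
    by (simp add: sum_subtractf sum.distrib sum_distrib_left[symmetric] algebra_simps)
  then show ?thesis using N by (simp add: field_simps)
qed

text \<open>Through ln t = 2 ln (sqrt t) <= 2 sqrt t the logarithmic singularity is traded for the
  inverse square root, which is integrable at good radii.\<close>

lemma ln_cmax_div_gap_le:
  assumes R: "R > 0" and g: "0 < gap a R w"
  shows "ln (cmax a R w / gap a R w) \<le> 2 + 2 * sqrt R * (1 / sqrt (gap a R w))"
proof -
  have pos: "0 < cmax a R w / gap a R w" using g cmax_pos[OF R] by simp
  have "cmax a R w \<le> gap a R w + R" by (auto simp: cmax_def gap_def)
  then have le: "cmax a R w / gap a R w \<le> 1 + R / gap a R w" using g by (simp add: field_simps)
  have "ln (cmax a R w / gap a R w) = 2 * ln (sqrt (cmax a R w / gap a R w))"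
    using pos by (simp add: ln_sqrt)
  also have "\<dots> \<le> 2 * sqrt (cmax a R w / gap a R w)"
    using ln_less_self[OF real_sqrt_gt_zero[OF pos]] by linarith
  also have "\<dots> \<le> 2 * sqrt (1 + R / gap a R w)" using le by simp
  also have "\<dots> \<le> 2 * (sqrt 1 + sqrt (R / gap a R w))"
    using R g by (intro mult_left_mono sqrt_add_le_add_sqrt) auto
  finally show ?thesis by (simp add: real_sqrt_divide)
qed

section \<open>Good radii\<close>

lemma nn_integral_inverse_sqrt_abs:
  "(\<integral>\<^sup>+s\<in>{-1..1}. inverse (ennreal (sqrt \<bar>s\<bar>)) \<partial>lborel) \<le> 4"
proof -
  let ?f = "\<lambda>s::real. inverse (ennreal (sqrt \<bar>s\<bar>))"
  have half: "(\<integral>\<^sup>+s\<in>{0..1}. ?f s \<partial>lborel) = 2"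
  proof -
    have "((\<lambda>s::real. s powr (-1/2)) has_integral (1 powr (-1/2 + 1) / (-1/2 + 1))) {0..1}"
      by (rule has_integral_powr_from_0) auto
    then have "(\<integral>\<^sup>+s. ennreal (s powr (-1/2)) * indicator {0..1} s \<partial>lborel) = ennreal (1 powr (-1/2 + 1) / (-1/2 + 1))"
      by (intro nn_integral_has_integral_lebesgue') auto
    then have "(\<integral>\<^sup>+s. ennreal (s powr (-1/2)) * indicator {0..1} s \<partial>lborel) = 2" by simp
    moreover have "(\<integral>\<^sup>+s\<in>{0..1}. ?f s \<partial>lborel) = (\<integral>\<^sup>+s. ennreal (s powr (-1/2)) * indicator {0..1} s \<partial>lborel)"
    proof (rule nn_integral_cong_AE)
      have "AE s in lborel. s \<noteq> (0::real)" by (rule AE_lborel_singleton)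
      then show "AE s in lborel. ?f s * indicator {0..1} s = ennreal (s powr (-1/2)) * indicator {0..1} (s::real)"
      proof eventually_elim
        case (elim s)
        show ?case
        proof (cases "s \<in> {0..1}")
          case True
          then have s: "s > 0" using elim by simp
          have "s powr (-1/2) = inverse (sqrt s)" using s by (simp add: powr_minus powr_half_sqrt)
          then show ?thesis using s by (simp add: inverse_ennreal)
        qed simp
      qed
    qed
    ultimately show ?thesis by simp
  qed
  have neg: "(\<integral>\<^sup>+s\<in>{-1..0}. ?f s \<partial>lborel) = (\<integral>\<^sup>+s\<in>{0..1}. ?f s \<partial>lborel)"
  proof -
    have "(\<integral>\<^sup>+s\<in>{-1..0}. ?f s \<partial>lborel) = (\<integral>\<^sup>+s. ?f (0 + (-1) * s) * indicator {-1..0} (0 + (-1) * s) \<partial>lborel)"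
      by (subst nn_integral_real_affine[where c="-1" and t=0]) auto
    also have "\<dots> = (\<integral>\<^sup>+s\<in>{0..1}. ?f s \<partial>lborel)"
      by (intro nn_integral_cong) (auto simp: indicator_def)
    finally show ?thesis .
  qed
  have "(\<integral>\<^sup>+s\<in>{-1..1}. ?f s \<partial>lborel) \<le> (\<integral>\<^sup>+s. ?f s * indicator {-1..0} s + ?f s * indicator {0..1} s \<partial>lborel)"
    by (intro nn_integral_mono) (auto simp: indicator_def)
  also have "\<dots> = 2 + 2"
    by (subst nn_integral_add) (auto simp: neg half)
  finally show ?thesis by simp
qed

text \<open>Since \<open>1 / 0 = 0\<close>, the integrability condition alone would not exclude mass on the circle.\<close>

definition good_radius :: "complex measure \<Rightarrow> complex \<Rightarrow> real \<Rightarrow> bool" where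
  "good_radius \<mu> a R \<longleftrightarrow> 0 < R \<and> (AE x in \<mu>. 0 < gap a R x) \<and> integrable \<mu> (\<lambda>x. 1 / sqrt (gap a R x))"

lemma gap_measurable [measurable]: "gap a R \<in> borel_measurable borel"
  unfolding gap_def by measurable

text \<open>By Tonelli's theorem it suffices to integrate over \<open>R\<close> first. For every
  \<open>x\<close> that integral is at most 4 + \<beta> - \<alpha>: the part within distance 1 of
  the singularity gives at most 4, and elsewhere the integrand is at most 1. So the integral over
  \<mu> is finite for almost every \<open>R\<close>.\<close>

lemma good_radius_exists:
  assumes "prob_space \<mu>" and s: "sets \<mu> = sets borel" and ab: "0 < \<alpha>" "\<alpha> < \<beta>"
  shows "\<exists>R. \<alpha> < R \<and> R < \<beta> \<and> good_radius \<mu> a R"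
proof -
  interpret prob_space \<mu> by fact
  interpret P: pair_sigma_finite \<mu> "lborel :: real measure" ..
  note [measurable_cong] = s
  \<comment> \<open>A reciprocal in the extended nonnegative reals is infinite at 0, so finiteness
    of the integral also excludes mass on the circle.\<close>
  let ?h = "\<lambda>x R. inverse (ennreal (sqrt (gap a R x)))"
  have m [measurable]: "(\<lambda>(x, R). ?h x R * indicator {\<alpha><..<\<beta>} R) \<in> borel_measurable (\<mu> \<Otimes>\<^sub>M lborel)"
    unfolding gap_def by measurable
  have in_le: "(\<integral>\<^sup>+R. ?h x R * indicator {\<alpha><..<\<beta>} R \<partial>lborel) \<le> 4 + ennreal (\<beta> - \<alpha>)" for x
  proof -
    let ?t = "norm (x - a)"
    have "(\<integral>\<^sup>+R. ?h x R * indicator {\<alpha><..<\<beta>} R \<partial>lborel)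
      \<le> (\<integral>\<^sup>+R. inverse (ennreal (sqrt \<bar>-?t + 1 * R\<bar>)) * indicator {-1..1} (-?t + 1 * R) + indicator {\<alpha><..<\<beta>} R \<partial>lborel)"
    proof (intro nn_integral_mono)
      fix R
      show "?h x R * indicator {\<alpha><..<\<beta>} R \<le> inverse (ennreal (sqrt \<bar>-?t + 1 * R\<bar>)) * indicator {-1..1} (-?t + 1 * R) + indicator {\<alpha><..<\<beta>} R"
      proof (cases "-?t + 1 * R \<in> {-1..1}")
        case True
        then show ?thesis by (auto simp: gap_def indicator_def abs_minus_commute intro: add_increasing2)
      next
        case False
        then have "1 \<le> sqrt (gap a R x)" by (auto simp: gap_def)
        then have "?h x R = ennreal (inverse (sqrt (gap a R x)))" "inverse (sqrt (gap a R x)) \<le> 1"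
          by (auto intro!: inverse_ennreal inverse_le_1_iff[THEN iffD2])
        then have "?h x R \<le> 1" by simp
        then show ?thesis using False by (auto simp: indicator_def)
      qed
    qed
    also have "\<dots> = (\<integral>\<^sup>+R. inverse (ennreal (sqrt \<bar>-?t + 1 * R\<bar>)) * indicator {-1..1} (-?t + 1 * R) \<partial>lborel)
        + (\<integral>\<^sup>+R. indicator {\<alpha><..<\<beta>} R \<partial>lborel)"
      by (rule nn_integral_add) auto
    also have "(\<integral>\<^sup>+R. inverse (ennreal (sqrt \<bar>-?t + 1 * R\<bar>)) * indicator {-1..1} (-?t + 1 * R) \<partial>lborel)
       = (\<integral>\<^sup>+s\<in>{-1..1}. inverse (ennreal (sqrt \<bar>s\<bar>)) \<partial>lborel)"
      by (subst (2) nn_integral_real_affine[where c=1 and t="-?t"]) auto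
    also have "(\<integral>\<^sup>+R. indicator {\<alpha><..<\<beta>} R \<partial>lborel) = ennreal (\<beta> - \<alpha>)" using ab by simp
    finally show ?thesis using nn_integral_inverse_sqrt_abs by (meson add_right_mono order_trans)
  qed
  have "(\<integral>\<^sup>+R. (\<integral>\<^sup>+x. ?h x R * indicator {\<alpha><..<\<beta>} R \<partial>\<mu>) \<partial>lborel)
    = (\<integral>\<^sup>+x. (\<integral>\<^sup>+R. ?h x R * indicator {\<alpha><..<\<beta>} R \<partial>lborel) \<partial>\<mu>)"
    by (rule P.Fubini') (rule m)
  also have "\<dots> \<le> (\<integral>\<^sup>+x. 4 + ennreal (\<beta> - \<alpha>) \<partial>\<mu>)" by (intro nn_integral_mono in_le)
  also have "\<dots> = 4 + ennreal (\<beta> - \<alpha>)" by (simp add: emeasure_space_1)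
  finally have "(\<integral>\<^sup>+R. (\<integral>\<^sup>+x. ?h x R * indicator {\<alpha><..<\<beta>} R \<partial>\<mu>) \<partial>lborel) \<noteq> \<infinity>"
    by (auto simp: top_unique)
  then have ae: "AE R in lborel. (\<integral>\<^sup>+x. ?h x R * indicator {\<alpha><..<\<beta>} R \<partial>\<mu>) \<noteq> \<infinity>"
    by (intro nn_integral_PInf_AE borel_measurable_nn_integral) (simp_all add: gap_def)
  have "\<exists>R\<in>{\<alpha><..<\<beta>}. (\<integral>\<^sup>+x. ?h x R \<partial>\<mu>) \<noteq> \<infinity>"
  proof (rule ccontr)
    assume no: "\<not> ?thesis"
    from ae have "AE R in lborel. R \<notin> {\<alpha><..<\<beta>}"
    proof eventually_elim
      case (elim R)
      then show ?case using no by (auto simp: indicator_def)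
    qed
    moreover have "{x. \<alpha> < x \<and> x < \<beta>} = {\<alpha><..<\<beta>}" by auto
    ultimately have "emeasure lborel {\<alpha><..<\<beta>} = 0" by (subst (asm) AE_iff_measurable[OF _ refl]) auto
    then show False using ab by simp
  qed
  then obtain R where R: "\<alpha> < R" "R < \<beta>" "(\<integral>\<^sup>+x. ?h x R \<partial>\<mu>) \<noteq> \<infinity>" by auto
  have hm: "(\<lambda>x. ?h x R) \<in> borel_measurable \<mu>" by measurable
  have pos: "AE x in \<mu>. 0 < gap a R x"
    using nn_integral_PInf_AE[OF hm R(3)]
  proof eventually_elim
    case (elim x)
    then have "gap a R x \<noteq> 0" by auto
    then show ?case using gap_nonneg[of a R x] by linarith
  qed
  have "(\<integral>\<^sup>+x. ennreal (norm (1 / sqrt (gap a R x))) \<partial>\<mu>) = (\<integral>\<^sup>+x. ?h x R \<partial>\<mu>)"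
    using pos by (intro nn_integral_cong_AE) (auto simp: inverse_ennreal inverse_eq_divide)
  then have "integrable \<mu> (\<lambda>x. 1 / sqrt (gap a R x))"
    using R(3) by (intro integrableI_bounded) (auto simp: top.not_eq_extremum)
  with pos R ab show ?thesis by (auto simp: good_radius_def)
qed

section \<open>Logarithmic potentials of the zeros\<close>

text \<open>Outer events are used because an enumeration of the zeros, chosen for each outcome, need not be
  measurable.\<close>

definition (in prob_space) asymp_null :: "(nat \<Rightarrow> 'a set) \<Rightarrow> bool" where
  "asymp_null S \<longleftrightarrow> (\<forall>e>0. \<forall>\<^sub>F n in sequentially. \<exists>B\<in>events. S n \<inter> space M \<subseteq> B \<and> prob B < e)"

lemma (in prob_space) asymp_null_mono:
  "asymp_null S \<Longrightarrow> \<forall>\<^sub>F n in sequentially. T n \<inter> space M \<subseteq> S n \<Longrightarrow> asymp_null T"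
  unfolding asymp_null_def
proof (intro allI impI)
  fix e :: real assume "\<forall>e>0. \<forall>\<^sub>F n in sequentially. \<exists>B\<in>events. S n \<inter> space M \<subseteq> B \<and> prob B < e"
    "\<forall>\<^sub>F n in sequentially. T n \<inter> space M \<subseteq> S n" "0 < e"
  then have "\<forall>\<^sub>F n in sequentially. \<exists>B\<in>events. S n \<inter> space M \<subseteq> B \<and> prob B < e"
    "\<forall>\<^sub>F n in sequentially. T n \<inter> space M \<subseteq> S n" by auto
  then show "\<forall>\<^sub>F n in sequentially. \<exists>B\<in>events. T n \<inter> space M \<subseteq> B \<and> prob B < e"
    by eventually_elim blast
qed

lemma (in prob_space) asymp_null_Un:
  assumes "asymp_null S" "asymp_null T"
  shows "asymp_null (\<lambda>n. S n \<union> T n)"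
  unfolding asymp_null_def
proof (intro allI impI)
  fix e :: real assume "0 < e"
  then have e2: "0 < e / 2" by simp
  from assms(1)[unfolded asymp_null_def, rule_format, OF e2] assms(2)[unfolded asymp_null_def, rule_format, OF e2]
  show "\<forall>\<^sub>F n in sequentially. \<exists>B\<in>events. (S n \<union> T n) \<inter> space M \<subseteq> B \<and> prob B < e"
  proof eventually_elim
    case (elim n)
    then obtain B C where BC: "B \<in> events" "S n \<inter> space M \<subseteq> B" "prob B < e / 2"
      "C \<in> events" "T n \<inter> space M \<subseteq> C" "prob C < e / 2" by blast
    then have "prob (B \<union> C) < e" using measure_Un_le[of B M C] by linarith
    then show ?case using BC by (intro bexI[of _ "B \<union> C"]) auto
  qed
qed

lemma (in prob_space) asymp_null_UN:
  assumes "finite I" "\<And>i. i \<in> I \<Longrightarrow> asymp_null (S i)"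
  shows "asymp_null (\<lambda>n. \<Union>i\<in>I. S i n)"
  using assms
proof (induction I rule: finite_induct)
  case empty
  then show ?case by (auto simp: asymp_null_def intro!: always_eventually bexI[of _ "{}"])
next
  case (insert i I)
  then show ?case using asymp_null_Un[of "S i" "\<lambda>n. \<Union>i\<in>I. S i n"] by simp
qed

lemma (in prob_space) asymp_null_tendsto:
  assumes "asymp_null S" "\<And>n. S n \<in> events"
  shows "(\<lambda>n. prob (S n)) \<longlonglongrightarrow> 0"
proof (rule tendstoI)
  fix e :: real assume "0 < e"
  then have "\<forall>\<^sub>F n in sequentially. \<exists>B\<in>events. S n \<inter> space M \<subseteq> B \<and> prob B < e"
    using assms by (auto simp: asymp_null_def)
  then show "\<forall>\<^sub>F n in sequentially. dist (prob (S n)) 0 < e"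
  proof eventually_elim
    case (elim n)
    then obtain B where B: "B \<in> events" "S n \<inter> space M \<subseteq> B" "prob B < e" by blast
    have "S n \<subseteq> B" using B assms(2) sets.sets_into_space by blast
    then have "prob (S n) \<le> prob B" using B by (intro finite_measure_mono)
    then show ?case using B by simp
  qed
qed

lemma (in prob_space) asymp_nullI:
  assumes "\<And>n. S n \<in> events" "(\<lambda>n. prob (S n)) \<longlonglongrightarrow> 0"
  shows "asymp_null S"
  unfolding asymp_null_def
proof (intro allI impI)
  fix e :: real assume "0 < e"
  then have "\<forall>\<^sub>F n in sequentially. prob (S n) < e" using order_tendstoD(2)[OF assms(2)] by simp
  then show "\<forall>\<^sub>F n in sequentially. \<exists>B\<in>events. S n \<inter> space M \<subseteq> B \<and> prob B < e"
    by eventually_elim (use assms(1) in blast)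
qed

lemma sum_squares_le_square_sum:
  fixes f :: "'i \<Rightarrow> real"
  assumes "finite I" "\<And>i. i \<in> I \<Longrightarrow> 0 \<le> f i"
  shows "(\<Sum>i\<in>I. (f i)\<^sup>2) \<le> (\<Sum>i\<in>I. f i)\<^sup>2"
proof -
  have "(\<Sum>i\<in>I. (f i)\<^sup>2) \<le> (\<Sum>i\<in>I. f i * (\<Sum>i\<in>I. f i))"
    unfolding power2_eq_square using assms by (intro sum_mono mult_left_mono member_le_sum) auto
  then show ?thesis by (simp add: sum_distrib_right power2_eq_square)
qed

text \<open>Off three kinds of events the comparison is deterministic: \<open>S0\<close>, some X_i
  lies on the circle; \<open>S1\<close>, the sum of the inverse square roots of the gaps is large;
  \<open>S2 m\<close>, e_k is tiny at the circle point of index m. The number \<open>N\<close> of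
  points does not depend on n, so anticoncentration is applied a bounded number of times.\<close>

lemma (in prob_space) log_potential_difference:
  fixes X :: "nat \<Rightarrow> 'a \<Rightarrow> complex" and r :: "nat \<Rightarrow> 'a \<Rightarrow> nat \<Rightarrow> complex" and \<delta> :: real
  assumes ind: "indep_vars (\<lambda>_. borel) X {1..}"
    and law: "\<And>i. i \<ge> 1 \<Longrightarrow> distr M borel (X i) = \<mu>"
    and k: "\<forall>\<^sub>F n in sequentially. 1 \<le> k n \<and> real (k n) \<le> ln (real n)"
    and r: "\<And>n \<omega>. k n \<le> n \<Longrightarrow> (pderiv ^^ k n) (\<Prod>i=1..n. [:- X i \<omega>, 1:])
      = Polynomial.smult (of_nat (pochhammer (Suc (n - k n)) (k n))) (\<Prod>j<n - k n. [:- r n \<omega> j, 1:])"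
    and good: "good_radius \<mu> a R" and \<delta>: "\<delta> > 0"
  shows "asymp_null (\<lambda>n. {\<omega>. \<bar>(\<Sum>j<n - k n. ln (cmax a R (r n \<omega> j))) - (\<Sum>i=1..n. ln (cmax a R (X i \<omega>)))\<bar> > \<delta> * n})"
  unfolding asymp_null_def
proof (intro allI impI)
  fix e :: real assume e: "0 < e"
  let ?V = "\<lambda>n z. \<Sum>i=1..n. ln (cmax a R (z i))"
  let ?W = "\<lambda>n \<omega>. \<Sum>j<n - k n. ln (cmax a R (r n \<omega> j))"
  have rv [measurable]: "X i \<in> borel_measurable M" if "i \<ge> 1" for i
    using ind that by (auto simp: indep_vars_def)
  have s: "sets \<mu> = sets borel" using law[of 1] by (metis sets_distr order_refl)
  interpret \<mu>: prob_space \<mu> using law[of 1] prob_space_distr[OF rv[of 1]] by simp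
  have R: "R > 0" and gpos: "AE x in \<mu>. 0 < gap a R x" and gint: "integrable \<mu> (\<lambda>x. 1 / sqrt (gap a R x))"
    using good by (auto simp: good_radius_def)
  define E where "E = (\<integral>x. 1 / sqrt (gap a R x) \<partial>\<mu>)"
  have E: "0 \<le> E" unfolding E_def by (intro integral_nonneg_AE) simp
  \<comment> \<open>Markov's inequality bounds the probability of \<open>S1\<close> by
    \<open>E / L\<close>.\<close>
  define L where "L = 3 * (E + 1) / e + 1"
  have L: "1 \<le> L" "E / L < e / 3" using e E by (auto simp: L_def field_simps add_pos_nonneg)
  \<comment> \<open>Makes the discretisation error in \<open>circle_comparison_lower\<close> at most
    \<open>\<delta> / 4 * n\<close> off \<open>S1\<close>.\<close>
  obtain N0 :: nat where N0: "4 * (ln 2 + 2 + 2 * sqrt R * L) / \<delta> \<le> real N0" using real_arch_simple by blast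
  define N where "N = max 1 N0"
  have "4 * (ln 2 + 2 + 2 * sqrt R * L) / \<delta> \<le> real N" using N0 by (simp add: N_def)
  then have N: "1 \<le> N" "(ln 2 + 2 + 2 * sqrt R * L) / N \<le> \<delta> / 4" using \<delta> by (auto simp: N_def field_simps)
  obtain \<rho> :: "nat \<Rightarrow> complex" where \<rho>: "\<And>w. (\<Prod>m<N. w - \<rho> m) = w ^ N - of_real R ^ N" "\<And>m. m < N \<Longrightarrow> norm (\<rho> m) = R"
    using roots_of_power[OF N(1) R] by blast
  have gX: "AE \<omega> in M. 0 < gap a R (X i \<omega>)" if "i \<ge> 1" for i
  proof -
    have "AE x in distr M borel (X i). 0 < gap a R x" by (subst law[OF that]) (rule gpos)
    then show ?thesis using rv[OF that] by (subst (asm) AE_distr_iff) auto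
  qed
  have iX: "integrable M (\<lambda>\<omega>. 1 / sqrt (gap a R (X i \<omega>)))" "(\<integral>\<omega>. 1 / sqrt (gap a R (X i \<omega>)) \<partial>M) = E" if "i \<ge> 1" for i
  proof -
    have m: "(\<lambda>x. 1 / sqrt (gap a R x)) \<in> borel_measurable borel" by measurable
    have "integrable (distr M borel (X i)) (\<lambda>x. 1 / sqrt (gap a R x))" by (subst law[OF that]) (rule gint)
    then show "integrable M (\<lambda>\<omega>. 1 / sqrt (gap a R (X i \<omega>)))"
      using integrable_distr_eq[OF rv[OF that] m] by simp
    show "(\<integral>\<omega>. 1 / sqrt (gap a R (X i \<omega>)) \<partial>M) = E"
      unfolding E_def law[OF that, symmetric] by (rule integral_distr[OF rv[OF that] m, symmetric])
  qed
  define \<epsilon> where "\<epsilon> = \<delta> / 4"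
  have \<epsilon>: "\<epsilon> > 0" using \<delta> by (simp add: \<epsilon>_def)
  let ?small = "\<lambda>n. esym_small (k n) (exp (- (\<epsilon> * real n))) (real n ^ 4) {1..n}"
  define Y where "Y m i \<omega> = 1 / (a + \<rho> m - X i \<omega>)" for m i \<omega>
  define S0 where "S0 n = {\<omega>\<in>space M. \<not> (\<forall>i\<in>{1..n}. 0 < gap a R (X i \<omega>))}" for n :: nat
  define S1 where "S1 n = {\<omega>\<in>space M. real n * L \<le> (\<Sum>i=1..n. 1 / sqrt (gap a R (X i \<omega>)))}" for n :: nat
  define S2 where "S2 m n = {\<omega>\<in>space M. ?small n (\<lambda>i. Y m i \<omega>)}" for m n
  have S0: "S0 n \<in> events" "prob (S0 n) = 0" for n
  proof -
    have "{\<omega>\<in>space M. \<forall>i\<in>{1..n}. 0 < gap a R (X i \<omega>)} \<in> events" by measurable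
    then show ev: "S0 n \<in> events" unfolding S0_def by (rule sets.sets_Collect_neg)
    have "AE \<omega> in M. \<forall>i\<in>{1..n}. 0 < gap a R (X i \<omega>)" using gX by (intro AE_finite_allI) auto
    then have "AE \<omega> in M. \<omega> \<notin> S0 n" by eventually_elim (auto simp: S0_def)
    then show "prob (S0 n) = 0" using prob_eq_0[OF ev] by simp
  qed
  have S1e: "S1 n \<in> events" for n unfolding S1_def by measurable
  have S1: "prob (S1 n) < e / 3" if n: "n \<ge> 1" for n
  proof -
    have "prob (S1 n) \<le> (\<integral>\<omega>. (\<Sum>i=1..n. 1 / sqrt (gap a R (X i \<omega>))) \<partial>M) / (real n * L)"
      unfolding S1_def using iX n L
      by (intro integral_Markov_inequality_measure[where A="{}"] Bochner_Integration.integrable_sum) (auto intro!: sum_nonneg)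
    also have "(\<integral>\<omega>. (\<Sum>i=1..n. 1 / sqrt (gap a R (X i \<omega>))) \<partial>M) = n * E"
      using iX by (subst Bochner_Integration.integral_sum) auto
    also have "n * E / (real n * L) = E / L" using n by simp
    finally show ?thesis using L(2) by linarith
  qed
  have Ym: "Y m i \<in> borel_measurable M" if "i \<ge> 1" for m i
    using rv[OF that] unfolding Y_def by measurable
  have S2e: "S2 m n \<in> events" for m n
    unfolding S2_def using Ym by (intro esym_small_measurable) auto
  have S2: "(\<lambda>n. prob (S2 m n)) \<longlonglongrightarrow> 0" if m: "m < N" for m
  proof -
    define f where "f x = 1 / (a + \<rho> m - x)" for x
    have f [measurable]: "f \<in> borel_measurable borel" unfolding f_def by measurable
    have Yf: "Y m i = (\<lambda>\<omega>. f (X i \<omega>))" for i by (simp add: Y_def f_def fun_eq_iff)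
    show ?thesis unfolding S2_def
    proof (rule esym_anticoncentration_limit[OF _ _ _ k \<epsilon>])
      show "indep_vars (\<lambda>_. borel) (Y m) {1..}"
        using indep_vars_compose2[OF ind, of "\<lambda>_. f" "\<lambda>_. borel"] unfolding Yf by simp
      show "distr M borel (Y m i) = distr \<mu> borel f" if "i \<ge> 1" for i
        unfolding Yf law[OF that, symmetric] using rv[OF that] by (subst distr_distr) (auto simp: o_def)
      \<comment> \<open>With 1 / 0 = 0 the function \<open>f\<close> vanishes exactly at
        \<open>a + \<rho> m\<close>. This point lies on the circle, which has measure 0.\<close>
      have "AE x in \<mu>. x \<notin> {a + \<rho> m}" using gpos
      proof eventually_elim
        case (elim x)
        have "gap a R (a + \<rho> m) = 0" using \<rho>(2)[OF m] by (simp add: gap_def)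
        then show ?case using elim by auto
      qed
      then have "measure \<mu> {a + \<rho> m} = 0" using \<mu>.prob_eq_0[of "{a + \<rho> m}"] s by simp
      moreover have "f -` {0} \<inter> space \<mu> = {a + \<rho> m}"
        using sets_eq_imp_space_eq[OF s] by (auto simp: f_def)
      moreover have "f \<in> measurable \<mu> borel" using f s by (simp cong: measurable_cong_sets)
      ultimately show "measure (distr \<mu> borel f) {0} = 0" by (simp add: measure_distr)
    qed
  qed
  have "\<forall>\<^sub>F n in sequentially. \<forall>m\<in>{..<N}. prob (S2 m n) < e / (3 * N)"
    using e N by (intro eventually_ball_finite ballI order_tendstoD(2)[OF S2]) auto
  moreover have "\<forall>\<^sub>F n in sequentially. L \<le> real n" by real_asymp
  moreover have "\<forall>\<^sub>F n in sequentially. 5 * ln (real n) ^ 2 \<le> \<delta> / 4 * real n" using \<delta> by real_asymp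
  ultimately show "\<forall>\<^sub>F n in sequentially. \<exists>B\<in>events. {\<omega>. \<bar>?W n \<omega> - ?V n (\<lambda>i. X i \<omega>)\<bar> > \<delta> * n} \<inter> space M \<subseteq> B \<and> prob B < e"
    using k
  proof eventually_elim
    case (elim n)
    have n1: "1 \<le> n" using elim L by linarith
    have kn: "k n \<le> n"
    proof -
      have "ln (real n) \<le> real n - 1" using n1 by (intro ln_le_minus_one) auto
      then show ?thesis using elim by linarith
    qed
    define B where "B = S0 n \<union> S1 n \<union> (\<Union>m\<in>{..<N}. S2 m n)"
    have Be: "B \<in> events" unfolding B_def using S0 S1e S2e by auto
    have "prob B \<le> prob (S0 n \<union> S1 n) + prob (\<Union>m\<in>{..<N}. S2 m n)"
      unfolding B_def using S0 S1e S2e by (intro measure_Un_le) auto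
    also have "\<dots> \<le> (prob (S0 n) + prob (S1 n)) + (\<Sum>m<N. prob (S2 m n))"
      using S0 S1e S2e by (intro add_mono measure_Un_le measure_UNION_le) auto
    also have "\<dots> \<le> (0 + e / 3) + (\<Sum>m<N. e / (3 * N))"
      using S0 S1[OF n1] elim(1) by (intro add_mono sum_mono) (auto intro: less_imp_le)
    also have "\<dots> = e / 3 + e / 3" using N by simp
    finally have pB: "prob B < e" using e by simp
    have "\<bar>?W n \<omega> - ?V n (\<lambda>i. X i \<omega>)\<bar> \<le> \<delta> * n"
      if w: "\<omega> \<in> space M" "\<omega> \<notin> B" for \<omega>
    proof -
      define x where "x i = X i \<omega>" for i
      define c where "c = real (pochhammer (Suc (n - k n)) (k n))"
      have c: "1 \<le> c" "c \<le> real n ^ k n"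
        using pochhammer_bounds[OF kn] unfolding c_def by (metis of_nat_1 of_nat_le_iff, metis of_nat_le_iff of_nat_power)
      have g: "0 < gap a R (x i)" if "i \<in> {1..n}" for i
        using w that by (auto simp: B_def S0_def x_def)
      have s1: "(\<Sum>i=1..n. 1 / sqrt (gap a R (x i))) \<le> real n * L"
        using w by (auto simp: B_def S1_def x_def)
      \<comment> \<open>Origin of the exponent 4: the sum of 1 / gap is at most the square of the
        sum of the inverse square roots, hence at most (n L)^2, and L <= n eventually.\<close>
      have s2: "(\<Sum>i=1..n. 1 / gap a R (x i)) \<le> real n ^ 4"
      proof -
        have "(\<Sum>i=1..n. 1 / gap a R (x i)) = (\<Sum>i=1..n. (1 / sqrt (gap a R (x i)))\<^sup>2)"
          by (intro sum.cong) (auto simp: power_divide)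
        also have "\<dots> \<le> (\<Sum>i=1..n. 1 / sqrt (gap a R (x i)))\<^sup>2"
          by (rule sum_squares_le_square_sum) auto
        also have "\<dots> \<le> (real n * L)\<^sup>2" using s1 by (intro power_mono sum_nonneg) auto
        also have "\<dots> \<le> (real n * real n)\<^sup>2" using elim L by (intro power_mono mult_left_mono) auto
        finally show ?thesis by (simp add: power2_eq_square power4_eq_xxxx)
      qed
      have zx: "z \<noteq> x i" if "norm (z - a) = R" "i \<in> {1..n}" for z i
        using g[OF that(2)] that(1) by (auto simp: gap_def)
      have eq: "c * (\<Prod>j<n - k n. norm (z - r n \<omega> j)) =
        fact (k n) * (\<Prod>i=1..n. norm (z - x i)) * norm (esym (k n) {1..n} (\<lambda>i. 1 / (z - x i)))"
        if z: "norm (z - a) = R" for z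
      proof -
        have "norm (poly ((pderiv ^^ k n) (\<Prod>i=1..n. [:- X i \<omega>, 1:])) z) = c * (\<Prod>j<n - k n. norm (z - r n \<omega> j))"
          unfolding r[OF kn] by (simp add: poly_prod norm_mult prod_norm c_def)
        moreover have "poly ((pderiv ^^ k n) (\<Prod>i=1..n. [:- X i \<omega>, 1:])) z =
          fact (k n) * (\<Prod>i=1..n. z - x i) * esym (k n) {1..n} (\<lambda>i. 1 / (z - x i))"
          using poly_higher_pderiv_prod_linear[of "{1..n}" z x] zx[OF z] by (simp add: x_def)
        ultimately show ?thesis by (simp add: norm_mult prod_norm)
      qed
      let ?G = "\<Sum>i=1..n. ln (cmax a R (x i) / gap a R (x i))"
      have up: "?W n \<omega> \<le> ?V n x + 5 * real (k n) * ln n"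
        by (rule circle_comparison_upper[OF R c(1) kn n1 g s2 eq])
      have low: "?V n x \<le> ?W n \<omega> + \<epsilon> * n + real (k n) * ln n
         + (real (n - k n) * ln 2 + ?G) / N"
      proof (rule circle_comparison_lower[OF R _ c(2) n1 N(1) g \<rho>(1)])
        show "0 < c" using c by simp
        fix m assume m: "m < N"
        let ?e = "norm (esym (k n) {1..n} (\<lambda>i. 1 / (a + \<rho> m - x i)))" and ?p = "\<Prod>i=1..n. norm (a + \<rho> m - x i)"
        have z: "norm (a + \<rho> m - a) = R" using \<rho>(2)[OF m] by simp
        have "(\<Sum>i=1..n. norm (Y m i \<omega>)) \<le> (\<Sum>i=1..n. 1 / gap a R (x i))"
        proof (rule sum_mono)
          fix i assume i: "i \<in> {1..n}"
          show "norm (Y m i \<omega>) \<le> 1 / gap a R (x i)"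
            unfolding Y_def using g[OF i] gap_le_norm_diff[OF z, of "x i"] by (simp add: norm_divide frac_le x_def)
        qed
        then have "(\<Sum>i=1..n. norm (Y m i \<omega>)) \<le> real n ^ 4" using s2 by simp
        moreover have "\<not> ?small n (\<lambda>i. Y m i \<omega>)"
          using w m by (auto simp: B_def S2_def)
        ultimately have es: "exp (- (\<epsilon> * real n)) \<le> ?e"
          by (simp add: esym_small_def Y_def x_def)
        have "exp (- (\<epsilon> * real n)) * ?p \<le>
          ?e * ?p"
          using es by (intro mult_right_mono prod_nonneg) auto
        also have "\<dots> \<le> fact (k n) * (?e * ?p)"
          using mult_right_mono[OF fact_ge_1[of "k n", where 'a=real], of "?e * ?p"]
          by (simp add: prod_nonneg)
        finally show "exp (- (\<epsilon> * real n)) * ?p \<le> c * (\<Prod>j<n - k n. norm (a + \<rho> m - r n \<omega> j))"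
          unfolding eq[OF z] by (simp add: mult_ac)
      qed
      have "?G \<le> (\<Sum>i=1..n. 2 + 2 * sqrt R * (1 / sqrt (gap a R (x i))))"
        using g by (intro sum_mono ln_cmax_div_gap_le R) auto
      also have "\<dots> = 2 * n + 2 * sqrt R * (\<Sum>i=1..n. 1 / sqrt (gap a R (x i)))"
        by (simp add: sum.distrib sum_distrib_left)
      also have "\<dots> \<le> 2 * n + 2 * sqrt R * (real n * L)"
        using s1 R by (intro add_left_mono mult_left_mono) auto
      finally have "real (n - k n) * ln 2 + ?G \<le> real n * ln 2 + (2 * n + 2 * sqrt R * (real n * L))"
        by (intro add_mono mult_right_mono) auto
      also have "\<dots> = n * (ln 2 + 2 + 2 * sqrt R * L)" by (simp add: algebra_simps)
      finally have "(real (n - k n) * ln 2 + ?G) / N \<le> n * (ln 2 + 2 + 2 * sqrt R * L) / N"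
        by (rule divide_right_mono) simp
      also have "\<dots> = n * ((ln 2 + 2 + 2 * sqrt R * L) / N)" by simp
      also have "\<dots> \<le> n * (\<delta> / 4)" using N(2) by (rule mult_left_mono) simp
      finally have t: "(real (n - k n) * ln 2 + ?G) / N \<le> \<delta> / 4 * n"
        by (simp only: mult.commute)
      have l0: "0 \<le> ln (real n)" using n1 by simp
      have kl: "real (k n) * ln n \<le> ln (real n) ^ 2"
        using elim l0 by (simp add: power2_eq_square mult_right_mono)
      have l2: "0 \<le> ln (real n) ^ 2" by simp
      have d0: "0 \<le> \<delta> * n" using \<delta> by simp
      have en: "\<epsilon> * n = \<delta> / 4 * n" by (simp add: \<epsilon>_def)
      have "\<bar>?W n \<omega> - ?V n x\<bar> \<le> \<delta> * n"
      proof -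
        have "5 * real (k n) * ln n = 5 * (real (k n) * ln n)" by simp
        moreover have "\<delta> / 4 * n = \<delta> * n / 4" by simp
        ultimately show ?thesis
          unfolding abs_le_iff using up low t kl l2 elim(3) d0 en by linarith
      qed
      then show ?thesis by (simp add: x_def)
    qed
    then show ?case using Be pB by (intro bexI[of _ B]) force+
  qed
qed

section \<open>Tent functions\<close>

text \<open>For r <= R this is radial, equal to ln (R / r) on the inner disc and 0 outside the outer
  one; the difference removes the growth of the potentials at infinity.\<close>

definition tent :: "complex \<Rightarrow> real \<Rightarrow> real \<Rightarrow> complex \<Rightarrow> real" where
  "tent a R r w = ln (cmax a R w) - ln (cmax a r w)"

text \<open>For v <= u the values satisfy cmax_v <= cmax_u <= (u / v) cmax_v. So
  \<open>ln (cmax a R w)\<close> is 1-Lipschitz in ln R, uniformly in \<open>w\<close>. This bounds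
  tents and later permits moving radii to good ones.\<close>

lemma ln_cmax_diff_le:
  assumes "0 < R" "0 < r"
  shows "\<bar>ln (cmax a R w) - ln (cmax a r w)\<bar> \<le> \<bar>ln R - ln r\<bar>"
proof -
  have *: "\<bar>ln (cmax a u w) - ln (cmax a v w)\<bar> \<le> ln u - ln v" if uv: "0 < v" "v \<le> u" for u v
  proof -
    have "0 < cmax a v w" "cmax a v w \<le> cmax a u w" "cmax a u w \<le> cmax a v w * (u / v)"
    proof -
      show "0 < cmax a v w" using uv by (simp add: cmax_pos)
      show "cmax a v w \<le> cmax a u w" using uv by (auto simp: cmax_def)
      have "norm (w - a) * 1 \<le> cmax a v w * (u / v)" using uv by (intro mult_mono) (auto simp: cmax_def)
      moreover have "v * (u / v) \<le> cmax a v w * (u / v)" using uv by (intro mult_right_mono) (auto simp: cmax_def)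
      ultimately show "cmax a u w \<le> cmax a v w * (u / v)" using uv by (simp add: cmax_def)
    qed
    moreover from this have "ln (cmax a u w) \<le> ln (cmax a v w * (u / v))" "ln (cmax a v w) \<le> ln (cmax a u w)"
      by (subst ln_le_cancel_iff; linarith)+
    moreover have "ln (cmax a v w * (u / v)) = ln (cmax a v w) + (ln u - ln v)"
      using uv \<open>0 < cmax a v w\<close> by (subst ln_mult_pos) (auto simp: ln_divide_pos)
    ultimately show ?thesis by linarith
  qed
  show ?thesis
  proof (cases "r \<le> R")
    case True
    then show ?thesis using *[OF assms(2) True] by linarith
  next
    case False
    then have "R \<le> r" by simp
    from *[OF assms(1) this] show ?thesis by linarith
  qed
qed

lemma continuous_on_tent: "0 < R \<Longrightarrow> 0 < r \<Longrightarrow> continuous_on UNIV (tent a R r)"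
  unfolding tent_def cmax_def
  by (intro continuous_intros) (auto simp: max_def)

lemma abs_tent_le: "0 < R \<Longrightarrow> 0 < r \<Longrightarrow> \<bar>tent a R r w\<bar> \<le> \<bar>ln R - ln r\<bar>"
  unfolding tent_def by (rule ln_cmax_diff_le)

lemma tent_nonneg: "0 < r \<Longrightarrow> r \<le> R \<Longrightarrow> 0 \<le> tent a R r w"
  unfolding tent_def using cmax_pos[of r a w] by (simp add: cmax_def)

lemma tent_eq_0: "r \<le> R \<Longrightarrow> R \<le> norm (w - a) \<Longrightarrow> tent a R r w = 0"
  by (cases "norm (w - a) = r") (auto simp: tent_def cmax_def max_def)

text \<open>Symmetry in centre and argument, so that values of one kernel in a convolution become
  tents centred at the nodes.\<close>

lemma tent_translate: "tent a R r w = tent 0 R r (a - w)"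
  by (simp add: tent_def cmax_def norm_minus_commute)

section \<open>Uniform approximation by finite sums of tents\<close>

lemma uniformly_continuous_compact_support:
  fixes f :: "complex \<Rightarrow> real"
  assumes f: "continuous_on UNIV f" and S: "\<forall>z. S < norm z \<longrightarrow> f z = 0" and e: "0 < e"
  shows "\<exists>d>0. d < 1 \<and> (\<forall>x y. norm (x - y) < d \<longrightarrow> \<bar>f x - f y\<bar> < e)"
proof -
  have "uniformly_continuous_on (cball 0 (S + 1)) f"
    using f by (intro compact_uniformly_continuous continuous_on_subset[OF f]) auto
  then obtain d where d: "0 < d" "\<And>x y. x \<in> cball 0 (S + 1) \<Longrightarrow> y \<in> cball 0 (S + 1) \<Longrightarrow> dist y x < d \<Longrightarrow> dist (f y) (f x) < e"
    using e unfolding uniformly_continuous_on_def by metis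
  show ?thesis
  proof (intro exI[of _ "min d (1/2)"] conjI allI impI)
    fix x y :: complex assume xy: "norm (x - y) < min d (1/2)"
    show "\<bar>f x - f y\<bar> < e"
    proof (cases "x \<in> cball 0 (S + 1) \<and> y \<in> cball 0 (S + 1)")
      case True
      then show ?thesis using d(2)[of y x] xy by (simp add: dist_norm)
    next
      case False
      have "norm x \<le> norm y + norm (x - y)" "norm y \<le> norm x + norm (x - y)"
        using norm_triangle_sub[of x y] norm_triangle_sub[of y x] by (simp_all add: norm_minus_commute add.commute)
      then have "S < norm x" "S < norm y" using False xy by auto
      then show ?thesis using S e by simp
    qed
  qed (use d in auto)
qed

lemma integrable_compact_support:
  fixes f :: "complex \<Rightarrow> real"
  assumes f: "continuous_on UNIV f" and S: "\<And>z. S < norm z \<Longrightarrow> f z = 0"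
  shows "integrable lborel f"
proof -
  have "integrable lborel (\<lambda>x. indicator (cball 0 S) x *\<^sub>R f x)"
    by (rule borel_integrable_compact) (auto intro: continuous_on_subset[OF f])
  also have "(\<lambda>x. indicator (cball 0 S) x *\<^sub>R f x) = f"
    using S by (auto simp: indicator_def fun_eq_iff not_le)
  finally show ?thesis .
qed

lemma integrable_indicator_cball: "integrable lborel (indicator (cball (0 :: complex) S) :: complex \<Rightarrow> real)"
  using emeasure_bounded_finite[OF bounded_cball[of "0 :: complex" S]] by (intro integrable_real_indicator) auto

text \<open>Nodes and weights are fixed before \<open>F\<close>: a finite cover of the disc by balls
  of radius \<open>h\<close> is made disjoint, and the areas of the pieces are the weights. This
  uniformity lets one Riemann sum serve all integrands \<phi>(x) T(x - w) at once, whatever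
  \<open>w\<close> is.\<close>

lemma riemann_sum_approximation:
  fixes S \<eta> h :: real
  assumes h: "0 < h"
  shows "\<exists>(n :: nat) (p :: nat \<Rightarrow> complex) (v :: nat \<Rightarrow> real). \<forall>F :: complex \<Rightarrow> real. continuous_on UNIV F \<longrightarrow>
       (\<forall>z. S < norm z \<longrightarrow> F z = 0) \<longrightarrow> (\<forall>x y. norm (x - y) < h \<longrightarrow> \<bar>F x - F y\<bar> \<le> \<eta>) \<longrightarrow>
       \<bar>(\<integral>x. F x \<partial>lborel) - (\<Sum>i<n. F (p i) * v i)\<bar> \<le> \<eta> * measure lborel (cball (0 :: complex) S)"
proof -
  have "\<forall>e>0. \<exists>K. finite K \<and> cball (0::complex) S \<subseteq> (\<Union>x\<in>K. ball x e)"
    using compact_cball[of "0::complex" S] unfolding compact_eq_totally_bounded by (rule conjunct2)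
  then obtain K where K: "finite K" "cball (0::complex) S \<subseteq> (\<Union>x\<in>K. ball x h)" using h by blast
  obtain n :: nat and p where p: "K = p ` {i. i < n}" using finite_imp_nat_seg_image_inj_on[OF K(1)] by blast
  define A where "A i = cball 0 S \<inter> ball (p i) h" for i
  define D where "D = disjointed A"
  have A_sets: "A i \<in> sets lborel" for i unfolding A_def by auto
  then have D_sets [measurable]: "D i \<in> sets borel" for i
    using sets.range_disjointed_sets[of A lborel] by (auto simp: D_def)
  have D_sub: "D i \<subseteq> A i" for i unfolding D_def by (rule disjointed_subset)
  have D_fin: "emeasure lborel (D i) < \<infinity>" for i
  proof -
    have "bounded (D i)" using D_sub[of i] by (intro bounded_subset[OF bounded_cball[of 0 S]]) (auto simp: A_def)
    then show ?thesis by (rule emeasure_bounded_finite)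
  qed
  have cover: "(\<Union>i<n. D i) = cball 0 S"
  proof -
    have "(\<Union>i<n. D i) = (\<Union>i<n. A i)"
      using finite_UN_disjointed_eq[of A n] by (simp add: D_def lessThan_atLeast0)
    also have "\<dots> = cball 0 S" using K(2) unfolding p A_def by fastforce
    finally show ?thesis .
  qed
  have disj: "disjoint_family D" unfolding D_def by (rule disjoint_family_disjointed)
  define v where "v i = measure lborel (D i)" for i
  show ?thesis
  proof (intro exI[of _ n] exI[of _ p] exI[of _ v] allI impI)
    fix F :: "complex \<Rightarrow> real"
    assume F: "continuous_on UNIV F" "\<forall>z. S < norm z \<longrightarrow> F z = 0"
      "\<forall>x y. norm (x - y) < h \<longrightarrow> \<bar>F x - F y\<bar> \<le> \<eta>"
    have iF: "integrable lborel F" by (rule integrable_compact_support[OF F(1)]) (use F(2) in blast)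
    have iD: "integrable lborel (\<lambda>x. F (p i) * indicator (D i) x)" for i
      using D_fin[of i] by (intro integrable_mult_right integrable_real_indicator) auto
    let ?G = "\<lambda>x. \<Sum>i<n. F (p i) * indicator (D i) x"
    have iG: "integrable lborel ?G" using iD by (intro Bochner_Integration.integrable_sum)
    have "(\<integral>x. ?G x \<partial>lborel) = (\<Sum>i<n. F (p i) * v i)"
      using iD by (subst Bochner_Integration.integral_sum) (auto simp: v_def)
    then have "(\<integral>x. F x \<partial>lborel) - (\<Sum>i<n. F (p i) * v i) = (\<integral>x. F x - ?G x \<partial>lborel)"
      using iF iG by (simp add: Bochner_Integration.integral_diff)
    also have "\<bar>\<dots>\<bar> \<le> (\<integral>x. \<bar>F x - ?G x\<bar> \<partial>lborel)" by (rule integral_abs_bound)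
    also have "\<dots> \<le> (\<integral>x. \<eta> * indicator (cball (0::complex) S) x \<partial>lborel)"
    proof (rule Bochner_Integration.integral_mono)
      show "integrable lborel (\<lambda>x. \<bar>F x - ?G x\<bar>)" using iF iG by auto
      show "integrable lborel (\<lambda>x. \<eta> * indicator (cball (0::complex) S) x)"
        by (intro integrable_mult_right integrable_indicator_cball)
      fix x
      show "\<bar>F x - ?G x\<bar> \<le> \<eta> * indicator (cball 0 S) x"
      proof (cases "x \<in> cball 0 S")
        case True
        then obtain i where i: "i < n" "x \<in> D i" using cover by blast
        have "?G x = (\<Sum>j<n. if j = i then F (p i) else 0)"
          using disj i by (intro sum.cong) (auto simp: indicator_def disjoint_family_on_def)
        then have "?G x = F (p i)" using i by simp
        moreover have "x \<in> A i" using i D_sub by blast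
        then have "norm (x - p i) < h" by (simp add: A_def dist_norm norm_minus_commute)
        ultimately show ?thesis using F(3)[rule_format, of x "p i"] True by simp
      next
        case False
        then have "x \<notin> D i" if "i < n" for i using cover that by blast
        then have "?G x = 0" by (intro sum.neutral) auto
        then show ?thesis using False F(2)[rule_format, of x] by (simp add: not_le)
      qed
    qed
    also have "\<dots> = \<eta> * measure lborel (cball (0 :: complex) S)" by simp
    finally show "\<bar>(\<integral>x. F x \<partial>lborel) - (\<Sum>i<n. F (p i) * v i)\<bar> \<le> \<eta> * measure lborel (cball (0 :: complex) S)" .
  qed
qed

lemma tent_integral_pos:
  assumes "0 < r" "r < R"
  shows "0 < (\<integral>x. tent 0 R r x \<partial>lborel)"
proof -
  have i: "integrable lborel (tent 0 R r)"
    using assms by (intro integrable_compact_support[of _ R] continuous_on_tent tent_eq_0) auto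
  have "0 < ln (R / r) * measure lborel (cball (0::complex) r)"
    using assms by (intro mult_pos_pos) (auto simp: content_cball_pos)
  also have "\<dots> = (\<integral>x. ln (R / r) * indicator (cball (0::complex) r) x \<partial>lborel)" by simp
  also have "\<dots> \<le> (\<integral>x. tent 0 R r x \<partial>lborel)"
  proof (rule Bochner_Integration.integral_mono[OF _ i])
    show "integrable lborel (\<lambda>x. ln (R / r) * indicator (cball (0::complex) r) x)"
      by (intro integrable_mult_right integrable_indicator_cball)
    show "ln (R / r) * indicator (cball 0 r) x \<le> tent 0 R r x" for x
      using assms tent_nonneg[of r R 0 x]
      by (auto simp: indicator_def) (auto simp: tent_def cmax_def ln_divide_pos max_def)
  qed
  finally show ?thesis .
qed

lemma lborel_integral_translate:
  fixes f :: "complex \<Rightarrow> real"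
  assumes [measurable]: "f \<in> borel_measurable borel"
  shows "(\<integral>x. f (x - w) \<partial>lborel) = (\<integral>x. f x \<partial>lborel)"
proof -
  have "(\<integral>x. f x \<partial>lborel) = (\<integral>x. f x \<partial>distr lborel borel ((+) (- w)))"
    by (simp only: lborel_distr_plus)
  also have "\<dots> = (\<integral>x. f (x - w) \<partial>lborel)" by (subst integral_distr) auto
  finally show ?thesis by simp
qed

text \<open>Let \<open>T\<close> be a tent with outer radius \<open>R\<close> and integral
  \<open>K\<close>. The integral of \<phi>(x) T(x - w) divided by \<open>K\<close> is within
  \<epsilon>/2 of \<phi>(w), because \<phi> varies by less than \<epsilon>/2 over distances below
  \<open>R\<close>. A Riemann sum, uniform in \<open>w\<close>, turns the integral into a
  combination of tents.\<close>

lemma tent_combination_approximation: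
  fixes \<phi> :: "complex \<Rightarrow> real"
  assumes \<phi>: "continuous_on UNIV \<phi>" and S': "\<forall>z. S < norm z \<longrightarrow> \<phi> z = 0" and \<epsilon>: "0 < \<epsilon>"
  shows "\<exists>(n :: nat) p c R. 0 < R \<and> (\<forall>w. \<bar>\<phi> w - (\<Sum>i<n. c i * tent (p i) R (R / 2) w)\<bar> \<le> \<epsilon>)"
proof -
  have S: "\<phi> z = 0" if "S < norm z" for z using S' that by blast
  obtain R where R: "0 < R" "R < 1" "\<And>x y. norm (x - y) < R \<Longrightarrow> \<bar>\<phi> x - \<phi> y\<bar> < \<epsilon> / 2"
    using uniformly_continuous_compact_support[OF \<phi> S' half_gt_zero[OF \<epsilon>]] by blast
  define T where "T = tent 0 R (R / 2)"
  have Tc: "continuous_on UNIV T" unfolding T_def using R by (intro continuous_on_tent) auto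
  have T0: "T z = 0" if "R \<le> norm z" for z unfolding T_def using R that by (intro tent_eq_0) auto
  have Tn: "0 \<le> T z" for z unfolding T_def using R by (intro tent_nonneg) auto
  define K where "K = (\<integral>x. T x \<partial>lborel)"
  have K: "0 < K" unfolding K_def T_def using R by (intro tent_integral_pos) auto
  define V where "V = measure lborel (cball (0::complex) S)"
  have V: "0 \<le> V" by (simp add: V_def)
  \<comment> \<open>The Riemann sum error \<open>\<eta> * V\<close> may use half of
    \<open>K * \<epsilon>\<close>; \<open>V + 1\<close> avoids division by 0.\<close>
  define \<eta> where "\<eta> = K * \<epsilon> / (2 * (V + 1))"
  have \<eta>: "0 < \<eta>" "\<eta> * V \<le> K * (\<epsilon> / 2)"
  proof -
    show "0 < \<eta>" using K \<epsilon> V by (simp add: \<eta>_def)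
    have "\<eta> * V \<le> \<eta> * (V + 1)" using \<open>0 < \<eta>\<close> by simp
    also have "\<dots> = K * (\<epsilon> / 2)" using V by (simp add: \<eta>_def field_simps)
    finally show "\<eta> * V \<le> K * (\<epsilon> / 2)" .
  qed
  define B where "B = \<bar>ln R - ln (R / 2)\<bar>"
  have TB: "\<bar>T z\<bar> \<le> B" for z unfolding T_def B_def using R by (intro abs_tent_le) auto
  have B: "0 \<le> B" by (simp add: B_def)
  have "bounded (\<phi> ` cball 0 S)"
    by (intro compact_imp_bounded compact_continuous_image continuous_on_subset[OF \<phi>]) auto
  then obtain C0 where "\<forall>y\<in>\<phi> ` cball 0 S. norm y \<le> C0" unfolding bounded_iff ..
  then have C0: "\<bar>\<phi> z\<bar> \<le> C0" if "z \<in> cball 0 S" for z using that by simp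
  define C where "C = max C0 0"
  have C: "0 \<le> C" "\<bar>\<phi> z\<bar> \<le> C" for z
    using C0[of z] S[of z] by (cases "z \<in> cball 0 S"; force simp: C_def not_le)+
  \<comment> \<open>\<open>h1\<close> and \<open>h2\<close> share the admissible oscillation \<eta>
    of the product \<open>\<phi> x * T (x - w)\<close> between its factors, which are bounded by
    \<open>C\<close> and \<open>B\<close>.\<close>
  obtain h1 where h1: "0 < h1" "\<And>x y. norm (x - y) < h1 \<Longrightarrow> \<bar>\<phi> x - \<phi> y\<bar> < \<eta> / (2 * (B + 1))"
  proof -
    have "0 < \<eta> / (2 * (B + 1))" using \<eta> B by simp
    from uniformly_continuous_compact_support[OF \<phi> S' this] show ?thesis using that by blast
  qed
  have T0': "\<forall>z. R < norm z \<longrightarrow> T z = 0" using T0 by simp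
  obtain h2 where h2: "0 < h2" "\<And>x y. norm (x - y) < h2 \<Longrightarrow> \<bar>T x - T y\<bar> < \<eta> / (2 * (C + 1))"
  proof -
    have "0 < \<eta> / (2 * (C + 1))" using \<eta> C(1) by simp
    from uniformly_continuous_compact_support[OF Tc T0' this] show ?thesis using that by blast
  qed
  define h where "h = min h1 h2"
  have h: "0 < h" using h1 h2 by (simp add: h_def)
  obtain n :: nat and p v where rs: "\<And>F :: complex \<Rightarrow> real. continuous_on UNIV F \<Longrightarrow> \<forall>z. S < norm z \<longrightarrow> F z = 0 \<Longrightarrow>
       \<forall>x y. norm (x - y) < h \<longrightarrow> \<bar>F x - F y\<bar> \<le> \<eta> \<Longrightarrow>
       \<bar>(\<integral>x. F x \<partial>lborel) - (\<Sum>i<n. F (p i) * v i)\<bar> \<le> \<eta> * V"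
    using riemann_sum_approximation[OF h, of S \<eta>] unfolding V_def by blast
  show ?thesis
  proof (intro exI[of _ R] exI[of _ "\<lambda>i. \<phi> (p i) * v i / K"] exI[of _ p] exI[of _ n] conjI allI)
    show "0 < R" by fact
    fix w
    have Tw: "continuous_on UNIV (\<lambda>x. T (x - w))" by (intro continuous_on_compose2[OF Tc] continuous_intros) auto
    have Tm: "T \<in> borel_measurable borel" using Tc by (rule borel_measurable_continuous_onI)
    have iT: "integrable lborel (\<lambda>x. T (x - w))"
    proof (rule integrable_compact_support[OF Tw])
      fix z :: complex assume "R + norm w < norm z"
      then show "T (z - w) = 0" using norm_triangle_ineq2[of z w] by (intro T0) linarith
    qed
    have i1: "integrable lborel (\<lambda>x. \<phi> x * T (x - w))"
      by (rule integrable_compact_support[of _ S]) (use S Tw \<phi> in \<open>auto intro!: continuous_intros\<close>)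
    have KT: "(\<integral>x. T (x - w) \<partial>lborel) = K" unfolding K_def by (rule lborel_integral_translate[OF Tm])
    have d1: "\<bar>(\<integral>x. \<phi> x * T (x - w) \<partial>lborel) - (\<Sum>i<n. \<phi> (p i) * T (p i - w) * v i)\<bar> \<le> \<eta> * V"
    proof (rule rs, goal_cases)
      show "continuous_on UNIV (\<lambda>x. \<phi> x * T (x - w))" by (intro continuous_intros \<phi> Tw)
      show "\<forall>z. S < norm z \<longrightarrow> \<phi> z * T (z - w) = 0" using S by simp
    next
      case 3
      show ?case
      proof (intro allI impI)
        fix x y :: complex assume xy: "norm (x - y) < h"
        have "\<phi> x * T (x - w) - \<phi> y * T (y - w) = (\<phi> x - \<phi> y) * T (x - w) + \<phi> y * (T (x - w) - T (y - w))"
          by (simp add: algebra_simps)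
        then have "\<bar>\<phi> x * T (x - w) - \<phi> y * T (y - w)\<bar> \<le> \<bar>\<phi> x - \<phi> y\<bar> * \<bar>T (x - w)\<bar> + \<bar>\<phi> y\<bar> * \<bar>T (x - w) - T (y - w)\<bar>"
          by (metis abs_mult abs_triangle_ineq)
        also have "\<dots> \<le> \<eta> / (2 * (B + 1)) * (B + 1) + (C + 1) * (\<eta> / (2 * (C + 1)))"
          using h1(2)[of x y] h2(2)[of "x - w" "y - w"] xy TB[of "x - w"] C(2)[of y] C(1) B \<eta>
          by (intro add_mono mult_mono) (auto simp: h_def)
        also have "\<dots> = \<eta> / 2 + \<eta> / 2" using B C(1) by (intro arg_cong2[of _ _ _ _ "(+)"]) (simp_all add: field_simps)
        also have "\<dots> = \<eta>" by simp
        finally show "\<bar>\<phi> x * T (x - w) - \<phi> y * T (y - w)\<bar> \<le> \<eta>" .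
      qed
    qed
    have d2: "\<bar>(\<integral>x. \<phi> x * T (x - w) \<partial>lborel) - K * \<phi> w\<bar> \<le> K * (\<epsilon> / 2)"
    proof -
      have "(\<integral>x. \<phi> x * T (x - w) \<partial>lborel) - K * \<phi> w = (\<integral>x. \<phi> x * T (x - w) - \<phi> w * T (x - w) \<partial>lborel)"
        using i1 iT KT by (subst Bochner_Integration.integral_diff) auto
      also have "\<bar>\<dots>\<bar> \<le> (\<integral>x. \<bar>\<phi> x * T (x - w) - \<phi> w * T (x - w)\<bar> \<partial>lborel)" by (rule integral_abs_bound)
      also have "\<dots> \<le> (\<integral>x. (\<epsilon> / 2) * T (x - w) \<partial>lborel)"
      proof (rule Bochner_Integration.integral_mono)
        show "integrable lborel (\<lambda>x. \<bar>\<phi> x * T (x - w) - \<phi> w * T (x - w)\<bar>)" using i1 iT by auto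
        show "integrable lborel (\<lambda>x. (\<epsilon> / 2) * T (x - w))" using iT by auto
        fix x :: complex
        have "\<bar>\<phi> x * T (x - w) - \<phi> w * T (x - w)\<bar> = \<bar>\<phi> x - \<phi> w\<bar> * T (x - w)"
          using Tn[of "x - w"] by (simp add: left_diff_distrib[symmetric] abs_mult)
        also have "\<dots> \<le> (\<epsilon> / 2) * T (x - w)"
        proof (cases "norm (x - w) < R")
          case True
          then show ?thesis using R(3)[OF True] Tn[of "x - w"] by (intro mult_right_mono) auto
        next
          case False
          then show ?thesis using T0[of "x - w"] by simp
        qed
        finally show "\<bar>\<phi> x * T (x - w) - \<phi> w * T (x - w)\<bar> \<le> (\<epsilon> / 2) * T (x - w)" .
      qed
      also have "\<dots> = K * (\<epsilon> / 2)" using KT by simp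
      finally show ?thesis .
    qed
    have "\<bar>K * \<phi> w - (\<Sum>i<n. \<phi> (p i) * T (p i - w) * v i)\<bar> \<le> K * \<epsilon>"
    proof -
      have "K * \<epsilon> = K * (\<epsilon> / 2) + K * (\<epsilon> / 2)" by simp
      then show ?thesis using d1 d2 \<eta>(2) by linarith
    qed
    moreover have "(\<Sum>i<n. \<phi> (p i) * T (p i - w) * v i) = K * (\<Sum>i<n. \<phi> (p i) * v i / K * tent (p i) R (R / 2) w)"
      using K by (simp add: sum_distrib_left T_def tent_translate[of "p _"] mult_ac)
    ultimately have "K * \<bar>\<phi> w - (\<Sum>i<n. \<phi> (p i) * v i / K * tent (p i) R (R / 2) w)\<bar> \<le> K * \<epsilon>"
      using K by (simp add: abs_mult_pos' right_diff_distrib[symmetric])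
    then show "\<bar>\<phi> w - (\<Sum>i<n. \<phi> (p i) * v i / K * tent (p i) R (R / 2) w)\<bar> \<le> \<epsilon>"
      using K by simp
  qed
qed

text \<open>Good radii are dense, so every radius can be moved to one by at most \<open>s\<close> on
  the logarithmic scale. By \<open>ln_cmax_diff_le\<close> each tent changes by at most
  \<open>2 * s\<close>. Goodness depends on the centre, so the radii become functions of the
  index.\<close>

lemma good_tent_combination_approximation:
  fixes \<phi> :: "complex \<Rightarrow> real"
  assumes \<phi>: "continuous_on UNIV \<phi>" and S: "\<forall>z. S < norm z \<longrightarrow> \<phi> z = 0" and \<epsilon>: "0 < \<epsilon>"
    and good: "\<And>a \<alpha> \<beta>. 0 < \<alpha> \<Longrightarrow> \<alpha> < \<beta> \<Longrightarrow> \<exists>R. \<alpha> < R \<and> R < \<beta> \<and> good a R"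
  shows "\<exists>(n :: nat) p c R r. (\<forall>i. 0 < R i \<and> 0 < r i \<and> good (p i) (R i) \<and> good (p i) (r i)) \<and>
    (\<forall>w. \<bar>\<phi> w - (\<Sum>i<n. c i * tent (p i) (R i) (r i) w)\<bar> \<le> \<epsilon>)"
proof -
  obtain n p c R0 where a: "0 < R0" "\<And>w. \<bar>\<phi> w - (\<Sum>i<(n::nat). c i * tent (p i) R0 (R0 / 2) w)\<bar> \<le> \<epsilon> / 2"
    using tent_combination_approximation[OF \<phi> S half_gt_zero[OF \<epsilon>]] by blast
  define C where "C = (\<Sum>i<n. \<bar>c i\<bar>)"
  have C: "0 \<le> C" by (simp add: C_def sum_nonneg)
  define s where "s = \<epsilon> / (4 * (C + 1))"
  have s: "0 < s" "C * (2 * s) \<le> \<epsilon> / 2"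
  proof -
    show "0 < s" using \<epsilon> C by (simp add: s_def)
    have "C * (2 * s) \<le> (C + 1) * (2 * s)" using \<open>0 < s\<close> by (intro mult_right_mono) auto
    also have "\<dots> = \<epsilon> / 2" using C by (simp add: s_def field_simps)
    finally show "C * (2 * s) \<le> \<epsilon> / 2" .
  qed
  have ex: "\<exists>R. 0 < R \<and> \<bar>ln R - ln \<rho>\<bar> \<le> s \<and> good b R" if \<rho>: "0 < \<rho>" for \<rho> b
  proof -
    have "\<rho> * exp (- s) < \<rho>" using \<rho> s by simp
    then obtain R where R: "\<rho> * exp (- s) < R" "R < \<rho>" "good b R"
      using good[of "\<rho> * exp (- s)" \<rho> b] \<rho> by auto
    have pos: "0 < \<rho> * exp (- s)" using \<rho> by simp
    then have R0: "0 < R" using R by linarith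
    have "ln (\<rho> * exp (- s)) < ln R" using R pos by (subst ln_less_cancel_iff) auto
    then have "ln \<rho> - s < ln R" using \<rho> by (simp add: ln_mult_pos)
    moreover have "ln R < ln \<rho>" using R R0 by (subst ln_less_cancel_iff) auto
    ultimately show ?thesis using R R0 by (intro exI[of _ R]) auto
  qed
  have "\<forall>i. \<exists>\<rho>. 0 < \<rho> \<and> \<bar>ln \<rho> - ln R0\<bar> \<le> s \<and> good (p i) \<rho>" using ex[OF a(1)] by blast
  from choice[OF this] obtain R where R: "\<And>i. 0 < R i \<and> \<bar>ln (R i) - ln R0\<bar> \<le> s \<and> good (p i) (R i)" by blast
  have "\<forall>i. \<exists>\<rho>. 0 < \<rho> \<and> \<bar>ln \<rho> - ln (R0 / 2)\<bar> \<le> s \<and> good (p i) \<rho>" using ex[of "R0 / 2"] a(1) by simp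
  from choice[OF this] obtain r where r: "\<And>i. 0 < r i \<and> \<bar>ln (r i) - ln (R0 / 2)\<bar> \<le> s \<and> good (p i) (r i)" by blast
  show ?thesis
  proof (rule exI[of _ n], rule exI[of _ p], rule exI[of _ c], rule exI[of _ R], rule exI[of _ r], intro conjI allI)
    show "0 < R i" "0 < r i" "good (p i) (R i)" "good (p i) (r i)" for i using R r by blast+
    fix w
    have "\<bar>(\<Sum>i<n. c i * tent (p i) R0 (R0 / 2) w) - (\<Sum>i<n. c i * tent (p i) (R i) (r i) w)\<bar>
      = \<bar>\<Sum>i<n. c i * (tent (p i) R0 (R0 / 2) w - tent (p i) (R i) (r i) w)\<bar>"
      by (simp add: sum_subtractf right_diff_distrib)
    also have "\<dots> \<le> (\<Sum>i<n. \<bar>c i\<bar> * (2 * s))"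
    proof (rule order_trans[OF sum_abs], rule sum_mono)
      fix i
      have "\<bar>tent (p i) R0 (R0 / 2) w - tent (p i) (R i) (r i) w\<bar> \<le> \<bar>ln R0 - ln (R i)\<bar> + \<bar>ln (R0 / 2) - ln (r i)\<bar>"
        using ln_cmax_diff_le[of R0 "R i" "p i" w] ln_cmax_diff_le[of "R0 / 2" "r i" "p i" w] R r a(1)
        unfolding tent_def by force
      also have "\<dots> \<le> 2 * s" using R[of i] r[of i] by linarith
      finally show "\<bar>c i * (tent (p i) R0 (R0 / 2) w - tent (p i) (R i) (r i) w)\<bar> \<le> \<bar>c i\<bar> * (2 * s)"
        unfolding abs_mult by (rule mult_left_mono) simp
    qed
    also have "\<dots> = C * (2 * s)" by (simp only: C_def sum_distrib_right)
    finally show "\<bar>\<phi> w - (\<Sum>i<n. c i * tent (p i) (R i) (r i) w)\<bar> \<le> \<epsilon>"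
      using a(2)[of w] s(2) by linarith
  qed
qed

section \<open>Continuity of the zeros\<close>

lemma finite_coordinates_convergent_subsequence:
  fixes r :: "nat \<Rightarrow> nat \<Rightarrow> complex"
  assumes "\<And>m j. j < d \<Longrightarrow> norm (r m j) \<le> B"
  shows "\<exists>\<sigma> t. strict_mono (\<sigma> :: nat \<Rightarrow> nat) \<and> (\<forall>j<d. (\<lambda>m. r (\<sigma> m) j) \<longlonglongrightarrow> t j)"
  using assms
proof (induction d)
  case 0
  show ?case by (intro exI[of _ "\<lambda>m. m"]) (auto simp: strict_mono_def)
next
  case (Suc d)
  then obtain \<sigma> t where s: "strict_mono (\<sigma> :: nat \<Rightarrow> nat)" "\<forall>j<d. (\<lambda>m. r (\<sigma> m) j) \<longlonglongrightarrow> t j"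
    by (meson less_SucI)
  have "bounded (range (\<lambda>m. r (\<sigma> m) d))" using Suc.prems[of d] by (auto simp: bounded_iff)
  then obtain l \<tau> where t: "strict_mono (\<tau> :: nat \<Rightarrow> nat)" "((\<lambda>m. r (\<sigma> m) d) \<circ> \<tau>) \<longlonglongrightarrow> l"
    using bounded_imp_convergent_subsequence by blast
  have "(\<lambda>m. r ((\<sigma> \<circ> \<tau>) m) j) \<longlonglongrightarrow> (t(d := l)) j" if "j < Suc d" for j
  proof (cases "j = d")
    case True
    then show ?thesis using t(2) by (simp add: o_def)
  next
    case False
    then have "(\<lambda>m. r (\<sigma> m) j) \<longlonglongrightarrow> t j" using s that by simp
    from LIMSEQ_subseq_LIMSEQ[OF this t(1)] show ?thesis using False by (simp add: o_def)
  qed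
  moreover have "strict_mono (\<sigma> \<circ> \<tau>)" using s t by (simp add: strict_mono_o)
  ultimately show ?case by blast
qed

text \<open>For |z| > 1 each lower term is at most B |z|^d; comparing with the leading term cancels
  |z|^d.\<close>

lemma root_norm_le:
  fixes p :: "complex poly" and B :: real
  assumes z: "poly p z = 0" and d: "degree p = Suc d" and B: "\<And>l. norm (coeff p l) \<le> B"
  shows "norm z \<le> max 1 (real (Suc d) * B / norm (lead_coeff p))"
proof (cases "norm z \<le> 1")
  case False
  have c: "lead_coeff p \<noteq> 0" using d by (metis degree_0 leading_coeff_0_iff nat.distinct(1))
  have "poly p z = (\<Sum>l\<le>d. coeff p l * z ^ l) + lead_coeff p * z ^ Suc d"
    by (simp add: poly_altdef d)
  then have "lead_coeff p * z ^ Suc d = - (\<Sum>l\<le>d. coeff p l * z ^ l)" using z by (simp add: eq_neg_iff_add_eq_0 add.commute)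
  then have "norm (lead_coeff p) * norm z ^ Suc d = norm (\<Sum>l\<le>d. coeff p l * z ^ l)"
    by (metis norm_minus_cancel norm_mult norm_power)
  also have "\<dots> \<le> (\<Sum>l\<le>d. B * norm z ^ d)"
  proof (rule sum_norm_le)
    fix l assume "l \<in> {..d}"
    then show "norm (coeff p l * z ^ l) \<le> B * norm z ^ d"
      unfolding norm_mult norm_power using False B[of l]
      by (intro mult_mono power_increasing) (auto intro: order_trans[OF norm_ge_zero B])
  qed
  also have "\<dots> = (real (Suc d) * B) * norm z ^ d" by simp
  finally have "(norm (lead_coeff p) * norm z) * norm z ^ d \<le> (real (Suc d) * B) * norm z ^ d" by (simp add: mult_ac)
  then have "norm (lead_coeff p) * norm z \<le> real (Suc d) * B" 
    by (rule mult_right_le_imp_le) (use False in \<open>intro zero_less_power, linarith\<close>)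
  then have "norm z \<le> real (Suc d) * B / norm (lead_coeff p)" using c by (simp add: field_simps)
  then show ?thesis by linarith
qed simp

text \<open>An arbitrary enumeration of zeros need not converge, but symmetric sums do. Along a
  subsequence violating the limit, the bounded roots converge further to some \<open>t\<close>. The
  limit polynomial then has both root lists \<open>s\<close> and \<open>t\<close>, and the sums
  coincide because they depend only on multiplicities.\<close>

lemma root_sum_tendsto:
  fixes r :: "nat \<Rightarrow> nat \<Rightarrow> complex" and \<phi> :: "complex \<Rightarrow> real"
  assumes \<phi>: "continuous_on UNIV \<phi>" and c: "c \<noteq> 0"
    and pm: "\<And>m. pm m = Polynomial.smult c (\<Prod>j<d. [:- r m j, 1:])"
    and p: "p = Polynomial.smult c (\<Prod>j<d. [:- s j, 1:])"
    and lim: "\<And>l. (\<lambda>m. coeff (pm m) l) \<longlonglongrightarrow> coeff p l"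
  shows "(\<lambda>m. \<Sum>j<d. \<phi> (r m j)) \<longlonglongrightarrow> (\<Sum>j<d. \<phi> (s j))"
proof (rule ccontr)
  have deg: "degree (pm m) = d" "lead_coeff (pm m) = c" for m
  proof -
    show "degree (pm m) = d" using c by (simp add: pm degree_prod_sum_eq)
    show "lead_coeff (pm m) = c" unfolding pm lead_coeff_smult lead_coeff_prod by simp
  qed
  have "\<exists>B. \<forall>m j. j < d \<longrightarrow> norm (r m j) \<le> B"
  proof (cases d)
    case (Suc e)
    have "\<exists>b. \<forall>m. norm (coeff (pm m) l) \<le> b" for l
      using convergent_imp_Bseq[OF convergentI[OF lim[of l]]] by (auto simp: Bseq_def)
    then obtain b where b: "\<And>l m. norm (coeff (pm m) l) \<le> b l" by metis
    define B where "B = (\<Sum>l\<le>d. \<bar>b l\<bar>)"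
    have B: "norm (coeff (pm m) l) \<le> B" for m l
    proof (cases "l \<le> d")
      case True
      have "norm (coeff (pm m) l) \<le> \<bar>b l\<bar>" using b[of m l] by linarith
      also have "\<dots> \<le> B" unfolding B_def using True by (intro member_le_sum) auto
      finally show ?thesis .
    next
      case False
      then show ?thesis using deg(1)[of m] by (simp add: coeff_eq_0 B_def sum_nonneg)
    qed
    have "norm (r m j) \<le> max 1 (real (Suc e) * B / norm c)" if "j < d" for m j
    proof -
      have "poly (pm m) (r m j) = 0" using that by (auto simp: pm poly_prod)
      from root_norm_le[OF this deg(1)[unfolded Suc] B] show ?thesis using deg(2)[of m] by simp
    qed
    then show ?thesis by blast
  qed simp
  then obtain B where B: "\<And>m j. j < d \<Longrightarrow> norm (r m j) \<le> B" by blast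
  assume "\<not> ?thesis"
  then obtain e where e: "0 < e" "\<not> (\<forall>\<^sub>F m in sequentially. dist (\<Sum>j<d. \<phi> (r m j)) (\<Sum>j<d. \<phi> (s j)) < e)"
    by (auto simp: tendsto_iff)
  then have "\<exists>\<^sub>F m in sequentially. e \<le> dist (\<Sum>j<d. \<phi> (r m j)) (\<Sum>j<d. \<phi> (s j))"
    by (simp add: frequently_def not_le)
  then have inf: "infinite {m. e \<le> dist (\<Sum>j<d. \<phi> (r m j)) (\<Sum>j<d. \<phi> (s j))}"
    by (simp add: frequently_cofinite[symmetric] cofinite_eq_sequentially)
  obtain \<sigma> where \<sigma>: "strict_mono (\<sigma> :: nat \<Rightarrow> nat)" "\<And>m. e \<le> dist (\<Sum>j<d. \<phi> (r (\<sigma> m) j)) (\<Sum>j<d. \<phi> (s j))"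
    using infinite_enumerate[OF inf] by blast
  obtain \<tau> t where \<tau>: "strict_mono (\<tau> :: nat \<Rightarrow> nat)" "\<forall>j<d. (\<lambda>m. r (\<sigma> (\<tau> m)) j) \<longlonglongrightarrow> t j"
    using finite_coordinates_convergent_subsequence[of d "\<lambda>m. r (\<sigma> m)" B] B by blast
  have "p = Polynomial.smult c (\<Prod>j<d. [:- t j, 1:])"
  proof (rule poly_eq_poly_eq_iff[THEN iffD1], rule ext)
    fix z :: complex
    have "(\<lambda>m. poly (pm (\<sigma> (\<tau> m))) z) \<longlonglongrightarrow> c * (\<Prod>j<d. z - t j)"
      unfolding pm using \<tau>(2) by (auto simp: poly_prod intro!: tendsto_intros)
    moreover have "(\<lambda>m. poly (pm m) z) \<longlonglongrightarrow> poly p z"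
    proof -
      have dp: "degree p \<le> d" using c by (simp add: p degree_prod_sum_eq)
      have "poly q z = (\<Sum>l\<le>d. coeff q l * z ^ l)" if "degree q \<le> d" for q
        unfolding poly_altdef using that by (intro sum.mono_neutral_left) (auto simp: coeff_eq_0)
      then show ?thesis using dp deg(1) lim by (simp, intro tendsto_intros) auto
    qed
    then have "(\<lambda>m. poly (pm (\<sigma> (\<tau> m))) z) \<longlonglongrightarrow> poly p z"
      using LIMSEQ_subseq_LIMSEQ[of "\<lambda>m. poly (pm m) z" _ "\<sigma> \<circ> \<tau>"] strict_mono_o[OF \<sigma>(1) \<tau>(1)] by (simp add: o_def)
    ultimately have "poly p z = c * (\<Prod>j<d. z - t j)" by (rule LIMSEQ_unique[rotated])
    then show "poly p z = poly (Polynomial.smult c (\<Prod>j<d. [:- t j, 1:])) z" by (simp add: poly_prod)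
  qed
  then have "(\<Sum>j<d. \<phi> (s j)) = (\<Sum>j<d. \<phi> (t j))"
    using sum_order_eq_sum_roots[OF c p, of \<phi>] sum_order_eq_sum_roots[where d=d and r=t and p=p and c=c and \<phi>=\<phi>, OF c] by simp
  moreover have "(\<lambda>m. \<Sum>j<d. \<phi> (r (\<sigma> (\<tau> m)) j)) \<longlonglongrightarrow> (\<Sum>j<d. \<phi> (t j))"
    using \<tau>(2) \<phi> by (intro tendsto_sum) (auto simp: continuous_on_eq_continuous_at isCont_def intro!: isCont_tendsto_compose[where g=\<phi>])
  ultimately have "(\<lambda>m. dist (\<Sum>j<d. \<phi> (r (\<sigma> (\<tau> m)) j)) (\<Sum>j<d. \<phi> (s j))) \<longlonglongrightarrow> 0"
    by (simp add: tendsto_dist_iff[symmetric])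
  then have "e \<le> 0" by (rule LIMSEQ_le_const) (use \<sigma>(2) in auto)
  then show False using e by simp
qed

lemma coeff_prod_linear_tendsto:
  assumes "finite I" "\<And>i. i \<in> I \<Longrightarrow> (\<lambda>m. x m i) \<longlonglongrightarrow> (y i :: complex)"
  shows "(\<lambda>m. coeff (\<Prod>i\<in>I. [:- x m i, 1:]) l) \<longlonglongrightarrow> coeff (\<Prod>i\<in>I. [:- y i, 1:]) l"
  using assms
proof (induction I arbitrary: l rule: finite_induct)
  case (insert i I)
  have IH: "(\<lambda>m. coeff (\<Prod>i\<in>I. [:- x m i, 1:]) l) \<longlonglongrightarrow> coeff (\<Prod>i\<in>I. [:- y i, 1:]) l" for l
    using insert by auto
  have xi: "(\<lambda>m. x m i) \<longlonglongrightarrow> y i" using insert.prems by auto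
  have split: "coeff (\<Prod>i\<in>insert i I. [:- u i, 1:]) l =
      (case l of 0 \<Rightarrow> 0 | Suc l' \<Rightarrow> coeff (\<Prod>i\<in>I. [:- u i, 1:]) l') - u i * coeff (\<Prod>i\<in>I. [:- u i, 1:]) l" for u :: "_ \<Rightarrow> complex"
    using insert.hyps by (cases l) auto
  show ?case unfolding split by (cases l) (auto intro!: tendsto_intros IH xi)
qed simp

section \<open>Measurability of integrals against the zeros\<close>

lemma integral_empirical_zeros:
  fixes \<phi> :: "complex \<Rightarrow> real"
  assumes k: "k \<le> n" and \<phi>: "\<phi> \<in> borel_measurable borel"
    and r: "(pderiv ^^ k) (\<Prod>i=1..n. [:- X i \<omega>, 1:])
      = Polynomial.smult (of_nat (pochhammer (Suc (n - k)) k)) (\<Prod>j<n - k. [:- r j, 1:])"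
  shows "(\<integral>z. \<phi> z \<partial>empirical_zeros X n k \<omega>) = (\<Sum>j<n - k. \<phi> (r j)) / real (n - k)"
proof -
  have c: "of_nat (pochhammer (Suc (n - k)) k) \<noteq> (0 :: complex)"
    using pochhammer_bounds(1)[OF k] by (metis not_one_le_zero of_nat_eq_0_iff)
  have nz: "(pderiv ^^ k) (random_poly X n \<omega>) \<noteq> 0"
    unfolding random_poly_def r using c by (auto simp: prod_zero_iff)
  show ?thesis
    unfolding empirical_zeros_def integral_zeros_measure[OF nz \<phi>]
    using sum_order_eq_sum_roots[OF c r[folded random_poly_def], of \<phi>] by simp
qed

text \<open>Although \<open>r\<close> is an arbitrary choice, the sum \<open>F\<close> over the
  zeros is continuous in the points, in the product topology on sequences; it is composed with the
  measurable map from \<omega> to the sequence of points.\<close>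

lemma integral_empirical_zeros_measurable:
  fixes \<phi> :: "complex \<Rightarrow> real"
  assumes \<phi>: "continuous_on UNIV \<phi>" and X: "\<And>i. i \<ge> 1 \<Longrightarrow> X i \<in> borel_measurable M"
  shows "(\<lambda>\<omega>. \<integral>z. \<phi> z \<partial>empirical_zeros X n k \<omega>) \<in> borel_measurable M"
proof (cases "k \<le> n")
  case False
  \<comment> \<open>Measurability is required for every \<open>n\<close>, also where
    \<open>k n < n\<close> is not assumed. For \<open>k > n\<close> the derivative is 0, and the
    integral does not depend on \<omega>.\<close>
  have "(pderiv ^^ k) (random_poly X n \<omega>) = 0" for \<omega>
  proof (rule poly_eqI)
    fix l
    have "degree (random_poly X n \<omega>) = n" unfolding random_poly_def by (subst degree_prod_sum_eq) auto
    then show "coeff ((pderiv ^^ k) (random_poly X n \<omega>)) l = coeff 0 l"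
      using False by (simp add: coeff_higher_pderiv coeff_eq_0)
  qed
  then show ?thesis by (simp add: empirical_zeros_def)
next
  case True
  define c :: complex where "c = of_nat (pochhammer (Suc (n - k)) k)"
  have c: "c \<noteq> 0" using pochhammer_bounds(1)[OF True] unfolding c_def by (metis not_one_le_zero of_nat_eq_0_iff)
  have "\<exists>r. (pderiv ^^ k) (\<Prod>i=1..n. [:- x i, 1:]) = Polynomial.smult c (\<Prod>j<n - k. [:- r j, 1:])" for x
    unfolding c_def using higher_pderiv_factorization[OF True] by metis
  then obtain r where r: "\<And>x. (pderiv ^^ k) (\<Prod>i=1..n. [:- x i, 1:]) = Polynomial.smult c (\<Prod>j<n - k. [:- r x j, 1:])"
    by metis
  define F where "F x = (\<Sum>j<n - k. \<phi> (r x j))" for x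
  have "continuous_on UNIV F"
  proof (rule continuous_on_sequentiallyI)
    fix u :: "nat \<Rightarrow> nat \<Rightarrow> complex" and x assume u: "u \<longlonglongrightarrow> x"
    have ui: "(\<lambda>m. u m i) \<longlonglongrightarrow> x i" for i
      using continuous_on_tendsto_compose[OF continuous_on_product_coordinates u] by simp
    show "(\<lambda>m. F (u m)) \<longlonglongrightarrow> F x" unfolding F_def
    proof (rule root_sum_tendsto[OF \<phi> c r r])
      fix l
      show "(\<lambda>m. coeff ((pderiv ^^ k) (\<Prod>i=1..n. [:- u m i, 1:])) l) \<longlonglongrightarrow> coeff ((pderiv ^^ k) (\<Prod>i=1..n. [:- x i, 1:])) l"
        unfolding coeff_higher_pderiv by (intro tendsto_intros coeff_prod_linear_tendsto ui) auto
    qed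
  qed
  then have F: "F \<in> borel_measurable borel" by (rule borel_measurable_continuous_onI)
  \<comment> \<open>Measurability of \<open>X\<close> is assumed only from index 1 on, so coordinate
    0 is set to 0.\<close>
  define x where "x \<omega> i = (if i \<ge> 1 then X i \<omega> else 0)" for \<omega> i
  have x: "x \<in> borel_measurable M"
  proof (rule measurable_coordinatewise_then_product)
    show "(\<lambda>\<omega>. x \<omega> i) \<in> borel_measurable M" for i
      unfolding x_def using X[of i] by (cases "i \<ge> 1") simp_all
  qed
  have "(\<lambda>\<omega>. F (x \<omega>) / real (n - k)) \<in> borel_measurable M"
    using measurable_compose[OF x F] by (intro borel_measurable_divide) auto
  also have "(\<lambda>\<omega>. F (x \<omega>) / real (n - k)) = (\<lambda>\<omega>. \<integral>z. \<phi> z \<partial>empirical_zeros X n k \<omega>)"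
  proof
    fix \<omega>
    have eq: "(\<Prod>i=1..n. [:- X i \<omega>, 1:]) = (\<Prod>i=1..n. [:- x \<omega> i, 1:])"
      by (intro prod.cong) (auto simp: x_def)
    show "F (x \<omega>) / real (n - k) = (\<integral>z. \<phi> z \<partial>empirical_zeros X n k \<omega>)"
      unfolding F_def
      by (rule integral_empirical_zeros[where X=X and \<omega>=\<omega> and r="r (x \<omega>)" and n=n and k=k, OF True borel_measurable_continuous_onI[OF \<phi>] r[of "x \<omega>", folded eq, unfolded c_def], symmetric])
  qed
  finally show ?thesis .
qed

section \<open>Convergence of the empirical measures\<close>

lemma (in prob_space) law_of_large_numbers_bounded:
  fixes X :: "nat \<Rightarrow> 'a \<Rightarrow> complex" and \<psi> :: "complex \<Rightarrow> real" and \<delta> :: real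
  assumes ind: "indep_vars (\<lambda>_. borel) X {1..}"
    and law: "\<And>i. i \<ge> 1 \<Longrightarrow> distr M borel (X i) = \<mu>"
    and \<psi>: "\<psi> \<in> borel_measurable borel" "\<And>x. \<bar>\<psi> x\<bar> \<le> B" and \<delta>: "\<delta> > 0"
  shows "asymp_null (\<lambda>n. {\<omega>. \<bar>(\<Sum>i=1..n. \<psi> (X i \<omega>)) - n * (\<integral>x. \<psi> x \<partial>\<mu>)\<bar> > \<delta> * n})"
proof -
  have rv [measurable]: "X i \<in> borel_measurable M" if "i \<ge> 1" for i
    using ind that by (auto simp: indep_vars_def)
  note [measurable] = \<psi>(1)
  \<comment> \<open>\<open>B\<close> may be 0; a positive bound keeps the denominator in Hoeffding's
    inequality nonzero.\<close>
  define C where "C = B + 1"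
  have C: "0 < C" "\<bar>\<psi> x\<bar> \<le> C" for x using \<psi>(2)[of 0] \<psi>(2)[of x] by (auto simp: C_def)
  have mean: "expectation (\<lambda>\<omega>. \<psi> (X i \<omega>)) = (\<integral>x. \<psi> x \<partial>\<mu>)" if "i \<ge> 1" for i
    unfolding law[OF that, symmetric] by (rule integral_distr[OF rv[OF that] \<psi>(1), symmetric])
  define S where "S n = {\<omega>\<in>space M. \<delta> * n \<le> \<bar>(\<Sum>i=1..n. \<psi> (X i \<omega>)) - n * (\<integral>x. \<psi> x \<partial>\<mu>)\<bar>}" for n :: nat
  have Se: "S n \<in> events" for n unfolding S_def by measurable
  have "(\<lambda>n. prob (S n)) \<longlonglongrightarrow> 0"
  proof (rule Lim_null_comparison)
    show "(\<lambda>n. 2 * exp (-2 * (\<delta> * real n)\<^sup>2 / (real n * (2 * C)\<^sup>2))) \<longlonglongrightarrow> 0"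
      using C(1) \<delta> by real_asymp
    show "\<forall>\<^sub>F n in sequentially. norm (prob (S n)) \<le> 2 * exp (-2 * (\<delta> * real n)\<^sup>2 / (real n * (2 * C)\<^sup>2))"
      using eventually_gt_at_top[of 0]
    proof eventually_elim
      case (elim n)
      have "indep_vars (\<lambda>_. borel) (\<lambda>i \<omega>. \<psi> (X i \<omega>)) {1..n}"
        by (rule indep_vars_compose2[OF indep_vars_subset[OF ind]]) auto
      then interpret H: Hoeffding_ineq M "{1..n}" "\<lambda>i \<omega>. \<psi> (X i \<omega>)" "\<lambda>_. - C" "\<lambda>_. C" "\<Sum>i=1..n. expectation (\<lambda>\<omega>. \<psi> (X i \<omega>))"
        by unfold_locales (use C in \<open>auto simp: abs_le_iff minus_le_iff\<close>)
      have m: "(\<Sum>i=1..n. expectation (\<lambda>\<omega>. \<psi> (X i \<omega>))) = n * (\<integral>x. \<psi> x \<partial>\<mu>)" using mean by simp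
      have "prob (S n) \<le> 2 * exp (-2 * (\<delta> * real n)\<^sup>2 / (\<Sum>i=1..n. (C - - C)\<^sup>2))"
        using H.Hoeffding_ineq_abs_ge[of "\<delta> * real n"] elim C(1) \<delta> unfolding S_def m by simp
      also have "(\<Sum>i=1..n. (C - - C)\<^sup>2) = real n * (2 * C)\<^sup>2" by simp
      finally show ?case by simp
    qed
  qed
  with Se have "asymp_null S" by (rule asymp_nullI)
  then show ?thesis by (rule asymp_null_mono) (auto simp: S_def intro!: always_eventually)
qed

definition deviation ::
  "(nat \<Rightarrow> nat) \<Rightarrow> (nat \<Rightarrow> 'a \<Rightarrow> nat \<Rightarrow> complex) \<Rightarrow> complex measure \<Rightarrow> (complex \<Rightarrow> real) \<Rightarrow> real \<Rightarrow> nat \<Rightarrow> 'a set" where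
  "deviation d \<zeta> \<mu> \<phi> \<delta> n = {\<omega>. \<delta> < \<bar>(\<Sum>j<d n. \<phi> (\<zeta> n \<omega> j)) / real (d n) - (\<integral>x. \<phi> x \<partial>\<mu>)\<bar>}"

text \<open>A tent is a difference of two potentials, so its sum over the zeros is close to its sum
  over the X_i, to which the law of large numbers applies. Passing from n to n - k in the
  normalisation costs k |I|, at most of order ln n.\<close>

lemma (in prob_space) root_average_tent:
  fixes X :: "nat \<Rightarrow> 'a \<Rightarrow> complex" and r :: "nat \<Rightarrow> 'a \<Rightarrow> nat \<Rightarrow> complex"
  assumes ind: "indep_vars (\<lambda>_. borel) X {1..}"
    and law: "\<And>i. i \<ge> 1 \<Longrightarrow> distr M borel (X i) = \<mu>"
    and k: "\<forall>\<^sub>F n in sequentially. 1 \<le> k n \<and> real (k n) \<le> ln (real n)"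
    and r: "\<And>n \<omega>. k n \<le> n \<Longrightarrow> (pderiv ^^ k n) (\<Prod>i=1..n. [:- X i \<omega>, 1:])
      = Polynomial.smult (of_nat (pochhammer (Suc (n - k n)) (k n))) (\<Prod>j<n - k n. [:- r n \<omega> j, 1:])"
    and good: "good_radius \<mu> a R" "good_radius \<mu> a \<rho>" and \<delta>: "\<delta> > 0"
  shows "asymp_null (deviation (\<lambda>n. n - k n) r \<mu> (tent a R \<rho>) \<delta>)"
proof -
  let ?Q = "\<lambda>R \<omega> n. \<bar>(\<Sum>j<n - k n. ln (cmax a R (r n \<omega> j))) - (\<Sum>i=1..n. ln (cmax a R (X i \<omega>)))\<bar>"
  let ?T = "\<lambda>n \<omega>. \<Sum>j<n - k n. tent a R \<rho> (r n \<omega> j)"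
  let ?L = "\<lambda>\<omega> n. \<bar>(\<Sum>i=1..n. tent a R \<rho> (X i \<omega>)) - real n * (\<integral>x. tent a R \<rho> x \<partial>\<mu>)\<bar>"
  \<comment> \<open>Four errors of size \<epsilon> n (two radii, the law of large numbers, the
    normalisation) have to fit below \<delta> (n - k) >= \<delta> n / 2.\<close>
  define \<epsilon> where "\<epsilon> = \<delta> / 12"
  have \<epsilon>: "\<epsilon> > 0" using \<delta> by (simp add: \<epsilon>_def)
  have R: "0 < R" "0 < \<rho>" using good by (auto simp: good_radius_def)
  define I where "I = (\<integral>x. tent a R \<rho> x \<partial>\<mu>)"
  have m: "tent a R \<rho> \<in> borel_measurable borel" using continuous_on_tent[OF R] by (rule borel_measurable_continuous_onI)
  have lln: "asymp_null (\<lambda>n. {\<omega>. ?L \<omega> n > \<epsilon> * real n})"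
    by (rule law_of_large_numbers_bounded[OF ind law m abs_tent_le[OF R] \<epsilon>])
  have "asymp_null (\<lambda>n. {\<omega>. ?Q R \<omega> n > \<epsilon> * real n} \<union>
    ({\<omega>. ?Q \<rho> \<omega> n > \<epsilon> * real n} \<union>
     {\<omega>. ?L \<omega> n > \<epsilon> * real n}))"
    by (intro asymp_null_Un log_potential_difference[OF ind law k r] good \<epsilon> lln)
  then show ?thesis
  proof (rule asymp_null_mono)
    have "\<forall>\<^sub>F n in sequentially. ln (real n) \<le> real n / 2" by real_asymp
    moreover have "\<forall>\<^sub>F n in sequentially. \<bar>I\<bar> * ln (real n) \<le> \<epsilon> * real n" using \<epsilon> by real_asymp
    ultimately show "\<forall>\<^sub>F n in sequentially. deviation (\<lambda>n. n - k n) r \<mu> (tent a R \<rho>) \<delta> n \<inter> space M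
     \<subseteq> {\<omega>. ?Q R \<omega> n > \<epsilon> * real n} \<union>
    ({\<omega>. ?Q \<rho> \<omega> n > \<epsilon> * real n} \<union>
     {\<omega>. ?L \<omega> n > \<epsilon> * real n})"
      using k eventually_gt_at_top[of 0]
    proof eventually_elim
      case (elim n)
      have kn: "real (k n) \<le> real n / 2" using elim by linarith
      have d: "real (n - k n) = real n - real (k n)" using kn by (subst of_nat_diff) auto
      have dpos: "real n / 2 \<le> real (n - k n)" "0 < real (n - k n)" using d kn elim by linarith+
      have kI: "real (k n) * \<bar>I\<bar> \<le> \<epsilon> * real n"
      proof -
        have "real (k n) * \<bar>I\<bar> \<le> ln (real n) * \<bar>I\<bar>" using elim by (intro mult_right_mono) auto
        then show ?thesis using elim by (simp add: mult.commute)
      qed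
      have *: "\<bar>?T n \<omega> / real (n - k n) - I\<bar> \<le> \<delta>"
        if w: "?Q R \<omega> n \<le> \<epsilon> * real n"
          "?Q \<rho> \<omega> n \<le> \<epsilon> * real n"
          "?L \<omega> n \<le> \<epsilon> * real n" for \<omega>
      proof -
        have s: "?T n \<omega> = (\<Sum>j<n - k n. ln (cmax a R (r n \<omega> j))) - (\<Sum>j<n - k n. ln (cmax a \<rho> (r n \<omega> j)))"
          "(\<Sum>i=1..n. tent a R \<rho> (X i \<omega>)) = (\<Sum>i=1..n. ln (cmax a R (X i \<omega>))) - (\<Sum>i=1..n. ln (cmax a \<rho> (X i \<omega>)))"
          unfolding tent_def sum_subtractf by simp_all
        have dI: "real (n - k n) * I = n * I - real (k n) * I" unfolding d by (simp add: algebra_simps)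
        have "\<bar>real (k n) * I\<bar> \<le> \<epsilon> * real n" using kI by (simp add: abs_mult)
        then have "\<bar>?T n \<omega> - real (n - k n) * I\<bar> \<le> 4 * (\<epsilon> * n)"
          using w[folded I_def] unfolding dI s by linarith
        also have "4 * (\<epsilon> * n) \<le> \<delta> * real (n - k n)"
        proof -
          have "\<delta> * (real n / 2) \<le> \<delta> * real (n - k n)" using dpos \<delta> by (intro mult_left_mono) auto
          moreover have "4 * (\<epsilon> * n) \<le> \<delta> * (real n / 2)" using \<delta> by (simp add: \<epsilon>_def)
          ultimately show ?thesis by linarith
        qed
        finally have "\<bar>?T n \<omega> - real (n - k n) * I\<bar> / real (n - k n) \<le> \<delta>"
          using dpos(2) by (simp add: divide_le_eq)
        moreover have "\<bar>?T n \<omega> - real (n - k n) * I\<bar> / real (n - k n)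
          = \<bar>(?T n \<omega> - real (n - k n) * I) / real (n - k n)\<bar>" by simp
        moreover have "(?T n \<omega> - real (n - k n) * I) / real (n - k n)
          = ?T n \<omega> / real (n - k n) - I" using dpos(2) by (simp add: diff_divide_distrib)
        ultimately show ?thesis by simp
      qed
      show ?case
      proof (rule subsetI, rule ccontr, unfold Un_iff de_Morgan_disj mem_Collect_eq not_less, elim conjE)
        fix \<omega> assume "\<omega> \<in> deviation (\<lambda>n. n - k n) r \<mu> (tent a R \<rho>) \<delta> n \<inter> space M"
          and w: "?Q R \<omega> n \<le> \<epsilon> * real n"
          "?Q \<rho> \<omega> n \<le> \<epsilon> * real n"
          "?L \<omega> n \<le> \<epsilon> * real n"
        then show False using *[OF w] by (simp add: I_def deviation_def)
      qed
    qed
  qed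
qed

lemma average_diff_le:
  fixes f g :: "nat \<Rightarrow> real"
  assumes "\<And>j. j < d \<Longrightarrow> \<bar>f j - g j\<bar> \<le> e" "0 \<le> e"
  shows "\<bar>(\<Sum>j<d. f j) / real d - (\<Sum>j<d. g j) / real d\<bar> \<le> e"
proof (cases "d = 0")
  case False
  have "\<bar>(\<Sum>j<d. f j) - (\<Sum>j<d. g j)\<bar> \<le> (\<Sum>j<d. \<bar>f j - g j\<bar>)"
    unfolding sum_subtractf[symmetric] by (rule sum_abs)
  also have "\<dots> \<le> (\<Sum>j<d. e)" using assms(1) by (intro sum_mono) auto
  finally have "\<bar>(\<Sum>j<d. f j) - (\<Sum>j<d. g j)\<bar> \<le> d * e" by simp
  moreover have "\<bar>(\<Sum>j<d. f j) / real d - (\<Sum>j<d. g j) / real d\<bar> = \<bar>(\<Sum>j<d. f j) - (\<Sum>j<d. g j)\<bar> / real d"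
    by (simp add: diff_divide_distrib[symmetric])
  ultimately show ?thesis using False by (simp add: divide_le_eq mult.commute)
qed (use assms in simp)

text \<open>Uniform approximation by a tent combination costs \<delta>/4 in each of the two
  averages. Deviations up to \<eta> of the finitely many tents, weighted by the coefficients, cost
  another \<delta>/4.\<close>

lemma (in prob_space) root_average_compact_support:
  fixes \<zeta> :: "nat \<Rightarrow> 'a \<Rightarrow> nat \<Rightarrow> complex" and \<phi> :: "complex \<Rightarrow> real"
  assumes \<mu>: "prob_space \<mu>" and s: "sets \<mu> = sets borel"
    and tents: "\<And>a R r \<delta>. good_radius \<mu> a R \<Longrightarrow> good_radius \<mu> a r \<Longrightarrow> \<delta> > 0 \<Longrightarrow>
      asymp_null (deviation d \<zeta> \<mu> (tent a R r) \<delta>)"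
    and \<phi>: "continuous_on UNIV \<phi>" and S: "\<forall>z. S < norm z \<longrightarrow> \<phi> z = 0" and B: "\<And>z. \<bar>\<phi> z\<bar> \<le> B" and \<delta>: "\<delta> > 0"
  shows "asymp_null (deviation d \<zeta> \<mu> \<phi> \<delta>)"
proof -
  let ?A = "\<lambda>n \<omega> \<phi>. (\<Sum>j<d n. \<phi> (\<zeta> n \<omega> j)) / real (d n)"
  interpret \<mu>: prob_space \<mu> by fact
  have \<delta>4: "0 < \<delta> / 4" using \<delta> by simp
  obtain N :: nat and p c R r where good: "\<And>i. 0 < R i \<and> 0 < r i \<and> good_radius \<mu> (p i) (R i) \<and> good_radius \<mu> (p i) (r i)"
    and app: "\<And>w. \<bar>\<phi> w - (\<Sum>i<N. c i * tent (p i) (R i) (r i) w)\<bar> \<le> \<delta> / 4"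
    using good_tent_combination_approximation[OF \<phi> S \<delta>4, of "good_radius \<mu>"] good_radius_exists[OF \<mu> s] by blast
  define T where "T i = tent (p i) (R i) (r i)" for i
  let ?C = "\<lambda>x. \<Sum>i<N. c i * T i x"
  define C where "C = (\<Sum>i<N. \<bar>c i\<bar>) + 1"
  have C: "0 < C" unfolding C_def by (intro add_nonneg_pos sum_nonneg) auto
  define \<eta> where "\<eta> = \<delta> / (4 * C)"
  have \<eta>: "0 < \<eta>" using \<delta> C by (simp add: \<eta>_def)
  have Tint: "integrable \<mu> (T i)" for i
  proof (rule \<mu>.integrable_const_bound[where B="\<bar>ln (R i) - ln (r i)\<bar>"])
    show "AE x in \<mu>. norm (T i x) \<le> \<bar>ln (R i) - ln (r i)\<bar>"
      unfolding T_def using good[of i] by (auto intro!: abs_tent_le)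
    have "T i \<in> borel_measurable borel"
      unfolding T_def using good[of i] by (intro borel_measurable_continuous_onI continuous_on_tent) auto
    then show "T i \<in> borel_measurable \<mu>" using s by (simp cong: measurable_cong_sets)
  qed
  have \<phi>int: "integrable \<mu> \<phi>"
  proof (rule \<mu>.integrable_const_bound[where B=B])
    show "\<phi> \<in> borel_measurable \<mu>" using borel_measurable_continuous_onI[OF \<phi>] s by (simp cong: measurable_cong_sets)
  qed (use B in auto)
  have "asymp_null (\<lambda>n. \<Union>i\<in>{..<N}. deviation d \<zeta> \<mu> (T i) \<eta> n)"
    unfolding T_def using good \<eta> by (intro asymp_null_UN tents) auto
  then show ?thesis
  proof (rule asymp_null_mono, intro always_eventually allI subsetI)
    fix n \<omega> assume w: "\<omega> \<in> deviation d \<zeta> \<mu> \<phi> \<delta> n \<inter> space M"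
    show "\<omega> \<in> (\<Union>i\<in>{..<N}. deviation d \<zeta> \<mu> (T i) \<eta> n)"
    proof (rule ccontr)
      assume "\<not> ?thesis"
      then have le: "\<bar>?A n \<omega> (T i) - (\<integral>x. T i x \<partial>\<mu>)\<bar> \<le> \<eta>" if "i < N" for i
        using that by (auto simp: not_less deviation_def)
      have avg: "?A n \<omega> ?C = (\<Sum>i<N. c i * (?A n \<omega> (T i)))"
        by (subst sum.swap) (simp add: sum_divide_distrib sum_distrib_left)
      have int: "(\<integral>x. ?C x \<partial>\<mu>) = (\<Sum>i<N. c i * (\<integral>x. T i x \<partial>\<mu>))"
        using Tint by (subst Bochner_Integration.integral_sum) auto
      have "\<bar>?A n \<omega> ?C - (\<integral>x. ?C x \<partial>\<mu>)\<bar>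
        = \<bar>\<Sum>i<N. c i * (?A n \<omega> (T i) - (\<integral>x. T i x \<partial>\<mu>))\<bar>"
        unfolding avg int by (simp only: sum_subtractf[symmetric] right_diff_distrib)
      also have "\<dots> \<le> (\<Sum>i<N. \<bar>c i\<bar> * \<eta>)"
        using le by (intro order_trans[OF sum_abs] sum_mono) (auto simp: abs_mult intro!: mult_left_mono)
      also have "\<dots> \<le> C * \<eta>" using \<eta> by (simp add: C_def sum_distrib_right[symmetric])
      also have "\<dots> = \<delta> / 4" using C by (simp add: \<eta>_def)
      finally have 1: "\<bar>?A n \<omega> ?C - (\<integral>x. ?C x \<partial>\<mu>)\<bar> \<le> \<delta> / 4" .
      have 2: "\<bar>?A n \<omega> \<phi> - ?A n \<omega> ?C\<bar> \<le> \<delta> / 4"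
        using app \<delta> unfolding T_def by (intro average_diff_le) auto
      have 3: "\<bar>(\<integral>x. \<phi> x \<partial>\<mu>) - (\<integral>x. ?C x \<partial>\<mu>)\<bar> \<le> \<delta> / 4"
      proof -
        have iT: "integrable \<mu> (\<lambda>x. \<Sum>i<N. c i * T i x)" using Tint by auto
        have "(\<integral>x. \<phi> x \<partial>\<mu>) - (\<integral>x. ?C x \<partial>\<mu>) = (\<integral>x. \<phi> x - (\<Sum>i<N. c i * T i x) \<partial>\<mu>)"
          by (rule Bochner_Integration.integral_diff[OF \<phi>int iT, symmetric])
        also have "\<bar>\<dots>\<bar> \<le> (\<integral>x. \<bar>\<phi> x - (\<Sum>i<N. c i * T i x)\<bar> \<partial>\<mu>)" by (rule integral_abs_bound)
        also have "\<dots> \<le> (\<integral>x. \<delta> / 4 \<partial>\<mu>)"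
          using \<phi>int iT app unfolding T_def[symmetric] by (intro Bochner_Integration.integral_mono) auto
        finally show ?thesis by (simp add: \<mu>.prob_space)
      qed
      have "\<bar>?A n \<omega> \<phi> - (\<integral>x. \<phi> x \<partial>\<mu>)\<bar> > \<delta>" using w by (simp add: deviation_def)
      then show False using 1 2 3 \<delta> by linarith
    qed
  qed
qed

text \<open>Tightness comes from the compactly supported case itself: the average of
  \<open>cut m\<close> over the zeros is close to its integral, which is near 1 for large
  \<open>m\<close>. Hence few zeros lie far out, and \<phi> may be replaced by its product with
  \<open>cut m\<close>.\<close>

lemma (in prob_space) root_average_bounded:
  fixes \<zeta> :: "nat \<Rightarrow> 'a \<Rightarrow> nat \<Rightarrow> complex" and \<phi> :: "complex \<Rightarrow> real"
  assumes \<mu>: "prob_space \<mu>" and s: "sets \<mu> = sets borel"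
    and tents: "\<And>a R r \<delta>. good_radius \<mu> a R \<Longrightarrow> good_radius \<mu> a r \<Longrightarrow> \<delta> > 0 \<Longrightarrow>
      asymp_null (deviation d \<zeta> \<mu> (tent a R r) \<delta>)"
    and d: "\<forall>\<^sub>F n in sequentially. 0 < d n"
    and \<phi>: "continuous_on UNIV \<phi>" and B: "\<And>z. \<bar>\<phi> z\<bar> \<le> B" and \<delta>: "\<delta> > 0"
  shows "asymp_null (deviation d \<zeta> \<mu> \<phi> \<delta>)"
proof -
  let ?A = "\<lambda>n \<omega> \<phi>. (\<Sum>j<d n. \<phi> (\<zeta> n \<omega> j)) / real (d n)"
  interpret \<mu>: prob_space \<mu> by fact
  have B0: "0 \<le> B" using B[of 0] by linarith
  define cut where "cut m w = max 0 (min 1 (real m + 1 - norm w))" for m :: nat and w :: complex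
  have cut01: "0 \<le> cut m w" "cut m w \<le> 1" for m w by (auto simp: cut_def)
  have cut_0: "cut m w = 0" if "real m + 1 < norm w" for m w using that by (auto simp: cut_def)
  have cut_c: "continuous_on UNIV (cut m)" for m unfolding cut_def by (intro continuous_intros)
  have meas: "f \<in> borel_measurable \<mu>" if "continuous_on UNIV f" for f :: "complex \<Rightarrow> real"
    using borel_measurable_continuous_onI[OF that] s by (simp cong: measurable_cong_sets)
  have cut_int: "integrable \<mu> (cut m)" for m
    by (rule \<mu>.integrable_const_bound[where B=1]) (use cut01 meas[OF cut_c] in auto)
  have "(\<lambda>m. \<integral>x. cut m x \<partial>\<mu>) \<longlonglongrightarrow> (\<integral>x. 1 \<partial>\<mu>)"
  proof (rule integral_dominated_convergence[where w="\<lambda>_. 1"])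
    have "(\<lambda>m. cut m x) \<longlonglongrightarrow> 1" for x
    proof (rule tendsto_eventually)
      obtain m0 :: nat where "norm x \<le> real m0" using real_arch_simple by blast
      then show "\<forall>\<^sub>F m in sequentially. cut m x = 1"
        by (intro eventually_mono[OF eventually_ge_at_top[of m0]]) (simp add: cut_def)
    qed
    then show "AE x in \<mu>. (\<lambda>m. cut m x) \<longlonglongrightarrow> 1" by simp
  qed (use cut01 meas[OF cut_c] in \<open>auto simp: \<mu>.integrable_const\<close>)
  then have lim: "(\<lambda>m. \<integral>x. cut m x \<partial>\<mu>) \<longlonglongrightarrow> 1" by (simp add: \<mu>.prob_space)
  define \<eta> where "\<eta> = \<delta> / (8 * (B + 1))"
  have \<eta>: "0 < \<eta>" "B * \<eta> \<le> \<delta> / 8"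
  proof -
    show "0 < \<eta>" using \<delta> B0 by (simp add: \<eta>_def)
    then have "B * \<eta> \<le> (B + 1) * \<eta>" by (intro mult_right_mono) auto
    also have "\<dots> = \<delta> / 8" using B0 by (simp add: \<eta>_def field_simps)
    finally show "B * \<eta> \<le> \<delta> / 8" .
  qed
  obtain m where m: "1 - \<eta> < (\<integral>x. cut m x \<partial>\<mu>)"
    using order_tendstoD(1)[OF lim, of "1 - \<eta>"] \<eta>(1) by (auto simp: eventually_sequentially)
  define f where "f w = \<phi> w * cut m w" for w
  have fc: "continuous_on UNIV f" unfolding f_def by (intro continuous_intros \<phi> cut_c)
  have f0: "\<forall>z. real m + 1 < norm z \<longrightarrow> f z = 0" by (simp add: f_def cut_0)
  have fB: "\<bar>f z\<bar> \<le> B" for z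
    using mult_mono[OF B[of z] cut01(2)[of m z]] cut01[of m z] B0 by (simp add: f_def abs_mult)
  have \<phi>int: "integrable \<mu> \<phi>" by (rule \<mu>.integrable_const_bound[where B=B]) (use B meas[OF \<phi>] in auto)
  have fint: "integrable \<mu> f" by (rule \<mu>.integrable_const_bound[where B=B]) (use fB meas[OF fc] in auto)
  have diff: "\<bar>\<phi> w - f w\<bar> \<le> B * (1 - cut m w)" for w
  proof -
    have "\<phi> w - f w = \<phi> w * (1 - cut m w)" by (simp add: f_def algebra_simps)
    then show ?thesis using B[of w] cut01[of m w] by (simp add: abs_mult mult_right_mono)
  qed
  have int: "\<bar>(\<integral>x. \<phi> x \<partial>\<mu>) - (\<integral>x. f x \<partial>\<mu>)\<bar> \<le> \<delta> / 8"
  proof -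
    have "\<bar>(\<integral>x. \<phi> x \<partial>\<mu>) - (\<integral>x. f x \<partial>\<mu>)\<bar> = \<bar>\<integral>x. \<phi> x - f x \<partial>\<mu>\<bar>"
      by (simp only: Bochner_Integration.integral_diff[OF \<phi>int fint])
    also have "\<dots> \<le> (\<integral>x. \<bar>\<phi> x - f x\<bar> \<partial>\<mu>)" by (rule integral_abs_bound)
    also have "\<dots> \<le> (\<integral>x. B * (1 - cut m x) \<partial>\<mu>)"
      using \<phi>int fint cut_int diff by (intro Bochner_Integration.integral_mono) auto
    also have "\<dots> = B * (1 - (\<integral>x. cut m x \<partial>\<mu>))"
      using cut_int by (simp add: Bochner_Integration.integral_diff \<mu>.prob_space)
    also have "\<dots> \<le> B * \<eta>" using m B0 by (intro mult_left_mono) auto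
    finally show ?thesis using \<eta>(2) by linarith
  qed
  have \<delta>4: "0 < \<delta> / 4" using \<delta> by simp
  have cut_B: "\<bar>cut m z\<bar> \<le> 1" for z using cut01[of m z] by simp
  have cut_0': "\<forall>z. real m + 1 < norm z \<longrightarrow> cut m z = 0" using cut_0 by blast
  have "asymp_null (\<lambda>n. deviation d \<zeta> \<mu> f (\<delta> / 4) n \<union>
     deviation d \<zeta> \<mu> (cut m) \<eta> n)"
    by (rule asymp_null_Un[OF root_average_compact_support[OF \<mu> s tents fc f0 fB \<delta>4]
       root_average_compact_support[OF \<mu> s tents cut_c cut_0' cut_B \<eta>(1)]])
  then show ?thesis
  proof (rule asymp_null_mono)
    show "\<forall>\<^sub>F n in sequentially. deviation d \<zeta> \<mu> \<phi> \<delta> n \<inter> space M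
      \<subseteq> deviation d \<zeta> \<mu> f (\<delta> / 4) n \<union>
     deviation d \<zeta> \<mu> (cut m) \<eta> n"
      using d
    proof eventually_elim
      case (elim n)
      have *: "\<bar>?A n \<omega> \<phi> - (\<integral>x. \<phi> x \<partial>\<mu>)\<bar> \<le> \<delta>"
        if w: "\<bar>?A n \<omega> f - (\<integral>x. f x \<partial>\<mu>)\<bar> \<le> \<delta> / 4"
          "\<bar>?A n \<omega> (cut m) - (\<integral>x. cut m x \<partial>\<mu>)\<bar> \<le> \<eta>" for \<omega>
      proof -
        have "\<bar>(\<Sum>j<d n. \<phi> (\<zeta> n \<omega> j)) - (\<Sum>j<d n. f (\<zeta> n \<omega> j))\<bar> \<le> (\<Sum>j<d n. B * (1 - cut m (\<zeta> n \<omega> j)))"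
          unfolding sum_subtractf[symmetric] using diff by (intro order_trans[OF sum_abs] sum_mono) auto
        also have "\<dots> = B * (real (d n) - (\<Sum>j<d n. cut m (\<zeta> n \<omega> j)))"
          by (simp only: sum_distrib_left[symmetric] sum_subtractf) simp
        finally have "\<bar>(\<Sum>j<d n. \<phi> (\<zeta> n \<omega> j)) - (\<Sum>j<d n. f (\<zeta> n \<omega> j))\<bar> / real (d n)
            \<le> B * (real (d n) - (\<Sum>j<d n. cut m (\<zeta> n \<omega> j))) / real (d n)"
          by (rule divide_right_mono) simp
        also have "\<dots> = B * (1 - ?A n \<omega> (cut m))"
          using elim by (simp add: field_simps)
        also have "\<dots> \<le> B * (2 * \<eta>)" using w(2) m B0 by (intro mult_left_mono) linarith+
        also have "\<dots> \<le> \<delta> / 4" using \<eta>(2) by simp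
        finally have "\<bar>?A n \<omega> \<phi> - ?A n \<omega> f\<bar> \<le> \<delta> / 4"
          by (simp add: diff_divide_distrib[symmetric])
        then show ?thesis using w(1) int \<delta> by linarith
      qed
      show ?case
      proof (rule subsetI, rule ccontr, unfold deviation_def Un_iff de_Morgan_disj mem_Collect_eq not_less, elim conjE)
        fix \<omega> assume "\<omega> \<in> {\<omega>. \<delta> < \<bar>?A n \<omega> \<phi> - (\<integral>x. \<phi> x \<partial>\<mu>)\<bar>} \<inter> space M"
          and w: "\<bar>?A n \<omega> f - (\<integral>x. f x \<partial>\<mu>)\<bar> \<le> \<delta> / 4"
          "\<bar>?A n \<omega> (cut m) - (\<integral>x. cut m x \<partial>\<mu>)\<bar> \<le> \<eta>"
        then show False using *[OF w] by simp
      qed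
    qed
  qed
qed

theorem theorem1p1:
  fixes M :: "'a measure" and \<mu> :: "complex measure"
    and X :: "nat \<Rightarrow> 'a \<Rightarrow> complex" and k :: "nat \<Rightarrow> nat"
  assumes "prob_space \<mu>" and "sets \<mu> = sets borel"
    and "prob_space M"
    and "prob_space.indep_vars M (\<lambda>_. borel) X {1..}"
    and "\<And>i. i \<ge> 1 \<Longrightarrow> distr M borel (X i) = \<mu>"
    and "\<And>n. n \<ge> 2 \<Longrightarrow> 0 < k n \<and> k n < n"
    and "\<forall>\<^sub>F n in sequentially. real (k n) \<le> ln (real n) / (5 * ln (ln (real n)))"
  shows "weakly_tendsto_in_prob M (\<lambda>n. empirical_zeros X n (k n)) \<mu>"
proof -
  interpret prob_space M by fact
  have rv: "X i \<in> borel_measurable M" if "i \<ge> 1" for i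
    using assms(4) that by (auto simp: indep_vars_def)
  \<comment> \<open>The form in which the growth assumption on \<open>k\<close> enters the
    estimates.\<close>
  have k: "\<forall>\<^sub>F n in sequentially. 1 \<le> k n \<and> real (k n) \<le> ln (real n)"
  proof -
    have "\<forall>\<^sub>F n in sequentially. ln (real n) / (5 * ln (ln (real n))) \<le> ln (real n)" by real_asymp
    with assms(7) eventually_ge_at_top[of 2] show ?thesis
    proof eventually_elim
      case (elim n)
      then show ?case using assms(6)[of n] by linarith
    qed
  qed
  \<comment> \<open>The zeros are enumerated separately for each \<open>n\<close> and \<omega>, with
    no measurability of the choice; events formed with \<open>r\<close> are handled as outer
    events.\<close>
  have "\<exists>r. k n \<le> n \<longrightarrow> (pderiv ^^ k n) (\<Prod>i=1..n. [:- X i \<omega>, 1:])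
      = Polynomial.smult (of_nat (pochhammer (Suc (n - k n)) (k n))) (\<Prod>j<n - k n. [:- r j, 1:])" for n \<omega>
    using higher_pderiv_factorization[of "k n" n "\<lambda>i. X i \<omega>"] by blast
  then obtain r where r: "\<And>n \<omega>. k n \<le> n \<Longrightarrow> (pderiv ^^ k n) (\<Prod>i=1..n. [:- X i \<omega>, 1:])
      = Polynomial.smult (of_nat (pochhammer (Suc (n - k n)) (k n))) (\<Prod>j<n - k n. [:- r n \<omega> j, 1:])"
    by metis
  show ?thesis
    unfolding weakly_tendsto_in_prob_def tendsto_in_prob_def
  proof (intro allI impI conjI)
    fix \<phi> :: "complex \<Rightarrow> real" assume \<phi>: "continuous_on UNIV \<phi>" "bounded (range \<phi>)"
    then obtain B where B: "\<And>z. \<bar>\<phi> z\<bar> \<le> B" by (auto simp: bounded_iff)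
    show meas: "(\<lambda>\<omega>. \<integral>z. \<phi> z \<partial>empirical_zeros X n (k n) \<omega>) \<in> borel_measurable M" for n
      by (rule integral_empirical_zeros_measurable[OF \<phi>(1) rv])
    fix \<epsilon> :: real assume \<epsilon>: "0 < \<epsilon>"
    have kn: "\<forall>\<^sub>F n in sequentially. k n < n"
      using eventually_ge_at_top[of 2] by eventually_elim (use assms(6) in auto)
    then have d: "\<forall>\<^sub>F n in sequentially. 0 < n - k n" by eventually_elim simp
    have "asymp_null (deviation (\<lambda>n. n - k n) r \<mu> \<phi> \<epsilon>)"
      by (rule root_average_bounded[OF assms(1,2) root_average_tent[OF assms(4,5) k r] d \<phi>(1) B \<epsilon>])
    then have "asymp_null (\<lambda>n. {\<omega>\<in>space M. \<bar>(\<integral>z. \<phi> z \<partial>empirical_zeros X n (k n) \<omega>) - (\<integral>z. \<phi> z \<partial>\<mu>)\<bar> > \<epsilon>})"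
    proof (rule asymp_null_mono)
      show "\<forall>\<^sub>F n in sequentially. {\<omega>\<in>space M. \<bar>(\<integral>z. \<phi> z \<partial>empirical_zeros X n (k n) \<omega>) - (\<integral>z. \<phi> z \<partial>\<mu>)\<bar> > \<epsilon>} \<inter> space M
        \<subseteq> deviation (\<lambda>n. n - k n) r \<mu> \<phi> \<epsilon> n"
        using kn
      proof eventually_elim
        case (elim n)
        have "(\<integral>z. \<phi> z \<partial>empirical_zeros X n (k n) \<omega>) = (\<Sum>j<n - k n. \<phi> (r n \<omega> j)) / real (n - k n)" for \<omega>
          using elim by (intro integral_empirical_zeros borel_measurable_continuous_onI \<phi>(1) r) auto
        then show ?case by (auto simp: deviation_def)
      qed
    qed
    \<comment> \<open>The deviation event of the integrals is measurable by \<open>meas\<close>, so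
      the outer estimate bounds its actual probability.\<close>
    then show "(\<lambda>n. measure M {\<omega>\<in>space M. \<bar>(\<integral>z. \<phi> z \<partial>empirical_zeros X n (k n) \<omega>) - (\<integral>z. \<phi> z \<partial>\<mu>)\<bar> > \<epsilon>}) \<longlonglongrightarrow> 0"
      by (rule asymp_null_tendsto) (use meas in measurable)
  qed simp
qed

end
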